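(* Let $ABC$ be a right triangle and let $T$ be similar to $ABC$. Let $\alpha$ be the smallest angle of $T$, and let $N$ be a positive integer. Then: (i) If $\tan\alpha$ is rational, then $ABC$ can be $N$-tiled by $T$ if and only if $N$ is a square, or $N = e^2+f^2$ for integers $e$ and $f$ such that $\tan\alpha = e/f$. (ii) If $\alpha = \pi/6$, then $ABC$ can be $N$-tiled by $T$ if $N$ is a square or three times a square, and for no other values of $N$. (iii) If $\tan\alpha$ is not rational and $\alpha \neq \pi/6$, then $ABC$ can be $N$-tiled by $T$ if and only if $N$ is a square.
   Context: An $N$-tiling of a triangle $ABC$ by a triangle $T$ (the tile) is a set of $N$ triangles $T_1,\dots,T_N$, each congruent to $T$ (reflections allowed), with pairwise disjoint interiors, whose union is the closed triangle $ABC$. Tiles need not meet edge-to-edge. Here only the shape of the tile is prescribed: "$ABC$ can be $N$-tiled by $T$" means that there is an $N$-tiling of $ABC$ by some triangle of the same shape as (similar to) $T$; its size is then forced by $N$, its area being $1/N$ of that of $ABC$. *)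

theory Defs
  imports "HOL-Analysis.Analysis"
begin

type_synonym point = "real ^ 2"

definition nondegenerate_triangle :: "point \<Rightarrow> point \<Rightarrow> point \<Rightarrow> bool" where
  "nondegenerate_triangle A B C \<longleftrightarrow> \<not> collinear {A, B, C}"

definition closed_triangle :: "point \<Rightarrow> point \<Rightarrow> point \<Rightarrow> point set" where
  "closed_triangle A B C = convex hull {A, B, C}"

(* The unoriented angle at the vertex Q (the middle argument), in radians. *)
definition angle_at :: "point \<Rightarrow> point \<Rightarrow> point \<Rightarrow> real" where
  "angle_at P Q R = arccos (((P - Q) \<bullet> (R - Q)) / (norm (P - Q) * norm (R - Q)))"

definition triangle_angles :: "point \<Rightarrow> point \<Rightarrow> point \<Rightarrow> real set" where
  "triangle_angles A B C = {angle_at C A B, angle_at A B C, angle_at B C A}"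

definition right_triangle :: "point \<Rightarrow> point \<Rightarrow> point \<Rightarrow> bool" where
  "right_triangle A B C \<longleftrightarrow> nondegenerate_triangle A B C \<and> pi / 2 \<in> triangle_angles A B C"

definition smallest_angle :: "point \<Rightarrow> point \<Rightarrow> point \<Rightarrow> real" where
  "smallest_angle A B C = Min (triangle_angles A B C)"

(* Similarities of the plane may reverse orientation, so reflections are allowed in
   both of the following notions. *)
definition similar_figures :: "point set \<Rightarrow> point set \<Rightarrow> bool" where
  "similar_figures S S' \<longleftrightarrow>
     (\<exists>r>0. \<exists>f. (\<forall>x y. dist (f x) (f y) = r * dist x y) \<and> f ` S = S')"

definition congruent_figures :: "point set \<Rightarrow> point set \<Rightarrow> bool" where
  "congruent_figures S S' \<longleftrightarrow>
     (\<exists>f. (\<forall>x y. dist (f x) (f y) = dist x y) \<and> f ` S = S')"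

(* As figures congruent to a nondegenerate triangle have nonempty interior, distinctness
   of the tiles is no restriction, and a tiling may be given as a set. *)
definition is_tiling :: "nat \<Rightarrow> point set \<Rightarrow> point set \<Rightarrow> point set set \<Rightarrow> bool" where
  "is_tiling N S T \<T> \<longleftrightarrow>
     finite \<T> \<and> card \<T> = N \<and>
     (\<forall>X\<in>\<T>. congruent_figures T X) \<and>
     pairwise (\<lambda>X Y. interior X \<inter> interior Y = {}) \<T> \<and>
     \<Union>\<T> = S"

(* Only the shape of T is prescribed, not its size. *)
definition can_be_tiled :: "nat \<Rightarrow> point set \<Rightarrow> point set \<Rightarrow> bool" where
  "can_be_tiled N S T \<longleftrightarrow> (\<exists>T' \<T>. similar_figures T T' \<and> is_tiling N S T' \<T>)"

end

theory Submission
  imports Defs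
begin

text \<open>
  Existence: a triangle splits into \<open>k\<^sup>2\<close> congruent similar copies of itself; the altitude splits a
  right triangle into two similar ones, and a triangle with angles 30, 60, 90 degrees splits into three.

  Necessity: comparing areas, the tile is \<open>ABC\<close> scaled by \<open>1 / l\<close> with \<open>l = sqrt N\<close>.  Covering
  the sides of \<open>ABC\<close> by tile edges shows that \<open>l\<close> is an eigenvalue of a nonnegative integer matrix
  with eigenvector \<open>(a, b, c)\<close>.  If \<open>l\<close> is irrational, conjugating it leaves three patterns for the
  matrix.  In one of them the legs of \<open>ABC\<close> are covered by hypotenuses only, so that \<open>l a = p c\<close>
  and \<open>l b = q c\<close>, whence \<open>N = p\<^sup>2 + q\<^sup>2\<close> and \<open>a / b = p / q\<close>.  In the other two, the
  hypotenuse and one leg of \<open>ABC\<close> are covered by the other leg only; then the angle between them is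
  a multiple of its complement and has rational cosine, so it is 60 degrees by Niven's theorem, and
  \<open>N\<close> is three times a square.
\<close>

section \<open>Similarities\<close>

text \<open>Tiles need not meet edge to edge, so there is no combinatorial structure to count with.
  What survives is local to the boundary: up to finitely many points a side of \<open>ABC\<close> is
  a disjoint union of whole tile edges, and the angle at a corner is the sum of the tile angles
  there, because the corner is an extreme point and therefore a vertex of every tile containing it.
  Both facts come from measuring intervals. As \<open>N\<close> is not a square, \<open>l\<close> is
  irrational, and the side equations put \<open>b / a\<close> and \<open>c / a\<close> into the
  field generated by \<open>l\<close>; only then is there something to conjugate. The rational
  cosine is a by-product: two sides covered by the same leg have a quotient of edge counts as their
  ratio. At that stage either acute angle could be the one of 60 degrees; since the tangent of the
  smaller one is at most 1, it is the larger, and the smaller is \<open>pi / 6\<close>.\<close>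

definition similarity :: "real \<Rightarrow> (point \<Rightarrow> point) \<Rightarrow> bool" where
  "similarity r f \<longleftrightarrow> 0 < r \<and> (\<forall>x y. dist (f x) (f y) = r * dist x y)"

lemma similarity_pos: "similarity r f \<Longrightarrow> 0 < r"
  by (simp add: similarity_def)

lemma similarity_dist: "similarity r f \<Longrightarrow> dist (f x) (f y) = r * dist x y"
  by (simp add: similarity_def)

lemma similarity_comp:
  assumes "similarity r f" "similarity s g"
  shows "similarity (r * s) (\<lambda>x. f (g x))"
  using assms by (simp add: similarity_def)

text \<open>Moving the image of \<open>0\<close> back to the origin and dividing by \<open>r\<close>
  leaves an isometry fixing \<open>0\<close>, and such a map is orthogonal. Hence a similarity,
  though defined by distances alone, is affine, which makes hulls, interiors and areas
  accessible.\<close>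

lemma similarity_affine:
  assumes "similarity r f"
  obtains g where "orthogonal_transformation g" "\<And>x. f x = f 0 + r *\<^sub>R g x"
proof
  let ?g = "\<lambda>x. (1 / r) *\<^sub>R (f x - f 0)"
  have r: "r > 0" and d: "\<And>x y. dist (f x) (f y) = r * dist x y"
    using assms by (auto simp: similarity_def)
  have "dist (?g x) (?g y) = dist x y" for x y
  proof -
    have "?g x - ?g y = (1 / r) *\<^sub>R (f x - f y)"
      by (simp add: algebra_simps)
    then show ?thesis
      using d[of x y] r by (simp add: dist_norm)
  qed
  then show "orthogonal_transformation ?g"
    by (simp add: orthogonal_transformation_isometry)
  show "f x = f 0 + r *\<^sub>R ?g x" for x
    using r by simp
qed

lemma similarity_bij:
  assumes "similarity r f"
  shows "bij f"
proof -
  obtain g where g: "orthogonal_transformation g" "\<And>x. f x = f 0 + r *\<^sub>R g x"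
    using similarity_affine[OF assms] by blast
  have r: "r > 0" using assms similarity_pos by blast
  have "inj f"
  proof (rule injI)
    fix x y assume "f x = f y"
    then have "r * dist x y = 0" using similarity_dist[OF assms, of x y] by simp
    then show "x = y" using r by simp
  qed
  moreover have "\<exists>x. y = f x" for y
  proof -
    obtain x where "g x = (1 / r) *\<^sub>R (y - f 0)"
      using orthogonal_transformation_surj[OF g(1)] by (metis surjD)
    then have "f x = y" using r g(2)[of x] by simp
    then show ?thesis by blast
  qed
  ultimately show ?thesis by (simp add: bij_def surj_def)
qed

lemma similarity_inv:
  assumes "similarity r f"
  shows "similarity (1 / r) (inv f)"
proof -
  have r: "r > 0" using assms similarity_pos by blast
  have "dist (inv f x) (inv f y) = 1 / r * dist x y" for x y
  proof -
    have "f (inv f x) = x" "f (inv f y) = y"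
      using similarity_bij[OF assms] by (auto simp: bij_def surj_f_inv_f)
    then show ?thesis
      using similarity_dist[OF assms, of "inv f x" "inv f y"] r by (simp add: field_simps)
  qed
  then show ?thesis using r by (simp add: similarity_def)
qed

text \<open>The factor \<open>r\<close> is absorbed here: a translation after an injective linear
  map is the form in which images commute with convex hulls and interiors.\<close>

lemma similarity_decomp:
  assumes "similarity r f"
  obtains h where "linear h" "inj h" "f = (\<lambda>x. f 0 + h x)"
proof -
  obtain g where g: "orthogonal_transformation g" "\<And>x. f x = f 0 + r *\<^sub>R g x"
    using similarity_affine[OF assms] by blast
  have r: "r > 0" using assms similarity_pos by blast
  have lin: "linear (\<lambda>x. r *\<^sub>R g x)"
    using g(1) by (intro linear_compose_scale_right orthogonal_transformation_linear)
  moreover have "inj (\<lambda>x. r *\<^sub>R g x)"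
    using orthogonal_transformation_inj[OF g(1)] r by (auto simp: inj_def)
  moreover have "f = (\<lambda>x. f 0 + r *\<^sub>R g x)" using g(2) by blast
  ultimately show ?thesis using that by blast
qed

lemma similarity_convex_hull:
  assumes "similarity r f"
  shows "f ` (convex hull S) = convex hull (f ` S)"
proof -
  obtain h where h: "linear h" "inj h" "f = (\<lambda>x. f 0 + h x)"
    using similarity_decomp[OF assms] by blast
  have im: "f ` X = (+) (f 0) ` h ` X" for X
    by (subst h(3)) (simp add: image_image)
  show ?thesis
    unfolding im convex_hull_linear_image[OF h(1)] convex_hull_translation ..
qed

lemma similarity_interior:
  assumes "similarity r f"
  shows "interior (f ` S) = f ` interior S"
proof -
  obtain h where h: "linear h" "inj h" "f = (\<lambda>x. f 0 + h x)"
    using similarity_decomp[OF assms] by blast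
  have im: "f ` X = (+) (f 0) ` h ` X" for X
    by (subst h(3)) (simp add: image_image)
  show ?thesis
    unfolding im interior_translation interior_injective_linear_image[OF h(1,2)] ..
qed

lemma similarity_collinear:
  assumes "similarity r f"
  shows "collinear (f ` S) \<longleftrightarrow> collinear S"
proof -
  have imp: "collinear (f ` S)" if sim: "similarity r f" and col: "collinear S" for r f S
  proof -
    obtain h where h: "linear h" "inj h" "f = (\<lambda>x. f 0 + h x)"
      using similarity_decomp[OF sim] by blast
    obtain u where u: "\<And>x y. x \<in> S \<Longrightarrow> y \<in> S \<Longrightarrow> \<exists>c. x - y = c *\<^sub>R u"
      using col by (auto simp: collinear_def)
    have "f x - f y = h (x - y)" for x y
      using fun_cong[OF h(3), of x] fun_cong[OF h(3), of y] linear_diff[OF h(1)] 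
      by (metis add_diff_cancel_left)
    then have "\<exists>c. f x - f y = c *\<^sub>R h u" if "x \<in> S" "y \<in> S" for x y
      using u[OF that] linear_cmul[OF h(1)] by metis
    then show ?thesis unfolding collinear_def by blast
  qed
  \<comment> \<open>The converse implication is the forward one for the inverse similarity.\<close>
  have "inv f ` f ` S = S"
    using similarity_bij[OF assms] by (auto simp: image_image bij_def)
  then show ?thesis
    using imp[OF assms, of S] imp[OF similarity_inv[OF assms], of "f ` S"] by auto
qed

lemma interior_triangle:
  assumes "nondegenerate_triangle A B C"
  shows "interior (closed_triangle A B C) =
    {x *\<^sub>R A + y *\<^sub>R B + z *\<^sub>R C | x y z. 0 < x \<and> 0 < y \<and> 0 < z \<and> x + y + z = 1}"
  using interior_convex_hull_3_minimal[of A B C] assms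
  unfolding closed_triangle_def nondegenerate_triangle_def by auto

lemma similarity_triangle:
  assumes "similarity r f"
  shows "f ` closed_triangle A B C = closed_triangle (f A) (f B) (f C)"
  using similarity_convex_hull[OF assms] by (simp add: closed_triangle_def)

lemma similarity_nondegenerate:
  assumes "similarity r f"
  shows "nondegenerate_triangle (f A) (f B) (f C) \<longleftrightarrow> nondegenerate_triangle A B C"
  using similarity_collinear[OF assms, of "{A,B,C}"] by (simp add: nondegenerate_triangle_def)

lemma similarity_closed_segment:
  assumes "similarity r f"
  shows "f ` closed_segment a b = closed_segment (f a) (f b)"
  using similarity_convex_hull[OF assms, of "{a,b}"] by (simp add: segment_convex_hull)

lemma similarity_inner:
  assumes "similarity r f"
  shows "(f a - f b) \<bullet> (f c - f d) = r\<^sup>2 * ((a - b) \<bullet> (c - d))"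
proof -
  obtain g where g: "orthogonal_transformation g" "\<And>x. f x = f 0 + r *\<^sub>R g x"
    using similarity_affine[OF assms] by blast
  have "f x - f y = r *\<^sub>R g (x - y)" for x y
    using g(2)[of x] g(2)[of y] orthogonal_transformation_linear[OF g(1)]
    by (simp add: linear_diff algebra_simps)
  then show ?thesis
    using g(1) by (simp add: orthogonal_transformation_def power2_eq_square)
qed

lemma similarity_angle_at:
  assumes "similarity r f"
  shows "angle_at (f P) (f Q) (f R) = angle_at P Q R"
proof -
  have r: "r > 0" using assms similarity_pos by blast
  have n: "norm (f x - f y) = r * norm (x - y)" for x y
    using similarity_dist[OF assms, of x y] by (simp add: dist_norm)
  show ?thesis
    unfolding angle_at_def similarity_inner[OF assms] n using r
    by (simp add: power2_eq_square field_simps)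
qed

text \<open>Translations and orthogonal maps preserve area; the exponent of \<open>r\<close> is the
  dimension of the plane, through the determinant of the scaling.\<close>

lemma similarity_measure:
  assumes "similarity r f" "S \<in> lmeasurable"
  shows "f ` S \<in> lmeasurable" "measure lebesgue (f ` S) = r\<^sup>2 * measure lebesgue S"
proof -
  have r: "r > 0" using assms similarity_pos by blast
  obtain g where g: "orthogonal_transformation g" "\<And>x. f x = f 0 + r *\<^sub>R g x"
    using similarity_affine[OF assms(1)] by blast
  have im: "f ` S = (+) (f 0) ` (*\<^sub>R) r ` g ` S"
    unfolding image_image by (rule image_cong[OF refl g(2)])
  have m: "g ` S \<in> lmeasurable" "measure lebesgue (g ` S) = measure lebesgue S"
    using measurable_orthogonal_image measure_orthogonal_image g(1) assms(2) by blast+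
  have l: "linear ((*\<^sub>R) r :: point \<Rightarrow> point)" by (simp add: linear_scaleR)
  have m2: "(*\<^sub>R) r ` g ` S \<in> lmeasurable"
    using measurable_linear_image[OF l m(1)] .
  have "measure lebesgue ((*\<^sub>R) r ` g ` S) = \<bar>det (matrix ((*\<^sub>R) r :: point \<Rightarrow> point))\<bar> * measure lebesgue S"
    using measure_linear_image[OF l m(1)] m(2) by simp
  also have "\<bar>det (matrix ((*\<^sub>R) r :: point \<Rightarrow> point))\<bar> = r\<^sup>2"
    using r by (simp add: det_matrix_scaleR)
  finally have m3: "measure lebesgue ((*\<^sub>R) r ` g ` S) = r\<^sup>2 * measure lebesgue S" .
  show "f ` S \<in> lmeasurable" unfolding im using m2 by (rule measurable_translation)
  show "measure lebesgue (f ` S) = r\<^sup>2 * measure lebesgue S"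
    unfolding im measure_translation using m3 .
qed

lemma similarity_homothety:
  assumes "k \<noteq> 0"
  shows "similarity \<bar>k\<bar> (\<lambda>x. v + k *\<^sub>R x)"
  using assms by (auto simp: similarity_def dist_norm simp flip: scaleR_diff_right)

text \<open>The ratio \<open>r\<close> is recorded, and the tiled region \<open>U\<close> may differ
  from the prototile \<open>S\<close>: this allows pieces tiled at the same scale to be glued, which
  \<open>can_be_tiled\<close> with its hidden scale would not.\<close>

definition tiled_by :: "point set \<Rightarrow> point set \<Rightarrow> real \<Rightarrow> nat \<Rightarrow> bool" where
  "tiled_by U S r N \<longleftrightarrow> (\<exists>\<T>. finite \<T> \<and> card \<T> = N \<and>
     (\<forall>X\<in>\<T>. \<exists>f. similarity r f \<and> f ` S = X) \<and>
     pairwise (\<lambda>X Y. interior X \<inter> interior Y = {}) \<T> \<and> \<Union>\<T> = U)"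

lemma similar_figures_iff: "similar_figures S S' \<longleftrightarrow> (\<exists>r f. similarity r f \<and> f ` S = S')"
  by (auto simp: similar_figures_def similarity_def)

lemma congruent_figures_iff: "congruent_figures S S' \<longleftrightarrow> (\<exists>f. similarity 1 f \<and> f ` S = S')"
  by (auto simp: congruent_figures_def similarity_def)

text \<open>A figure similar to \<open>T\<close> is a scaled copy of \<open>S\<close>, so
  \<open>S\<close> itself can serve as prototile. Conversely \<open>N > 0\<close> provides a tile to
  take as the actual tile; the others are congruent to it since their ratio is the same.\<close>

lemma can_be_tiled_iff_tiled_by:
  assumes "similar_figures T S" "N > 0"
  shows "can_be_tiled N S T \<longleftrightarrow> (\<exists>r. tiled_by S S r N)"
proof
  obtain s h where h: "similarity s h" "h ` T = S"
    using assms(1) by (auto simp: similar_figures_iff)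
  have hi: "similarity (1 / s) (inv h)" "inv h ` S = T"
    using similarity_inv[OF h(1)] h(2) similarity_bij[OF h(1)]
    by (auto simp: image_image bij_def inj_def)
  {
    assume "can_be_tiled N S T"
    then obtain T' \<T> t g where g: "similarity t g" "g ` T = T'" and t: "is_tiling N S T' \<T>"
      by (auto simp: can_be_tiled_def similar_figures_iff)
    have "tiled_by S S (t * (1 / s)) N"
      unfolding tiled_by_def
    proof (intro exI[of _ \<T>] conjI ballI)
      show "finite \<T>" "card \<T> = N" "\<Union>\<T> = S"
        "pairwise (\<lambda>X Y. interior X \<inter> interior Y = {}) \<T>"
        using t by (auto simp: is_tiling_def)
      fix X assume "X \<in> \<T>"
      then obtain f where f: "similarity 1 f" "f ` T' = X"
        using t by (auto simp: is_tiling_def congruent_figures_iff)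
      have "similarity (1 * (t * (1 / s))) (\<lambda>x. f (g (inv h x)))"
        by (intro similarity_comp f g hi)
      moreover have "(\<lambda>x. f (g (inv h x))) ` S = X"
        using f(2) g(2) hi(2) by (metis image_image)
      ultimately show "\<exists>f. similarity (t * (1 / s)) f \<and> f ` S = X" by auto
    qed
    then show "\<exists>r. tiled_by S S r N" by blast
  }
  {
    assume "\<exists>r. tiled_by S S r N"
    then obtain r \<T> where t: "finite \<T>" "card \<T> = N" "\<And>X. X \<in> \<T> \<Longrightarrow> \<exists>f. similarity r f \<and> f ` S = X"
      "pairwise (\<lambda>X Y. interior X \<inter> interior Y = {}) \<T>" "\<Union>\<T> = S"
      unfolding tiled_by_def by metis
    obtain X0 where "X0 \<in> \<T>" using assms(2) t(1,2) by fastforce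
    then obtain f0 where f0: "similarity r f0" "f0 ` S = X0" using t(3) by blast
    have "congruent_figures X0 X" if "X \<in> \<T>" for X
    proof -
      obtain f where f: "similarity r f" "f ` S = X" using t(3) \<open>X \<in> \<T>\<close> by blast
      have "inv f0 ` X0 = S"
        using f0(2) similarity_bij[OF f0(1)] by (auto simp: image_image bij_def inj_def)
      then have "(\<lambda>x. f (inv f0 x)) ` X0 = X" using f(2) by (metis image_image)
      moreover have "similarity (r * (1 / r)) (\<lambda>x. f (inv f0 x))"
        by (intro similarity_comp f similarity_inv f0)
      ultimately show ?thesis
        using similarity_pos[OF f(1)] by (auto simp: congruent_figures_iff)
    qed
    then have "is_tiling N S X0 \<T>" using t by (simp add: is_tiling_def)
    moreover have "similar_figures T X0"
      using similarity_comp[OF f0(1) h(1)] f0(2) h(2) 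
      unfolding similar_figures_iff by (metis image_image)
    ultimately show "can_be_tiled N S T" by (auto simp: can_be_tiled_def)
  }
qed

lemma tiled_by_image:
  assumes "tiled_by U S r N" "similarity s h"
  shows "tiled_by (h ` U) S (s * r) N"
proof -
  obtain \<T> where t: "finite \<T>" "card \<T> = N" "\<And>X. X \<in> \<T> \<Longrightarrow> \<exists>f. similarity r f \<and> f ` S = X"
      "pairwise (\<lambda>X Y. interior X \<inter> interior Y = {}) \<T>" "\<Union>\<T> = U"
    using assms(1) by (auto simp: tiled_by_def)
  have inj: "inj h" using similarity_bij[OF assms(2)] by (simp add: bij_def)
  show ?thesis
    unfolding tiled_by_def
  proof (intro exI[of _ "(`) h ` \<T>"] conjI ballI)
    show "finite ((`) h ` \<T>)" using t by simp
    show "card ((`) h ` \<T>) = N"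
      using t(2) inj by (metis card_image inj_image_eq_iff inj_onI)
    show "\<Union> ((`) h ` \<T>) = h ` U" using t(5) by blast
    show "pairwise (\<lambda>X Y. interior X \<inter> interior Y = {}) ((`) h ` \<T>)"
    proof (rule pairwiseI)
      fix X Y assume "X \<in> (`) h ` \<T>" "Y \<in> (`) h ` \<T>" "X \<noteq> Y"
      then obtain X' Y' where X: "X = h ` X'" "Y = h ` Y'" "X' \<in> \<T>" "Y' \<in> \<T>" "X' \<noteq> Y'"
        by blast
      then have "interior X' \<inter> interior Y' = {}" using t(4) by (auto simp: pairwise_def)
      then show "interior X \<inter> interior Y = {}"
        unfolding X similarity_interior[OF assms(2)] using inj
        by (metis image_Int image_empty)
    qed
    fix X assume "X \<in> (`) h ` \<T>"
    then obtain X' where X: "X = h ` X'" "X' \<in> \<T>" by blast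
    then obtain f where "similarity r f" "f ` S = X'" using t(3) by blast
    then show "\<exists>f. similarity (s * r) f \<and> f ` S = X"
      using similarity_comp[OF assms(2)] X(1) by (metis image_image)
  qed
qed

text \<open>Tiles have nonempty interior because \<open>S\<close> has, so no tile of one family
  occurs in the other and the cardinalities add.\<close>

lemma tiled_by_Un:
  assumes "tiled_by U S r M" "tiled_by V S r N" "interior U \<inter> interior V = {}" "interior S \<noteq> {}"
  shows "tiled_by (U \<union> V) S r (M + N)"
proof -
  obtain \<T> where t: "finite \<T>" "card \<T> = M" "\<And>X. X \<in> \<T> \<Longrightarrow> \<exists>f. similarity r f \<and> f ` S = X"
      "pairwise (\<lambda>X Y. interior X \<inter> interior Y = {}) \<T>" "\<Union>\<T> = U"
    using assms(1) by (auto simp: tiled_by_def)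
  obtain \<V> where v: "finite \<V>" "card \<V> = N" "\<And>X. X \<in> \<V> \<Longrightarrow> \<exists>f. similarity r f \<and> f ` S = X"
      "pairwise (\<lambda>X Y. interior X \<inter> interior Y = {}) \<V>" "\<Union>\<V> = V"
    using assms(2) by (auto simp: tiled_by_def)
  have ne: "interior X \<noteq> {}" if "X \<in> \<T>" for X
    using t(3)[OF that] similarity_interior assms(4) by blast
  have cross: "interior X \<inter> interior Y = {}" if "X \<in> \<T>" "Y \<in> \<V>" for X Y
  proof -
    have "X \<subseteq> U" "Y \<subseteq> V" using that t(5) v(5) by auto
    then show ?thesis using assms(3) interior_mono by blast
  qed
  have "\<T> \<inter> \<V> = {}" using cross ne by fastforce
  then have "card (\<T> \<union> \<V>) = M + N" using t(1,2) v(1,2) by (simp add: card_Un_disjoint)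
  moreover have "pairwise (\<lambda>X Y. interior X \<inter> interior Y = {}) (\<T> \<union> \<V>)"
    using t(4) v(4) cross unfolding pairwise_def by (metis Un_iff inf_commute)
  moreover have "\<forall>X\<in>\<T> \<union> \<V>. \<exists>f. similarity r f \<and> f ` S = X" using t(3) v(3) by blast
  ultimately show ?thesis
    unfolding tiled_by_def using t(1,5) v(1,5) by (intro exI[of _ "\<T> \<union> \<V>"]) auto
qed

text \<open>Convex tiles with disjoint interiors meet only inside their frontiers, which are null
  sets, so the areas of the tiles add up to that of \<open>S\<close>; this area is positive and
  cancels.\<close>

lemma tiled_by_ratio:
  assumes "tiled_by S S r N" "S = closed_triangle A B C" "nondegenerate_triangle A B C"
  shows "real N * r\<^sup>2 = 1"
proof -
  obtain \<T> where t: "finite \<T>" "card \<T> = N" "\<And>X. X \<in> \<T> \<Longrightarrow> \<exists>f. similarity r f \<and> f ` S = X"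
      "pairwise (\<lambda>X Y. interior X \<inter> interior Y = {}) \<T>" "\<Union>\<T> = S"
    using assms(1) by (auto simp: tiled_by_def)
  have cS: "compact S" "convex S"
    by (auto simp: assms(2) closed_triangle_def finite_imp_compact_convex_hull)
  then have lS: "S \<in> lmeasurable" by (simp add: lmeasurable_compact)
  have conv: "convex X" if "X \<in> \<T>" for X
    using t(3)[OF that] similarity_convex_hull[of r _ "{A,B,C}"] 
    by (metis assms(2) closed_triangle_def convex_convex_hull)
  have lX: "X \<in> lmeasurable" "measure lebesgue X = r\<^sup>2 * measure lebesgue S" if "X \<in> \<T>" for X
    using t(3)[OF that] similarity_measure lS by blast+
  have "pairwise (\<lambda>X Y. negligible (X \<inter> Y)) \<T>"
  proof (rule pairwiseI)
    fix X Y assume XY: "X \<in> \<T>" "Y \<in> \<T>" "X \<noteq> Y"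
    then have "interior X \<inter> interior Y = {}" using t(4) by (auto simp: pairwise_def)
    then have "X \<inter> Y \<subseteq> frontier X \<union> frontier Y"
      unfolding frontier_def using closure_subset by blast
    then show "negligible (X \<inter> Y)"
      using negligible_convex_frontier conv XY negligible_Un negligible_subset by metis
  qed
  then have "measure lebesgue S = (\<Sum>X\<in>\<T>. measure lebesgue X)"
    using measure_negligible_finite_Union[of \<T>] t lX(1) by metis
  also have "\<dots> = real N * (r\<^sup>2 * measure lebesgue S)"
    using lX(2) t(2) by simp
  finally have "measure lebesgue S * (real N * r\<^sup>2 - 1) = 0" by (simp add: algebra_simps)
  moreover have "measure lebesgue S \<noteq> 0"
  proof
    assume "measure lebesgue S = 0"
    then have "negligible S" using lS negligible_iff_measure by blast
    then have "interior S = {}"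
      using negligible_subset interior_subset open_interior open_not_negligible by metis
    moreover have "(1/3) *\<^sub>R A + (1/3) *\<^sub>R B + (1/3) *\<^sub>R C \<in> interior S"
      unfolding assms(2) interior_triangle[OF assms(3)]
      by (intro CollectI exI[of _ "1/3"]) auto
    ultimately show False by blast
  qed
  ultimately show ?thesis by simp
qed

section \<open>Constructing tilings\<close>

text \<open>The determinant of the two vectors, that is, twice the signed area of the triangle that
  they span with the origin. Collinearity, affine coordinates and orientation are all read off from
  it.\<close>

definition cross2 :: "point \<Rightarrow> point \<Rightarrow> real" where
  "cross2 p q = p $ 1 * q $ 2 - p $ 2 * q $ 1"

lemma point_eq_iff: "(p :: point) = q \<longleftrightarrow> p $ 1 = q $ 1 \<and> p $ 2 = q $ 2"
  by (simp add: vec_eq_iff forall_2)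

lemma inner_point: "(p :: point) \<bullet> q = p $ 1 * q $ 1 + p $ 2 * q $ 2"
  by (simp add: inner_vec_def sum_2)

lemma nondegenerate_iff_cross2:
  "nondegenerate_triangle A B C \<longleftrightarrow> cross2 (B - A) (C - A) \<noteq> 0"
proof -
  define p q where "p = B - A" and "q = C - A"
  have "collinear {A, B, C} \<longleftrightarrow> collinear {0, p, q}"
    using collinear_3[of B A C] by (simp add: p_def q_def insert_commute)
  also have "\<dots> \<longleftrightarrow> cross2 p q = 0"
  proof
    assume "collinear {0, p, q}"
    then have "p = 0 \<or> q = 0 \<or> (\<exists>c. q = c *\<^sub>R p)" by (simp add: collinear_lemma)
    then show "cross2 p q = 0" by (auto simp: cross2_def)
  next
    assume "cross2 p q = 0"
    then have c: "p $ 1 * q $ 2 = p $ 2 * q $ 1" by (simp add: cross2_def)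
    have "\<exists>c. q = c *\<^sub>R p" if "p \<noteq> 0"
    proof (cases "p $ 1 = 0")
      case True
      then have "p $ 2 \<noteq> 0" using that by (auto simp: point_eq_iff)
      then have "q = (q $ 2 / p $ 2) *\<^sub>R p" using c True by (auto simp: point_eq_iff)
      then show ?thesis by blast
    next
      case False
      then have "q = (q $ 1 / p $ 1) *\<^sub>R p" using c by (auto simp: point_eq_iff field_simps)
      then show ?thesis by blast
    qed
    then show "collinear {0, p, q}" by (auto simp: collinear_lemma)
  qed
  finally show ?thesis by (simp add: nondegenerate_triangle_def p_def q_def)
qed

lemma affine_coordinates_unique:
  assumes "nondegenerate_triangle A B C"
    and "A + u *\<^sub>R (B - A) + v *\<^sub>R (C - A) = A + u' *\<^sub>R (B - A) + v' *\<^sub>R (C - A)"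
  shows "u = u'" "v = v'"
proof -
  define p q where "p = B - A" and "q = C - A"
  have c: "cross2 p q \<noteq> 0" using assms(1) by (simp add: nondegenerate_iff_cross2 p_def q_def)
  have "u *\<^sub>R p + v *\<^sub>R q = u' *\<^sub>R p + v' *\<^sub>R q"
    using assms(2) unfolding p_def q_def by (simp only: add.assoc add_left_cancel)
  then have e: "(u - u') * p $ 1 + (v - v') * q $ 1 = 0" "(u - u') * p $ 2 + (v - v') * q $ 2 = 0"
    by (auto simp: point_eq_iff algebra_simps)
  have "(u - u') * cross2 p q = 0"
    using arg_cong[OF e(1), of "\<lambda>x. x * q $ 2"] arg_cong[OF e(2), of "\<lambda>x. x * q $ 1"]
    by (simp add: cross2_def algebra_simps)
  then show "u = u'" using c by simp
  have "(v - v') * cross2 p q = 0"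
    using arg_cong[OF e(1), of "\<lambda>x. x * p $ 2"] arg_cong[OF e(2), of "\<lambda>x. x * p $ 1"]
    by (simp add: cross2_def algebra_simps)
  then show "v = v'" using c by simp
qed

lemma closed_triangle_alt:
  "closed_triangle A B C = {A + u *\<^sub>R (B - A) + v *\<^sub>R (C - A) | u v. 0 \<le> u \<and> 0 \<le> v \<and> u + v \<le> 1}"
  unfolding closed_triangle_def convex_hull_3_alt ..

lemma interior_triangle_alt:
  assumes "nondegenerate_triangle A B C"
  shows "interior (closed_triangle A B C) =
    {A + u *\<^sub>R (B - A) + v *\<^sub>R (C - A) | u v. 0 < u \<and> 0 < v \<and> u + v < 1}" (is "_ = ?R")
proof -
  have eq: "x *\<^sub>R A + y *\<^sub>R B + z *\<^sub>R C = A + y *\<^sub>R (B - A) + z *\<^sub>R (C - A)" if "x + y + z = 1" for x y z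
  proof -
    have x: "x = 1 - y - z" using that by simp
    show ?thesis unfolding x by (simp add: algebra_simps)
  qed
  show ?thesis
    unfolding interior_triangle[OF assms]
  proof (intro equalityI subsetI)
    fix p assume "p \<in> {x *\<^sub>R A + y *\<^sub>R B + z *\<^sub>R C |x y z. 0 < x \<and> 0 < y \<and> 0 < z \<and> x + y + z = 1}"
    then obtain x y z where h: "p = x *\<^sub>R A + y *\<^sub>R B + z *\<^sub>R C" "0 < x" "0 < y" "0 < z" "x + y + z = 1"
      by blast
    then have "p = A + y *\<^sub>R (B - A) + z *\<^sub>R (C - A)" "y + z < 1" using eq by auto
    then show "p \<in> ?R" using h by blast
  next
    fix p assume "p \<in> ?R"
    then obtain u v where h: "p = A + u *\<^sub>R (B - A) + v *\<^sub>R (C - A)" "0 < u" "0 < v" "u + v < 1"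
      by blast
    then have "p = (1 - u - v) *\<^sub>R A + u *\<^sub>R B + v *\<^sub>R C" "0 < 1 - u - v" "(1 - u - v) + u + v = 1"
      using eq[of "1 - u - v" u v] by auto
    then show "p \<in> {x *\<^sub>R A + y *\<^sub>R B + z *\<^sub>R C |x y z. 0 < x \<and> 0 < y \<and> 0 < z \<and> x + y + z = 1}"
      using h(2,3) by blast
  qed
qed

lemma interior_triangle_nonempty:
  assumes "nondegenerate_triangle A B C"
  shows "interior (closed_triangle A B C) \<noteq> {}"
proof -
  have "A + (1/3) *\<^sub>R (B - A) + (1/3) *\<^sub>R (C - A) \<in> interior (closed_triangle A B C)"
    unfolding interior_triangle_alt[OF assms] by (intro CollectI exI[of _ "1/3"]) auto
  then show ?thesis by blast
qed

text \<open>Lines parallel to the sides cut the triangle. In affine coordinates scaled by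
  \<open>k\<close>, each unit cell with corner \<open>(i, j)\<close> is halved by a diagonal; one
  half is a translate of the shrunken triangle, the other a half-turn of it.\<close>

lemma tiled_by_square:
  assumes nd: "nondegenerate_triangle A B C" and k: "k > 0"
  defines "S \<equiv> closed_triangle A B C"
  shows "tiled_by S S (1 / real k) (k\<^sup>2)"
proof -
  define \<phi> where "\<phi> u v = A + (u / k) *\<^sub>R (B - A) + (v / k) *\<^sub>R (C - A)" for u v :: real
  \<comment> \<open>For \<open>b\<close> true the sign \<open>s b\<close> reverses the triangle, and
    \<open>w b\<close> anchors it at the far corner \<open>(i + 1, j + 1)\<close> of the
    cell.\<close>
  define s :: "bool \<Rightarrow> real" where "s b = (if b then -1 else 1)" for b
  define w :: "bool \<Rightarrow> real" where "w b = (if b then 1 else 0)" for b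
  define F where "F = (\<lambda>(i::nat, j::nat, b) p. (\<phi> (i + w b) (j + w b) - (s b / k) *\<^sub>R A) + (s b / k) *\<^sub>R p)"
  \<comment> \<open>The half next to \<open>(i, j)\<close> lies inside when
    \<open>i + j + 1 \<le> k\<close>; the opposite half reaches the coordinate sum
    \<open>i + j + 2\<close>, hence the extra 1.\<close>
  define I where "I = {(i, j, b). i + j + (if b then 1 else 0) < k}"
  have kr: "real k > 0" using k by simp
  have simF: "similarity (1 / k) (F x)" for x
  proof (cases x)
    case (fields i j b)
    have "\<bar>s b / k\<bar> = 1 / k" using kr by (simp add: s_def)
    moreover have "s b / k \<noteq> 0" using kr by (simp add: s_def)
    ultimately show ?thesis
      using similarity_homothety[of "s b / k"] unfolding F_def fields by (auto simp only: prod.case)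
  qed
  have F: "F (i, j, b) (A + u *\<^sub>R (B - A) + v *\<^sub>R (C - A)) = \<phi> (i + w b + s b * u) (j + w b + s b * v)"
    for i j b u v
    unfolding F_def \<phi>_def prod.case by (simp add: algebra_simps add_divide_distrib)
  have \<phi>_inj: "u = u' \<and> v = v'" if "\<phi> u v = \<phi> u' v'" for u v u' v'
    using affine_coordinates_unique[OF nd that[unfolded \<phi>_def]] kr by simp
  have intF: "\<exists>u v. p = \<phi> u v \<and> i < u \<and> u < i + 1 \<and> j < v \<and> v < j + 1 \<and>
      (if b then u + v > i + j + 1 else u + v < i + j + 1)" if "p \<in> interior (F (i, j, b) ` S)" for p i j b
  proof -
    obtain q where q: "q \<in> interior S" "p = F (i, j, b) q"
      using \<open>p \<in> _\<close> unfolding similarity_interior[OF simF] by blast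
    then obtain u v where uv: "q = A + u *\<^sub>R (B - A) + v *\<^sub>R (C - A)" "0 < u" "0 < v" "u + v < 1"
      unfolding S_def interior_triangle_alt[OF nd] by blast
    then have "p = \<phi> (i + w b + s b * u) (j + w b + s b * v)" using F q(2) by simp
    then show ?thesis using uv(2-4)
      by (intro exI[of _ "i + w b + s b * u"] exI[of _ "j + w b + s b * v"])
        (cases b; simp add: s_def w_def)
  qed
  have disj: "x = y" if px: "p \<in> interior (F x ` S)" and py: "p \<in> interior (F y ` S)" for x y p
  proof -
    obtain i j :: nat and b where x: "x = (i, j, b)" by (metis prod_cases3)
    obtain i' j' :: nat and b' where y: "y = (i', j', b')" by (metis prod_cases3)
    note xy = x y
    obtain u v :: real where u: "p = \<phi> u v" "i < u" "u < i + 1" "j < v" "v < j + 1"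
      "if b then u + v > i + j + 1 else u + v < i + j + 1"
      using intF[OF px[unfolded xy]] by metis
    obtain u' v' :: real where u': "p = \<phi> u' v'" "i' < u'" "u' < i' + 1" "j' < v'" "v' < j' + 1"
      "if b' then u' + v' > i' + j' + 1 else u' + v' < i' + j' + 1"
      using intF[OF py[unfolded xy]] by metis
    have e: "u = u'" "v = v'" using \<phi>_inj u(1) u'(1) by auto
    have "real i < real i' + 1" "real i' < real i + 1" "real j < real j' + 1" "real j' < real j + 1"
      using u u' e by linarith+
    then have "i = i'" "j = j'" by linarith+
    then show ?thesis using u(6) u'(6) e xy by (cases b; cases b') auto
  qed
  have finI: "finite I"
    by (rule finite_subset[of _ "{..k} \<times> {..k} \<times> UNIV"]) (auto simp: I_def)
  have ne: "interior (F x ` S) \<noteq> {}" for x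
    using similarity_interior[OF simF] interior_triangle_nonempty[OF nd] by (simp add: S_def)
  have inj: "inj_on (\<lambda>x. F x ` S) I"
    using disj ne by (intro inj_onI) (metis ex_in_conv)
  have cover: "(\<Union>x\<in>I. F x ` S) = S"
  proof (intro equalityI subsetI)
    fix p assume "p \<in> (\<Union>x\<in>I. F x ` S)"
    then obtain i j b q where h: "(i, j, b) \<in> I" "q \<in> S" "p = F (i, j, b) q" by auto
    then obtain u v where uv: "q = A + u *\<^sub>R (B - A) + v *\<^sub>R (C - A)" "0 \<le> u" "0 \<le> v" "u + v \<le> 1"
      unfolding S_def closed_triangle_alt by blast
    have p: "p = \<phi> (i + w b + s b * u) (j + w b + s b * v)" using F uv(1) h(3) by simp
    have "i + j + (if b then 1 else 0) + 1 \<le> k" using h(1) by (simp add: I_def)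
    then have "real (i + j + (if b then 1 else 0) + 1) \<le> real k" by (simp only: of_nat_le_iff)
    then have *: "real i + real j + w b + 1 \<le> k" by (simp add: w_def split: if_splits)
    have "0 \<le> (i + w b + s b * u) / k" "0 \<le> (j + w b + s b * v) / k" using uv
      by (cases b; simp add: s_def w_def)+
    moreover have "(i + w b + s b * u) / k + (j + w b + s b * v) / k \<le> 1"
      unfolding add_divide_distrib[symmetric] divide_le_eq_1_pos[OF kr]
      using * uv by (cases b; simp add: s_def w_def)
    ultimately show "p \<in> S" unfolding p \<phi>_def S_def closed_triangle_alt by blast
  next
    fix p assume "p \<in> S"
    then obtain u0 v0 where uv0: "p = A + u0 *\<^sub>R (B - A) + v0 *\<^sub>R (C - A)" "0 \<le> u0" "0 \<le> v0" "u0 + v0 \<le> 1"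
      unfolding S_def closed_triangle_alt by blast
    define u v where "u = k * u0" and "v = k * v0"
    have p: "p = \<phi> u v" using uv0 kr by (simp add: \<phi>_def u_def v_def)
    have "real k * (u0 + v0) \<le> real k * 1" using uv0(4) kr by (intro mult_left_mono) auto
    then have uv: "0 \<le> u" "0 \<le> v" "u + v \<le> k"
      using uv0 by (auto simp: u_def v_def algebra_simps)
    have mem: "\<phi> u v \<in> F (i, j, b) ` S" if "0 \<le> s b * (u - i - w b)" "0 \<le> s b * (v - j - w b)"
       "s b * (u - i - w b) + s b * (v - j - w b) \<le> 1" for i j b
    proof
      let ?q = "A + (s b * (u - i - w b)) *\<^sub>R (B - A) + (s b * (v - j - w b)) *\<^sub>R (C - A)"
      show "?q \<in> S" unfolding S_def closed_triangle_alt using that by blast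
      show "\<phi> u v = F (i, j, b) ?q" unfolding F by (cases b) (simp_all add: s_def w_def)
    qed
    define i j where "i = nat \<lfloor>u\<rfloor>" and "j = nat \<lfloor>v\<rfloor>"
    have ij: "i \<le> u" "u < i + 1" "j \<le> v" "v < j + 1"
      using uv by (auto simp: i_def j_def; linarith)+
    consider "u + v > real i + real j + 1" | "u + v \<le> real i + real j + 1" "i + j < k" | "i + j \<ge> k" by linarith
    then show "p \<in> (\<Union>x\<in>I. F x ` S)"
    proof cases
      case 1
      then have "real (i + j + 1) < real k" using uv by simp
      then have "i + j + 1 < k" by (simp only: of_nat_less_iff)
      then have "(i, j, True) \<in> I" by (simp add: I_def)
      then show ?thesis unfolding p using mem[of True i j] ij 1 by (fastforce simp: s_def w_def)
    next
      case 2
      then have "(i, j, False) \<in> I" by (simp add: I_def)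
      then show ?thesis unfolding p using mem[of False i j] ij 2 by (fastforce simp: s_def w_def)
    next
      \<comment> \<open>The point is a grid point on the side \<open>BC\<close>, and its own cell
        lies outside; it is a vertex of the near half of the cell with \<open>i\<close> or
        \<open>j\<close> lowered by one.\<close>
      case 3
      then have "real k \<le> real i + real j" by (metis of_nat_add of_nat_le_iff)
      then have e: "u = i" "v = j" "real i + real j = k" using ij uv by linarith+
      then have ek: "i + j = k" by linarith
      show ?thesis
      proof (cases "i > 0")
        case True
        then have "(i - 1, j, False) \<in> I" using ek k by (simp add: I_def)
        then show ?thesis unfolding p using mem[of False "i - 1" j] e True
          by (intro UN_I[of "(i - 1, j, False)"]) (auto simp: s_def w_def of_nat_diff)
      next
        case False
        then have j: "j > 0" using ek k by simp
        then have "(i, j - 1, False) \<in> I" using ek k by (simp add: I_def)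
        then show ?thesis unfolding p using mem[of False i "j - 1"] e j
          by (intro UN_I[of "(i, j - 1, False)"]) (auto simp: s_def w_def of_nat_diff)
      qed
    qed
  qed
  have til: "tiled_by S S (1 / k) (card I)"
    unfolding tiled_by_def
  proof (intro exI[of _ "(\<lambda>x. F x ` S) ` I"] conjI ballI)
    show "finite ((\<lambda>x. F x ` S) ` I)" using finI by simp
    show "card ((\<lambda>x. F x ` S) ` I) = card I" by (rule card_image[OF inj])
    show "\<Union> ((\<lambda>x. F x ` S) ` I) = S" using cover .
    show "pairwise (\<lambda>X Y. interior X \<inter> interior Y = {}) ((\<lambda>x. F x ` S) ` I)"
    proof (rule pairwiseI)
      fix X Y assume "X \<in> (\<lambda>x. F x ` S) ` I" "Y \<in> (\<lambda>x. F x ` S) ` I" "X \<noteq> Y"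
      then obtain x y where "X = F x ` S" "Y = F y ` S" "x \<noteq> y" by blast
      then show "interior X \<inter> interior Y = {}" using disj[of _ x y] by blast
    qed
    fix X assume "X \<in> (\<lambda>x. F x ` S) ` I"
    then show "\<exists>f. similarity (1 / k) f \<and> f ` S = X" using simF by blast
  qed
  \<comment> \<open>The triangles need not be counted: the area identity forces their
    number.\<close>
  have "real (card I) * (1 / k)\<^sup>2 = 1"
    by (rule tiled_by_ratio[OF til S_def[THEN meta_eq_to_obj_eq] nd])
  then have "real (card I) = real (k\<^sup>2)" using kr by (simp add: field_simps)
  then have "card I = k\<^sup>2" by (simp only: of_nat_eq_iff)
  then show ?thesis using til by simp
qed

text \<open>Everything is compared in the affine coordinates of \<open>ABC\<close>, where the line
  \<open>CH\<close> is \<open>u / t + v = 1\<close>.\<close>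

lemma triangle_split:
  assumes nd: "nondegenerate_triangle A B C" and t: "0 < t" "t < 1"
  defines "H \<equiv> A + t *\<^sub>R (B - A)"
  shows "closed_triangle A B C = closed_triangle A H C \<union> closed_triangle H B C"
    and "interior (closed_triangle A H C) \<inter> interior (closed_triangle H B C) = {}"
    and "nondegenerate_triangle A H C" "nondegenerate_triangle H B C"
proof -
  have c: "cross2 (B - A) (C - A) \<noteq> 0" using nd by (simp add: nondegenerate_iff_cross2)
  have "cross2 (H - A) (C - A) = t * cross2 (B - A) (C - A)"
    "cross2 (B - H) (C - H) = (1 - t) * cross2 (B - A) (C - A)"
    by (auto simp: cross2_def H_def algebra_simps)
  then show nd': "nondegenerate_triangle A H C" "nondegenerate_triangle H B C"
    using c t by (auto simp: nondegenerate_iff_cross2)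
  have e1: "A + u *\<^sub>R (H - A) + v *\<^sub>R (C - A) = A + (u * t) *\<^sub>R (B - A) + v *\<^sub>R (C - A)" for u v
    by (simp add: H_def)
  have e2: "H + u *\<^sub>R (B - H) + v *\<^sub>R (C - H) = A + (t + u * (1 - t) - v * t) *\<^sub>R (B - A) + v *\<^sub>R (C - A)" for u v
    by (simp add: H_def algebra_simps)
  show "interior (closed_triangle A H C) \<inter> interior (closed_triangle H B C) = {}"
  proof (rule ccontr)
    assume "\<not> ?thesis"
    then obtain p where "p \<in> interior (closed_triangle A H C)" "p \<in> interior (closed_triangle H B C)" by blast
    then obtain u v u' v' where h: "p = A + u *\<^sub>R (H - A) + v *\<^sub>R (C - A)" "0 < u" "0 < v" "u + v < 1"
      "p = H + u' *\<^sub>R (B - H) + v' *\<^sub>R (C - H)" "0 < u'" "0 < v'" "u' + v' < 1"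
      unfolding nd'[THEN interior_triangle_alt] by blast
    have "u * t = t + u' * (1 - t) - v' * t" "v = v'"
      using affine_coordinates_unique[OF nd] h(1,5) unfolding e1 e2 by metis+
    then have "t * (1 - u - v) + u' * (1 - t) = 0" by (simp add: algebra_simps)
    moreover have "t * (1 - u - v) > 0" "u' * (1 - t) > 0" using h t by auto
    ultimately show False by linarith
  qed
  show "closed_triangle A B C = closed_triangle A H C \<union> closed_triangle H B C"
  proof (intro equalityI subsetI)
    fix p assume "p \<in> closed_triangle A B C"
    then obtain u v where uv: "p = A + u *\<^sub>R (B - A) + v *\<^sub>R (C - A)" "0 \<le> u" "0 \<le> v" "u + v \<le> 1"
      unfolding closed_triangle_alt by blast
    show "p \<in> closed_triangle A H C \<union> closed_triangle H B C"
    proof (cases "u / t + v \<le> 1")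
      case True
      have "p = A + (u / t) *\<^sub>R (H - A) + v *\<^sub>R (C - A)" unfolding e1 using t uv by simp
      then have "p \<in> closed_triangle A H C" unfolding closed_triangle_alt using uv t True
        by (intro CollectI exI[of _ "u / t"] exI[of _ v]) auto
      then show ?thesis ..
    next
      case False
      \<comment> \<open>The solution of \<open>t + w * (1 - t) - v * t = u\<close>, as demanded by
        \<open>e2\<close>.\<close>
      define w where "w = (u - t + v * t) / (1 - t)"
      have "u / t > 1 - v" using False by simp
      then have "u > (1 - v) * t" using t by (simp add: field_simps)
      then have "w \<ge> 0" using t by (simp add: w_def algebra_simps)
      moreover have w: "w * (1 - t) = u - t + v * t" using t by (simp add: w_def)
      have "(w + v) * (1 - t) \<le> 1 * (1 - t)" using w uv by (simp add: algebra_simps)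
      then have "w + v \<le> 1" using t by (auto simp only: mult_le_cancel_right)
      moreover have "p = H + w *\<^sub>R (B - H) + v *\<^sub>R (C - H)" unfolding e2 w using uv by simp
      ultimately have "p \<in> closed_triangle H B C" unfolding closed_triangle_alt using uv by blast
      then show ?thesis ..
    qed
  next
    fix p assume p: "p \<in> closed_triangle A H C \<union> closed_triangle H B C"
    have mem: "H \<in> closed_triangle A B C" "A \<in> closed_triangle A B C"
      "B \<in> closed_triangle A B C" "C \<in> closed_triangle A B C"
    proof -
      have "H = A + t *\<^sub>R (B - A) + 0 *\<^sub>R (C - A)" by (simp add: H_def)
      then show "H \<in> closed_triangle A B C" unfolding closed_triangle_alt using t
        by (intro CollectI exI[of _ t] exI[of _ 0]) auto
    qed (auto simp: closed_triangle_def hull_inc)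
    have "convex (closed_triangle A B C)" by (simp add: closed_triangle_def)
    then have "closed_triangle A H C \<subseteq> closed_triangle A B C" "closed_triangle H B C \<subseteq> closed_triangle A B C"
      unfolding closed_triangle_def[of A H C] closed_triangle_def[of H B C]
      using mem by (intro hull_minimal; simp)+
    then show "p \<in> closed_triangle A B C" using p by blast
  qed
qed

section \<open>Cutting a right triangle into similar right triangles\<close>

lemma closed_triangle_perm:
  "closed_triangle B A C = closed_triangle A B C" "closed_triangle A C B = closed_triangle A B C"
  by (simp_all add: closed_triangle_def insert_commute)

lemma nondegenerate_triangle_perm:
  "nondegenerate_triangle B A C \<longleftrightarrow> nondegenerate_triangle A B C"
  "nondegenerate_triangle A C B \<longleftrightarrow> nondegenerate_triangle A B C"
  by (simp_all add: nondegenerate_triangle_def insert_commute)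

text \<open>Pythagoras in the orthogonal basis \<open>p\<close>, \<open>q\<close> of the plane; in
  coordinates it is a polynomial identity modulo \<open>p \<bullet> q = 0\<close>.\<close>

lemma orthogonal_expansion:
  fixes p q x :: point
  assumes "p \<bullet> q = 0" "p \<noteq> 0" "q \<noteq> 0"
  shows "(norm x)\<^sup>2 = (x \<bullet> p)\<^sup>2 / (p \<bullet> p) + (x \<bullet> q)\<^sup>2 / (q \<bullet> q)"
proof -
  have pp: "p \<bullet> p > 0" "q \<bullet> q > 0" using assms by auto
  have "(x \<bullet> x) * ((p \<bullet> p) * (q \<bullet> q)) = (x \<bullet> p)\<^sup>2 * (q \<bullet> q) + (x \<bullet> q)\<^sup>2 * (p \<bullet> p)"
    using assms(1) unfolding inner_point by algebra
  then show ?thesis using pp by (simp add: power2_norm_eq_inner field_simps)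
qed

text \<open>The map carrying the orthogonal basis \<open>A - C\<close>, \<open>B - C\<close> to
  \<open>A' - C'\<close>, \<open>B' - C'\<close> stretches both directions by \<open>r\<close>,
  hence all vectors. It may reverse orientation, so mirror images need no separate
  treatment.\<close>

lemma right_triangle_similarity:
  fixes A B C A' B' C' :: point
  assumes "(A - C) \<bullet> (B - C) = 0" "A \<noteq> C" "B \<noteq> C" "(A' - C') \<bullet> (B' - C') = 0"
    "dist A' C' = r * dist A C" "dist B' C' = r * dist B C" "r > 0"
  obtains f where "similarity r f" "f A = A'" "f B = B'" "f C = C'"
proof
  define p q p' q' where "p = A - C" and "q = B - C" and "p' = A' - C'" and "q' = B' - C'"
  have pq: "p \<bullet> q = 0" "q \<bullet> p = 0" "p \<noteq> 0" "q \<noteq> 0" "p' \<bullet> q' = 0" "q' \<bullet> p' = 0" and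
    n: "norm p' = r * norm p" "norm q' = r * norm q"
    using assms by (auto simp: p_def q_def p'_def q'_def dist_norm inner_commute)
  have pp: "p \<bullet> p > 0" "q \<bullet> q > 0" using pq by auto
  have n': "p' \<bullet> p' = r\<^sup>2 * (p \<bullet> p)" "q' \<bullet> q' = r\<^sup>2 * (q \<bullet> q)"
    using n by (metis power2_norm_eq_inner power_mult_distrib)+
  define f where "f x = C' + ((x - C) \<bullet> p / (p \<bullet> p)) *\<^sub>R p' + ((x - C) \<bullet> q / (q \<bullet> q)) *\<^sub>R q'" for x
  show "f A = A'" "f B = B'" "f C = C'"
    using pq pp by (auto simp: f_def p_def[symmetric] q_def[symmetric]) (auto simp: p'_def q'_def)
  have "dist (f x) (f y) = r * dist x y" for x y
  proof -
    define a b where "a = (x - y) \<bullet> p / (p \<bullet> p)" and "b = (x - y) \<bullet> q / (q \<bullet> q)"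
    have fxy: "f x - f y = a *\<^sub>R p' + b *\<^sub>R q'"
    proof -
      have "a = (x - C) \<bullet> p / (p \<bullet> p) - (y - C) \<bullet> p / (p \<bullet> p)"
        "b = (x - C) \<bullet> q / (q \<bullet> q) - (y - C) \<bullet> q / (q \<bullet> q)"
        by (simp_all add: a_def b_def inner_diff_left diff_divide_distrib)
      then show ?thesis by (simp add: f_def scaleR_left_diff_distrib)
    qed
    have "(norm (f x - f y))\<^sup>2 = a\<^sup>2 * (p' \<bullet> p') + b\<^sup>2 * (q' \<bullet> q')"
      unfolding fxy power2_norm_eq_inner using pq(5,6)
      by (simp add: inner_add_left inner_add_right power2_eq_square)
    also have "\<dots> = r\<^sup>2 * (((x - y) \<bullet> p)\<^sup>2 / (p \<bullet> p) + ((x - y) \<bullet> q)\<^sup>2 / (q \<bullet> q))"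
      unfolding n' a_def b_def using pp by (simp add: power2_eq_square field_simps)
    also have "\<dots> = (r * norm (x - y))\<^sup>2"
      using orthogonal_expansion[OF pq(1,3,4), of "x - y"] by (simp add: power_mult_distrib)
    finally have "norm (f x - f y) = r * norm (x - y)"
      using assms(7) by (simp add: power2_eq_iff_nonneg)
    then show ?thesis by (simp add: dist_norm)
  qed
  then show "similarity r f" using assms(7) by (simp add: similarity_def)
qed

text \<open>A piece of scale \<open>s\<close> relative to \<open>ABC\<close>, cut further with
  parameter \<open>k\<close>. Legs are compared by their squares because inner products give these
  directly.\<close>

lemma tiled_by_piece:
  fixes A B C A' B' C' :: point
  assumes "nondegenerate_triangle A B C" "(A - C) \<bullet> (B - C) = 0" "(A' - C') \<bullet> (B' - C') = 0"
    "(dist A' C')\<^sup>2 = s\<^sup>2 * (dist A C)\<^sup>2" "(dist B' C')\<^sup>2 = s\<^sup>2 * (dist B C)\<^sup>2" "s > 0" "k > 0" "r = s / real k"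
  shows "tiled_by (closed_triangle A' B' C') (closed_triangle A B C) r (k\<^sup>2)"
proof -
  have "A \<noteq> C" "B \<noteq> C" using assms(1) by (auto simp: nondegenerate_triangle_def insert_commute)
  moreover have "dist A' C' = s * dist A C" "dist B' C' = s * dist B C"
    using assms(4-6) by (auto simp: power2_eq_iff_nonneg simp flip: power_mult_distrib)
  ultimately obtain f where f: "similarity s f" "f A = A'" "f B = B'" "f C = C'"
    using right_triangle_similarity[OF assms(2) _ _ assms(3)] assms(6) by metis
  show ?thesis
    using tiled_by_image[OF tiled_by_square[OF assms(1,7)] f(1)] similarity_triangle[OF f(1)] f(2-4) assms(8)
    by simp
qed

text \<open>Let \<open>a\<close>, \<open>b\<close> be the legs opposite \<open>A\<close>,
  \<open>B\<close> and \<open>c\<close> the hypotenuse. The altitude from \<open>C\<close> leaves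
  two triangles of scales \<open>b / c\<close> and \<open>a / c\<close>. Cut into
  \<open>f\<^sup>2\<close> and \<open>e\<^sup>2\<close> parts, they have tiles of scales
  \<open>b / (c * f)\<close> and \<open>a / (c * e)\<close>, which agree because
  \<open>a * f = b * e\<close>.\<close>

lemma tiled_by_sum_squares:
  fixes A B C :: point and e f :: nat
  assumes nd: "nondegenerate_triangle A B C" and perp: "(A - C) \<bullet> (B - C) = 0"
    and ef: "e > 0" "f > 0" "dist B C * f = dist A C * e"
  defines "S \<equiv> closed_triangle A B C"
  shows "\<exists>r. tiled_by S S r (f\<^sup>2 + e\<^sup>2)"
proof -
  define p q where "p = A - C" and "q = B - C"
  have ne: "A \<noteq> C" "B \<noteq> C" using nd by (auto simp: nondegenerate_triangle_def insert_commute)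
  define a b where "a = dist B C" and "b = dist A C"
  have ab: "a > 0" "b > 0" using ne by (auto simp: a_def b_def)
  have pq: "p \<bullet> q = 0" "q \<bullet> p = 0" "p \<bullet> p = b\<^sup>2" "q \<bullet> q = a\<^sup>2"
    using perp by (auto simp: p_def q_def a_def b_def dist_norm power2_norm_eq_inner inner_commute)
  \<comment> \<open>The foot of the altitude is at distance \<open>b\<^sup>2 / c\<close> from
    \<open>A\<close>, with \<open>c\<close> the length of \<open>AB\<close>, hence at the fraction
    \<open>b\<^sup>2 / c\<^sup>2\<close> of \<open>AB\<close>.\<close>
  define t where "t = b\<^sup>2 / (a\<^sup>2 + b\<^sup>2)"
  have c: "a\<^sup>2 + b\<^sup>2 > 0" using ab by (simp add: add_pos_pos)
  have t: "0 < t" "t < 1" using ab c by (auto simp: t_def field_simps)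
  have t1: "1 - t = a\<^sup>2 / (a\<^sup>2 + b\<^sup>2)" using c unfolding t_def by (subst eq_divide_eq) (use c ab in \<open>simp add: left_diff_distrib\<close>)
  define H where "H = A + t *\<^sub>R (B - A)"
  have H: "A - H = t *\<^sub>R (p - q)" "B - H = (1 - t) *\<^sub>R (q - p)" "C - H = - ((1 - t) *\<^sub>R p + t *\<^sub>R q)"
    by (simp_all add: H_def p_def q_def algebra_simps)
  have bal: "t * a\<^sup>2 = (1 - t) * b\<^sup>2" unfolding t1 by (simp add: t_def)
  have perps: "(A - H) \<bullet> (C - H) = 0" "(C - H) \<bullet> (B - H) = 0"
  proof -
    have "(A - H) \<bullet> (C - H) = t * (t * a\<^sup>2 - (1 - t) * b\<^sup>2)"
      "(C - H) \<bullet> (B - H) = (1 - t) * ((1 - t) * b\<^sup>2 - t * a\<^sup>2)"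
      unfolding H using pq by (simp_all add: inner_simps algebra_simps)
    then show "(A - H) \<bullet> (C - H) = 0" "(C - H) \<bullet> (B - H) = 0" using bal by simp_all
  qed
  have d: "(dist A H)\<^sup>2 = t\<^sup>2 * (a\<^sup>2 + b\<^sup>2)" "(dist B H)\<^sup>2 = (1 - t)\<^sup>2 * (a\<^sup>2 + b\<^sup>2)"
    "(dist C H)\<^sup>2 = (1 - t)\<^sup>2 * b\<^sup>2 + t\<^sup>2 * a\<^sup>2"
    unfolding dist_norm power2_norm_eq_inner H using pq
    by (simp_all add: inner_simps algebra_simps power2_eq_square)
  define s1 s2 where "s1 = b / sqrt (a\<^sup>2 + b\<^sup>2)" and "s2 = a / sqrt (a\<^sup>2 + b\<^sup>2)"
  have s: "s1\<^sup>2 = t" "s2\<^sup>2 = 1 - t" "s1 > 0" "s2 > 0"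
    using c ab unfolding t1 by (auto simp: s1_def s2_def t_def power_divide)
  have r: "s1 / real f = s2 / real e"
    using ef ab c unfolding a_def[symmetric] b_def[symmetric] by (simp add: s1_def s2_def field_simps)
  have tb: "t * (a\<^sup>2 + b\<^sup>2) = b\<^sup>2" "(1 - t) * (a\<^sup>2 + b\<^sup>2) = a\<^sup>2"
    using c unfolding t1 by (simp_all add: t_def)
  have 1: "tiled_by (closed_triangle A C H) S (s1 / real f) (f\<^sup>2)"
    unfolding S_def
  proof (rule tiled_by_piece[OF nd perp, where s = s1])
    show "(dist A H)\<^sup>2 = s1\<^sup>2 * (dist A C)\<^sup>2"
      unfolding d s b_def[symmetric] using tb by (metis mult.assoc power2_eq_square)
    have "(1 - t)\<^sup>2 * b\<^sup>2 + t\<^sup>2 * a\<^sup>2 = t * a\<^sup>2"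
      using bal by (simp add: power2_eq_square mult.assoc) (simp add: algebra_simps)
    then show "(dist C H)\<^sup>2 = s1\<^sup>2 * (dist B C)\<^sup>2" unfolding d s a_def[symmetric] .
  qed (use perps s ef in auto)
  have 2: "tiled_by (closed_triangle C B H) S (s1 / real f) (e\<^sup>2)"
    unfolding S_def
  proof (rule tiled_by_piece[OF nd perp, where s = s2])
    have "(1 - t)\<^sup>2 * b\<^sup>2 + t\<^sup>2 * a\<^sup>2 = (1 - t) * b\<^sup>2"
      using bal by (simp add: power2_eq_square mult.assoc) (simp add: algebra_simps)
    then show "(dist C H)\<^sup>2 = s2\<^sup>2 * (dist A C)\<^sup>2" unfolding d s b_def[symmetric] .
    show "(dist B H)\<^sup>2 = s2\<^sup>2 * (dist B C)\<^sup>2"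
      unfolding d s a_def[symmetric] using tb by (metis mult.assoc power2_eq_square)
  qed (use perps s ef r in auto)
  have "S = closed_triangle A C H \<union> closed_triangle C B H"
    "interior (closed_triangle A C H) \<inter> interior (closed_triangle C B H) = {}"
    using triangle_split(1,2)[OF nd t] by (simp_all add: S_def H_def closed_triangle_def insert_commute)
  then show ?thesis
    using tiled_by_Un[OF 1 2] interior_triangle_nonempty[OF nd] by (auto simp: S_def)
qed

text \<open>The hypothesis on the legs says that the angle at \<open>A\<close> is 30 degrees. The
  bisector of the 60 degree angle at \<open>B\<close> meets \<open>AC\<close> in \<open>D\<close>,
  and \<open>M\<close> is the foot of the perpendicular from \<open>D\<close> to \<open>AB\<close>;
  this gives three congruent triangles of the same shape.\<close>

lemma tiled_by_three_squares:
  fixes A B C :: point and k :: nat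
  assumes nd: "nondegenerate_triangle A B C" and perp: "(A - C) \<bullet> (B - C) = 0"
    and k: "k > 0" and b: "(dist A C)\<^sup>2 = 3 * (dist B C)\<^sup>2"
  defines "S \<equiv> closed_triangle A B C"
  shows "\<exists>r. tiled_by S S r (3 * k\<^sup>2)"
proof -
  define p q where "p = A - C" and "q = B - C"
  define a where "a = dist B C"
  have pq: "p \<bullet> q = 0" "q \<bullet> p = 0" "p \<bullet> p = 3 * a\<^sup>2" "q \<bullet> q = a\<^sup>2"
    using perp b by (auto simp: p_def q_def a_def dist_norm power2_norm_eq_inner inner_commute)
  have dA: "(dist A C)\<^sup>2 = 3 * a\<^sup>2" "(dist B C)\<^sup>2 = a\<^sup>2" using b by (auto simp: a_def)
  \<comment> \<open>\<open>CD\<close> is a third of \<open>AC\<close> by the angle bisector theorem,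
    as \<open>AB = 2 * BC\<close>. The triangle \<open>ABD\<close> is isosceles, so the foot of the
    perpendicular is the midpoint of \<open>AB\<close>.\<close>
  define D M where "D = A + (2/3) *\<^sub>R (C - A)" and "M = A + (1/2) *\<^sub>R (B - A)"
  have v: "D - C = (1/3) *\<^sub>R p" "B - C = q" "A - M = (1/2) *\<^sub>R (p - q)" "B - M = (1/2) *\<^sub>R (q - p)"
    "D - M = - ((1/6) *\<^sub>R p + (1/2) *\<^sub>R q)"
    by (simp_all add: D_def M_def p_def q_def point_eq_iff) (simp_all add: field_simps)
  \<comment> \<open>The longer leg of each part has the length of \<open>BC\<close>, the shorter leg
    of \<open>ABC\<close>, so the scale is the ratio of the legs of \<open>ABC\<close>.\<close>
  define s where "s = 1 / sqrt 3"
  have s: "s\<^sup>2 = 1 / 3" "s > 0" by (simp_all add: s_def power_divide)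
  have perps: "(B - C) \<bullet> (D - C) = 0" "(A - M) \<bullet> (D - M) = 0" "(B - M) \<bullet> (D - M) = 0"
    unfolding v using pq by (simp_all add: inner_simps algebra_simps)
  have d: "(dist D C)\<^sup>2 = a\<^sup>2 / 3" "(dist A M)\<^sup>2 = a\<^sup>2" "(dist B M)\<^sup>2 = a\<^sup>2" "(dist D M)\<^sup>2 = a\<^sup>2 / 3"
    unfolding dist_norm power2_norm_eq_inner v using pq by (simp_all add: inner_simps algebra_simps)
  have 1: "tiled_by (closed_triangle B D C) S (s / real k) (k\<^sup>2)"
    unfolding S_def by (rule tiled_by_piece[OF nd perp, where s = s]) (use perps s(2) k in \<open>auto simp: d dA s(1)\<close>)
  have 2: "tiled_by (closed_triangle A D M) S (s / real k) (k\<^sup>2)"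
    unfolding S_def by (rule tiled_by_piece[OF nd perp, where s = s]) (use perps s(2) k in \<open>auto simp: d dA s(1)\<close>)
  have 3: "tiled_by (closed_triangle B D M) S (s / real k) (k\<^sup>2)"
    unfolding S_def by (rule tiled_by_piece[OF nd perp, where s = s]) (use perps s(2) k in \<open>auto simp: d dA s(1)\<close>)
  have nd2: "nondegenerate_triangle A C B" using nd by (simp add: nondegenerate_triangle_def insert_commute)
  note sp = triangle_split[OF nd2, of "2/3", folded D_def]
  have nd3: "nondegenerate_triangle A B D" using sp(3) by (simp add: nondegenerate_triangle_def insert_commute)
  note sp2 = triangle_split[OF nd3, of "1/2", folded M_def]
  have neS: "interior S \<noteq> {}" using interior_triangle_nonempty[OF nd] by (simp add: S_def)
  have 4: "tiled_by (closed_triangle A B D) S (s / real k) (k\<^sup>2 + k\<^sup>2)"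
    using tiled_by_Un[OF 2 3 _ neS] sp2(1,2) by (simp add: closed_triangle_def insert_commute)
  have "tiled_by S S (s / real k) ((k\<^sup>2 + k\<^sup>2) + k\<^sup>2)"
    using tiled_by_Un[OF 4 1 _ neS] sp(1,2) by (simp add: S_def closed_triangle_def insert_commute)
  moreover have "(k\<^sup>2 + k\<^sup>2) + k\<^sup>2 = 3 * k\<^sup>2" by simp
  ultimately show ?thesis by metis
qed

section \<open>Conjugation and rational cosines\<close>

lemma sqrt_nonsquare_irrational:
  assumes "\<not> (\<exists>k::nat. N = k\<^sup>2)"
  shows "sqrt (real N) \<notin> \<rat>"
proof
  assume "sqrt (real N) \<in> \<rat>"
  then obtain m n :: nat where mn: "n \<noteq> 0" "\<bar>sqrt (real N)\<bar> = m / n" "coprime m n"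
    by (rule Rats_abs_nat_div_natE)
  then have "sqrt (real N) * n = m" by simp
  then have "(sqrt (real N) * n)\<^sup>2 = (real m)\<^sup>2" by simp
  then have "real N * (real n)\<^sup>2 = (real m)\<^sup>2" by (simp add: power_mult_distrib)
  then have e: "N * n\<^sup>2 = m\<^sup>2" by (metis of_nat_mult of_nat_power of_nat_eq_iff)
  then have "n\<^sup>2 dvd m\<^sup>2" by (metis dvd_triv_right)
  then have "n dvd m" by simp
  then have "n = 1" using mn(3) by (metis coprime_common_divisor_nat dvd_refl)
  then show False using e assms by auto
qed

text \<open>Elements of the field generated by \<open>l\<close>, paired with their conjugates under
  the change of sign of \<open>l\<close>. A relation avoids constructing the field; it is functional
  once \<open>l\<close> is irrational.\<close>

definition quadratic_pair :: "real \<Rightarrow> real \<Rightarrow> real \<Rightarrow> bool" where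
  "quadratic_pair l z z' \<longleftrightarrow> (\<exists>s\<in>\<rat>. \<exists>t\<in>\<rat>. z = s + t * l \<and> z' = s - t * l)"

lemma quadratic_pair_Rats: "z \<in> \<rat> \<Longrightarrow> quadratic_pair l z z"
  unfolding quadratic_pair_def by (intro bexI[of _ z] bexI[of _ 0]) auto

lemma quadratic_pair_generator: "quadratic_pair l l (- l)"
  unfolding quadratic_pair_def by (intro bexI[of _ 0] bexI[of _ 1]) auto

lemma quadratic_pair_add:
  assumes "quadratic_pair l z z'" "quadratic_pair l w w'"
  shows "quadratic_pair l (z + w) (z' + w')"
proof -
  obtain s t u v where *: "s \<in> \<rat>" "t \<in> \<rat>" "z = s + t * l" "z' = s - t * l"
      "u \<in> \<rat>" "v \<in> \<rat>" "w = u + v * l" "w' = u - v * l"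
    using assms by (auto simp: quadratic_pair_def)
  then show ?thesis unfolding quadratic_pair_def
    by (intro bexI[of _ "s + u"] bexI[of _ "t + v"]) (auto simp: algebra_simps)
qed

lemma quadratic_pair_mult:
  assumes "quadratic_pair l z z'" "quadratic_pair l w w'" "l\<^sup>2 \<in> \<rat>"
  shows "quadratic_pair l (z * w) (z' * w')"
proof -
  obtain s t u v where *: "s \<in> \<rat>" "t \<in> \<rat>" "z = s + t * l" "z' = s - t * l"
      "u \<in> \<rat>" "v \<in> \<rat>" "w = u + v * l" "w' = u - v * l"
    using assms by (auto simp: quadratic_pair_def)
  show ?thesis unfolding quadratic_pair_def
  proof (rule bexI[of _ "s * u + t * v * l\<^sup>2"], rule bexI[of _ "s * v + t * u"], intro conjI)
    show "s * u + t * v * l\<^sup>2 \<in> \<rat>" "s * v + t * u \<in> \<rat>" using * assms(3) by auto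
  qed (simp_all add: *(3,4,7,8) algebra_simps power2_eq_square)
qed

lemma quadratic_pair_unique:
  assumes "quadratic_pair l z z'" "quadratic_pair l z z''" "l \<notin> \<rat>"
  shows "z' = z''"
proof -
  obtain s t u v where *: "s \<in> \<rat>" "t \<in> \<rat>" "z = s + t * l" "z' = s - t * l"
      "u \<in> \<rat>" "v \<in> \<rat>" "z = u + v * l" "z'' = u - v * l"
    using assms(1,2) by (auto simp: quadratic_pair_def)
  have "t = v"
  proof (rule ccontr)
    assume "t \<noteq> v"
    then have "l = (u - s) / (t - v)" using * by (simp add: field_simps)
    then show False using * assms(3) by auto
  qed
  then show ?thesis using * by auto
qed

text \<open>The norm \<open>z * z'\<close> is rational, so the inverse of \<open>z\<close> is a
  rational multiple of \<open>z'\<close>.\<close>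

lemma quadratic_pair_inverse:
  assumes "quadratic_pair l z z'" "l \<notin> \<rat>" "l\<^sup>2 \<in> \<rat>" "z \<noteq> 0"
  shows "quadratic_pair l (inverse z) (inverse z')"
proof -
  obtain s t where *: "s \<in> \<rat>" "t \<in> \<rat>" "z = s + t * l" "z' = s - t * l"
    using assms(1) by (auto simp: quadratic_pair_def)
  \<comment> \<open>If \<open>z'\<close> were \<open>0\<close>, its conjugate \<open>z\<close> would
    be \<open>0\<close> as well, by uniqueness.\<close>
  have z': "z' \<noteq> 0"
  proof
    assume "z' = 0"
    then have "quadratic_pair l z' z'" by (simp add: quadratic_pair_Rats)
    moreover have "quadratic_pair l z' z" unfolding quadratic_pair_def using *
      by (intro bexI[of _ s] bexI[of _ "-t"]) auto
    ultimately show False using quadratic_pair_unique assms(2,4) \<open>z' = 0\<close> by metis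
  qed
  define n where "n = z * z'"
  have n: "n \<in> \<rat>" "n \<noteq> 0"
  proof -
    have "n = s\<^sup>2 - t\<^sup>2 * l\<^sup>2" unfolding n_def * by (simp add: algebra_simps power2_eq_square)
    then show "n \<in> \<rat>" using * assms(3) by simp
    show "n \<noteq> 0" using z' assms(4) by (simp add: n_def)
  qed
  have "inverse z = z' / n" "inverse z' = z / n" using z' assms(4) by (auto simp: n_def field_simps)
  moreover have "quadratic_pair l (z' / n) (z / n)"
    unfolding quadratic_pair_def using * n
    by (intro bexI[of _ "s / n"] bexI[of _ "- t / n"]) (auto simp: field_simps)
  ultimately show ?thesis by simp
qed

text \<open>Two rows suffice to place \<open>x\<close> and \<open>y\<close> in the field of
  \<open>l\<close>. As \<open>m13\<close> is nonzero, the first eliminates \<open>y\<close>; the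
  second is then linear in \<open>x\<close>, and its leading coefficient is \<open>l\<close> minus a
  rational number, which cannot vanish.\<close>

lemma quadratic_pair_solve:
  assumes l: "l \<notin> \<rat>" "l\<^sup>2 \<in> \<rat>"
    and eqs: "l = real m11 + real m12 * x + real m13 * y"
      "l * x = real m21 + real m22 * x + real m23 * y"
    and "m13 \<noteq> 0"
  shows "\<exists>x' y'. quadratic_pair l x x' \<and> quadratic_pair l y y'"
proof -
  have m: "real m13 \<noteq> 0" using assms(5) by simp
  have y: "y = (l + - real m11 + - real m12 * x) * inverse (real m13)"
    using eqs(1) m by (simp add: field_simps)
  define k where "k = l + (- real m22 + real m23 * real m12 * inverse (real m13))"
  have "k \<noteq> 0"
  proof
    assume "k = 0"
    then have "l = real m22 - real m23 * real m12 * inverse (real m13)" by (simp add: k_def)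
    then show False using l(1) by (metis Rats_diff Rats_inverse Rats_mult Rats_of_nat)
  qed
  have "k * x = real m21 + real m23 * (l + - real m11) * inverse (real m13)"
    unfolding k_def using eqs(2)[unfolded y] m by (simp add: field_simps)
  then have x: "x = (real m21 + real m23 * (l + - real m11) * inverse (real m13)) * inverse k"
    using \<open>k \<noteq> 0\<close> by (simp add: field_simps)
  note intros = quadratic_pair_add quadratic_pair_mult quadratic_pair_generator quadratic_pair_Rats
  have "\<exists>k'. quadratic_pair l k k'" unfolding k_def
    by (rule exI, rule quadratic_pair_add[OF quadratic_pair_generator], rule quadratic_pair_Rats) auto
  then obtain k' where "quadratic_pair l (inverse k) k'"
    using quadratic_pair_inverse l \<open>k \<noteq> 0\<close> by blast
  then have "\<exists>x'. quadratic_pair l x x'" unfolding x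
    using intros l(2) by (meson Rats_minus_iff Rats_of_nat Rats_inverse)
  then obtain x' where x': "quadratic_pair l x x'" by blast
  then have "\<exists>y'. quadratic_pair l y y'" unfolding y
    using intros l(2) by (meson Rats_minus_iff Rats_of_nat Rats_inverse)
  with x' show ?thesis by blast
qed

text \<open>A Perron-Frobenius comparison in the row where the ratio \<open>m = |w'| / w\<close> is
  strictly largest. Moving the diagonal entry to the left gives
  \<open>(l + d2) * m * w \<le> d1 * |u'| + d3 * |v'|\<close>, whereas the positive eigenvector
  gives \<open>(l - d2) * m * w = m * (d1 * u + d3 * v)\<close>. So the whole row vanishes, against
  \<open>l * w > 0\<close>.\<close>

lemma nonneg_combination_strict:
  fixes d1 d2 d3 :: nat and l u v w u' v' w' m :: real
  assumes eq: "l * w = real d1 * u + real d2 * w + real d3 * v" "l > 0" "w > 0" "m > 0"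
    and eq': "- l * w' = real d1 * u' + real d2 * w' + real d3 * v'"
    and b: "\<bar>w'\<bar> = m * w" "\<bar>u'\<bar> < m * u" "\<bar>v'\<bar> < m * v"
  shows False
proof -
  have "(l + real d2) * (m * w) = \<bar>(l + real d2) * w'\<bar>"
    using eq(2) by (simp add: abs_mult b(1))
  also have "(l + real d2) * w' = - (real d1 * u' + real d3 * v')" using eq' by (simp add: algebra_simps)
  also have "\<bar>- (real d1 * u' + real d3 * v')\<bar> \<le> real d1 * \<bar>u'\<bar> + real d3 * \<bar>v'\<bar>"
    using abs_triangle_ineq[of "real d1 * u'" "real d3 * v'"]
    by (simp add: abs_mult)
  finally have 1: "l * (m * w) + real d2 * (m * w) \<le> real d1 * \<bar>u'\<bar> + real d3 * \<bar>v'\<bar>"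
    by (simp add: distrib_right)
  have 2: "l * (m * w) = real d1 * (m * u) + real d2 * (m * w) + real d3 * (m * v)"
    using arg_cong[OF eq(1), of "\<lambda>x. m * x"] by (simp add: algebra_simps)
  have mw: "m * w > 0" using eq by simp
  have le: "real d1 * \<bar>u'\<bar> \<le> real d1 * (m * u)" "real d3 * \<bar>v'\<bar> \<le> real d3 * (m * v)"
    using b by (auto intro: mult_left_mono)
  have "real d2 * (m * w) \<ge> 0" using mw by simp
  then have "real d1 * \<bar>u'\<bar> = real d1 * (m * u)" "real d3 * \<bar>v'\<bar> = real d3 * (m * v)" "real d2 * (m * w) = 0"
    using 1 2 le by linarith+
  then have "d1 = 0" "d3 = 0" "d2 = 0" using b mw by auto
  then have "l * w = 0" using eq(1) by simp
  then show False using eq by simp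
qed

text \<open>Conjugation respects sums, products and rational constants, so uniqueness of conjugates
  transfers the equation.\<close>

lemma quadratic_pair_eq:
  assumes l: "l \<notin> \<rat>" "l\<^sup>2 \<in> \<rat>"
    and "quadratic_pair l x x'" "quadratic_pair l y y'" "quadratic_pair l z z'"
    and "l * z = real d1 + real d2 * x + real d3 * y"
  shows "- l * z' = real d1 + real d2 * x' + real d3 * y'"
proof (rule quadratic_pair_unique[OF _ _ l(1)])
  show "quadratic_pair l (l * z) (- l * z')"
    by (intro quadratic_pair_mult quadratic_pair_generator assms)
  show "quadratic_pair l (l * z) (real d1 + real d2 * x' + real d3 * y')"
    unfolding assms(6)
    by (intro quadratic_pair_mult quadratic_pair_add assms quadratic_pair_Rats) auto
qed

text \<open>Conjugating \<open>l\<close> to \<open>- l\<close> turns the positive eigenvector \<open>(1, x, y)\<close> of a nonnegative integer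
  matrix into an eigenvector \<open>(1, x', y')\<close> for \<open>- l\<close>.  By a Perron-Frobenius argument, and because
  the Pythagorean relation survives conjugation, its entries have the same absolute values, so the
  sign pattern forces the zero pattern of the matrix.\<close>

lemma side_matrix_zero_pattern_aux:
  fixes d11 d12 d13 d21 d22 d23 d31 d32 d33 :: nat and l x y :: real
  assumes l: "l \<notin> \<rat>" "l\<^sup>2 \<in> \<rat>" "l > 0" and xy: "x > 0" "y > 0" "1 + x\<^sup>2 = y\<^sup>2"
    and eq: "l = real d11 + real d12 * x + real d13 * y"
      "l * x = real d21 + real d22 * x + real d23 * y"
      "l * y = real d31 + real d32 * x + real d33 * y"
  shows "(d11 = 0 \<and> d12 = 0 \<and> d21 = 0 \<and> d22 = 0 \<and> d33 = 0) \<or>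
    (d22 = 0 \<and> d23 = 0 \<and> d32 = 0 \<and> d33 = 0 \<and> d11 = 0) \<or>
    (d11 = 0 \<and> d13 = 0 \<and> d31 = 0 \<and> d33 = 0 \<and> d22 = 0)"
proof -
  have "\<exists>x' y'. quadratic_pair l x x' \<and> quadratic_pair l y y'"
  proof (cases "d13 = 0")
    case False
    then show ?thesis using quadratic_pair_solve[OF l(1,2) eq(1,2)] by blast
  next
    case True
    \<comment> \<open>Otherwise \<open>l = d11\<close> would be rational. So the roles of
      \<open>x\<close> and \<open>y\<close> can be exchanged.\<close>
    have "d12 \<noteq> 0" using eq(1) l(1) True by (metis Rats_of_nat add.right_neutral mult_zero_left of_nat_0)
    then show ?thesis
      using quadratic_pair_solve[OF l(1,2), of d11 d13 y d12 x d31 d33 d32] eq(1,3) by (auto simp: ac_simps)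
  qed
  then obtain x' y' where q: "quadratic_pair l x x'" "quadratic_pair l y y'" by blast
  have q1: "quadratic_pair l 1 1" by (simp add: quadratic_pair_Rats)
  have eq': "- l = real d11 + real d12 * x' + real d13 * y'"
      "- l * x' = real d21 + real d22 * x' + real d23 * y'"
      "- l * y' = real d31 + real d32 * x' + real d33 * y'"
    using quadratic_pair_eq[OF l(1,2) q q1] quadratic_pair_eq[OF l(1,2) q q(1)]
      quadratic_pair_eq[OF l(1,2) q q(2)] eq by auto
  have py: "1 + x'\<^sup>2 = y'\<^sup>2"
  proof (rule quadratic_pair_unique[OF _ _ l(1)])
    show "quadratic_pair l (1 + x\<^sup>2) (1 + x'\<^sup>2)" "quadratic_pair l (1 + x\<^sup>2) (y'\<^sup>2)"
      unfolding power2_eq_square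
      using quadratic_pair_add[OF q1 quadratic_pair_mult[OF q(1,1) l(2)]]
        quadratic_pair_mult[OF q(2,2) l(2)] xy(3) by (simp_all add: power2_eq_square)
  qed
  \<comment> \<open>If \<open>|x'| < x\<close>, Pythagoras gives \<open>|y'| < y\<close>, and the
    first row is the strict one, with ratio 1. If \<open>|x'| > x\<close>, the ratio
    \<open>m\<close> of the second row exceeds 1 and, again by Pythagoras, also
    \<open>|y'| / y\<close>.\<close>
  have ax: "\<bar>x'\<bar> = x"
  proof (cases "\<bar>x'\<bar>" x rule: linorder_cases)
    case less
    then have "x'\<^sup>2 < x\<^sup>2" using xy by (metis abs_ge_zero power2_abs power_strict_mono zero_less_numeral)
    then have "\<bar>y'\<bar>\<^sup>2 < y\<^sup>2" using py xy by simp
    then have "\<bar>y'\<bar> < y" using xy by (simp add: power2_less_imp_less)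
    then have False
      using nonneg_combination_strict[of l 1 d12 x d11 d13 y 1 1 x' y'] less eq(1) eq'(1) l(3)
      by (simp add: algebra_simps)
    then show ?thesis ..
  next
    case greater
    define m where "m = \<bar>x'\<bar> / x"
    have m: "m > 1" "\<bar>x'\<bar> = m * x" using greater xy by (auto simp: m_def)
    have "\<bar>y'\<bar>\<^sup>2 < m\<^sup>2 * y\<^sup>2"
    proof -
      have "x'\<^sup>2 = m\<^sup>2 * x\<^sup>2" using m(2) by (metis power2_abs power_mult_distrib)
      moreover have "m\<^sup>2 > 1" using m by simp
      ultimately show ?thesis using py xy(3) by (simp add: algebra_simps flip: xy(3))
    qed
    then have "\<bar>y'\<bar>\<^sup>2 < (m * y)\<^sup>2" by (simp add: power_mult_distrib)
    then have "\<bar>y'\<bar> < m * y" using xy(2) m(1) by (intro power2_less_imp_less[of _ "m * y"]) simp_all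
    then have False
      using nonneg_combination_strict[of l x d21 1 d22 d23 y m x' 1 y'] m eq(2) eq'(2) l(3) xy
      by (simp add: algebra_simps)
    then show ?thesis ..
  qed
  have "\<bar>y'\<bar>\<^sup>2 = y\<^sup>2" using py xy ax by (metis power2_abs)
  then have ay: "\<bar>y'\<bar> = y" using xy(2) power2_eq_imp_eq[of "\<bar>y'\<bar>" y] by simp
  have nn: "real d12 * x \<ge> 0" "real d13 * y \<ge> 0" "real d22 * x \<ge> 0" "real d23 * y \<ge> 0"
    "real d32 * x \<ge> 0" "real d33 * y \<ge> 0" "real d11 \<ge> 0" "real d21 \<ge> 0" "real d31 \<ge> 0" using xy by auto
  \<comment> \<open>Keeping both signs would give \<open>l = - l\<close>. In each other case,
    comparing every equation with its conjugate leaves vanishing sums of nonnegative terms.\<close>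
  consider "x' = x" "y' = y" | "x' = x" "y' = - y" | "x' = - x" "y' = y" | "x' = - x" "y' = - y"
    using ax ay by linarith
  then show ?thesis
  proof cases
    case 1
    then have "l = - l" using eq(1) eq'(1) by simp
    then show ?thesis using l(3) by linarith
  next
    case 2
    have "real d11 = 0" "real d12 * x = 0" "real d21 = 0" "real d22 * x = 0" "real d33 * y = 0"
      using eq eq'[unfolded 2 mult_minus_left mult_minus_right minus_minus] nn by linarith+
    then show ?thesis using xy by simp
  next
    case 3
    have "real d11 = 0" "real d13 * y = 0" "real d31 = 0" "real d33 * y = 0" "real d22 * x = 0"
      using eq eq'[unfolded 3 mult_minus_left mult_minus_right minus_minus] nn by linarith+
    then show ?thesis using xy by simp
  next
    case 4
    have "real d11 = 0" "real d22 * x = 0" "real d23 * y = 0" "real d32 * x = 0" "real d33 * y = 0"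
      using eq eq'[unfolded 4 mult_minus_left mult_minus_right minus_minus] nn by linarith+
    then show ?thesis using xy by simp
  qed
qed

lemma side_matrix_zero_pattern:
  fixes d11 d12 d13 d21 d22 d23 d31 d32 d33 :: nat and l a b c :: real
  assumes l: "l \<notin> \<rat>" "l\<^sup>2 \<in> \<rat>" "l > 0" and abc: "a > 0" "b > 0" "c > 0" "a\<^sup>2 + b\<^sup>2 = c\<^sup>2"
    and eq: "l * a = real d11 * a + real d12 * b + real d13 * c"
      "l * b = real d21 * a + real d22 * b + real d23 * c"
      "l * c = real d31 * a + real d32 * b + real d33 * c"
  shows "(d11 = 0 \<and> d12 = 0 \<and> d21 = 0 \<and> d22 = 0 \<and> d33 = 0) \<or>
    (d22 = 0 \<and> d23 = 0 \<and> d32 = 0 \<and> d33 = 0 \<and> d11 = 0) \<or>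
    (d11 = 0 \<and> d13 = 0 \<and> d31 = 0 \<and> d33 = 0 \<and> d22 = 0)"
proof (rule side_matrix_zero_pattern_aux[OF l, of "b / a" "c / a"])
  show "b / a > 0" "c / a > 0" using abc by auto
  show "1 + (b / a)\<^sup>2 = (c / a)\<^sup>2" using abc by (simp add: field_simps)
  show "l = real d11 + real d12 * (b / a) + real d13 * (c / a)"
    "l * (b / a) = real d21 + real d22 * (b / a) + real d23 * (c / a)"
    "l * (c / a) = real d31 + real d32 * (b / a) + real d33 * (c / a)"
    using eq abc(1) by (simp_all add: field_simps)
qed

text \<open>Niven's theorem by angle doubling. The numbers \<open>x k\<close> satisfy
  \<open>x (Suc k) = (x k)\<^sup>2 - 2\<close>, so a reduced denominator \<open>q\<close> is squared
  at every step, whereas only finitely many values occur because the angles are multiples of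
  \<open>pi / n\<close> modulo \<open>2 * pi\<close>. Hence \<open>q = 1\<close>.\<close>

lemma niven:
  fixes m n :: nat
  assumes n: "n > 0" and rat: "2 * cos (real m * pi / real n) \<in> \<rat>"
  shows "2 * cos (real m * pi / real n) \<in> \<int>"
proof -
  define x where "x k = 2 * cos (real (2 ^ k * m) * pi / real n)" for k :: nat
  have step: "x (Suc k) = (x k)\<^sup>2 - 2" for k
  proof -
    define t where "t = real (2 ^ k * m) * pi / real n"
    have "real (2 ^ Suc k * m) * pi / real n = 2 * t" by (simp add: t_def)
    then have "x (Suc k) = 2 * cos (2 * t)" "x k = 2 * cos t" unfolding x_def t_def by (simp_all only:)
    then show ?thesis by (simp add: cos_double_cos power2_eq_square)
  qed
  have "x k \<in> (\<lambda>i. 2 * cos (real i * pi / real n)) ` {..<2 * n}" for k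
  proof
    let ?r = "(2 ^ k * m) mod (2 * n)" and ?q = "(2 ^ k * m) div (2 * n)"
    show "?r \<in> {..<2 * n}" using n by simp
    have "2 ^ k * m = 2 * n * ?q + ?r" by simp
    then have "real (2 ^ k * m) = real (2 * n * ?q + ?r)" by (simp only:)
    also have "\<dots> = 2 * real n * real ?q + real ?r" by (simp only: of_nat_add of_nat_mult of_nat_numeral)
    finally have "real (2 ^ k * m) = 2 * real n * real ?q + real ?r" .
    then have "real (2 ^ k * m) * pi / real n = real ?r * pi / real n + real ?q * (2 * pi)"
      using n by (simp add: field_simps)
    moreover have "cos (t + real j * (2 * pi)) = cos t" for t and j :: nat
    proof (induction j)
      case (Suc j)
      have "t + real (Suc j) * (2 * pi) = (t + real j * (2 * pi)) + 2 * pi" by (simp add: algebra_simps)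
      then show ?case using Suc by (metis cos_periodic)
    qed simp
    ultimately show "x k = 2 * cos (real ?r * pi / real n)" by (simp add: x_def)
  qed
  then have "finite (range x)"
    by (intro finite_subset[of "range x" "(\<lambda>i. 2 * cos (real i * pi / real n)) ` {..<2 * n}"]) auto
  then have "\<not> inj x" using finite_imageD infinite_UNIV_nat by blast
  then obtain i j where ij: "i < j" "x i = x j" by (metis injI linorder_neqE_nat)
  obtain p0 q :: nat where q: "q \<noteq> 0" "\<bar>x 0\<bar> = p0 / q" "coprime p0 q"
    by (rule Rats_abs_nat_div_natE[of "x 0"]) (use rat in \<open>simp add: x_def\<close>)
  \<comment> \<open>The fraction stays reduced: subtracting \<open>2\<close> changes the numerator
    only by a multiple of \<open>q\<close>.\<close>
  have "\<exists>p :: int. x k * real q ^ (2 ^ k) = of_int p \<and> coprime p (int q)" for k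
  proof (induction k)
    case 0
    have "x 0 * real q = real p0 \<or> x 0 * real q = - real p0"
      using q by (cases "x 0 \<ge> 0") (auto simp: field_simps)
    then consider "x 0 * real q = of_int (int p0)" | "x 0 * real q = of_int (- int p0)" by auto
    then show ?case
    proof cases
      case 1
      then show ?thesis using q(3) by (intro exI[of _ "int p0"]) simp
    next
      case 2
      then show ?thesis using q(3) by (intro exI[of _ "- int p0"]) simp
    qed
  next
    case (Suc k)
    then obtain p :: int where p: "x k * real q ^ (2 ^ k) = of_int p" "coprime p (int q)" by blast
    have e: "(2::nat) ^ Suc k = 2 ^ k * 2" by simp
    have "x (Suc k) * real q ^ (2 ^ Suc k) = (x k * real q ^ (2 ^ k))\<^sup>2 - 2 * real q ^ (2 ^ Suc k)"
      unfolding step e power_mult by (simp add: algebra_simps power_mult_distrib)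
    also have "\<dots> = of_int (p\<^sup>2 - 2 * int q ^ (2 ^ Suc k))" unfolding p by simp
    finally have 1: "x (Suc k) * real q ^ (2 ^ Suc k) = of_int (p\<^sup>2 - 2 * int q ^ (2 ^ Suc k))" .
    have "coprime (p\<^sup>2 - 2 * int q ^ (2 ^ Suc k)) (int q)"
    proof (rule coprimeI)
      fix c assume c: "c dvd p\<^sup>2 - 2 * int q ^ (2 ^ Suc k)" "c dvd int q"
      have "c dvd int q ^ (2 ^ Suc k)" using c(2) by (simp add: dvd_power_same dvd_trans dvd_power)
      then have "c dvd (p\<^sup>2 - 2 * int q ^ (2 ^ Suc k)) + 2 * int q ^ (2 ^ Suc k)"
        using c(1) by (intro dvd_add dvd_mult)
      then have "c dvd p\<^sup>2" by simp
      moreover have "coprime (p\<^sup>2) (int q)" using p(2) by simp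
      ultimately show "is_unit c" using c(2) by (meson coprime_common_divisor)
    qed
    with 1 show ?case by blast
  qed
  then obtain p :: "nat \<Rightarrow> int" where p: "\<And>k. x k * real q ^ (2 ^ k) = of_int (p k)" "\<And>k. coprime (p k) (int q)"
    by metis
  have lt: "(2::nat) ^ i < 2 ^ j" using ij by simp
  \<comment> \<open>A repeated value written over two different powers of \<open>q\<close> makes
    \<open>q\<close> divide a numerator coprime to it.\<close>
  have "real_of_int (p j) = x i * real q ^ (2 ^ i) * real q ^ (2 ^ j - 2 ^ i)"
    using p(1)[of j] ij lt by (simp add: mult.assoc flip: power_add)
  also have "\<dots> = real_of_int (p i * int q ^ (2 ^ j - 2 ^ i))" unfolding p(1) by simp
  finally have "p j = p i * int q ^ (2 ^ j - 2 ^ i)" by (simp only: of_int_eq_iff)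
  moreover have "int q dvd int q ^ (2 ^ j - 2 ^ i)" using lt by (simp add: dvd_power)
  ultimately have "int q dvd p j" by simp
  then have "is_unit (int q)" using p(2)[of j] by (meson coprime_common_divisor dvd_refl)
  then have "q = 1" by simp
  then have "x 0 = of_int (p 0)" using p(1)[of 0] by simp
  then show ?thesis by (simp add: x_def)
qed

text \<open>The two relations give \<open>\<xi> = j * pi / (2 * (j + 1))\<close>, so Niven's theorem
  applies, and 1 is the only integer strictly between 0 and 2.\<close>

lemma rational_cos_eq_pi_third:
  fixes j :: nat
  assumes "0 < \<xi>" "\<xi> < pi / 2" "\<xi> = real j * \<eta>" "\<xi> + \<eta> = pi / 2" "cos \<xi> \<in> \<rat>"
  shows "\<xi> = pi / 3"
proof -
  have "(real j + 1) * \<eta> = pi / 2" using assms(3,4) by (simp add: algebra_simps)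
  then have "\<eta> = pi / (2 * (real j + 1))" by (simp add: field_simps)
  then have \<xi>: "\<xi> = real j * pi / real (2 * (j + 1))" using assms(3) by simp
  have "2 * cos \<xi> \<in> \<rat>" using assms(5) by simp
  then have "2 * cos \<xi> \<in> \<int>" unfolding \<xi> by (intro niven) auto
  then obtain z where z: "2 * cos \<xi> = of_int z" by (auto elim: Ints_cases)
  have "cos \<xi> > 0" using assms(1,2) by (intro cos_gt_zero_pi) auto
  moreover have "cos \<xi> < 1" using assms(1,2) cos_monotone_0_pi[of 0 \<xi>] by simp
  ultimately have "z = 1" using z by linarith
  then have "cos \<xi> = cos (pi / 3)" using z by (simp add: cos_60)
  moreover have "0 \<le> \<xi>" "\<xi> \<le> pi" using assms(1,2) by auto
  ultimately show ?thesis using cos_inj_pi[of \<xi> "pi / 3"] by simp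
qed

section \<open>Tile edges along a side\<close>

text \<open>The open intervals are disjoint inside \<open>[0, L]\<close>, and adding finitely many
  points makes them cover it, so their measures add up to \<open>L\<close>. This serves for tile
  edges along a side and, with directions in place of points, for tile angles at a corner;
  \<open>F\<close> absorbs isolated contacts.\<close>

lemma interval_lengths_sum:
  fixes l u :: "'i \<Rightarrow> real"
  assumes J: "finite J" "finite F" and L: "0 \<le> L"
    and le: "\<And>j. j \<in> J \<Longrightarrow> 0 \<le> l j \<and> l j \<le> u j \<and> u j \<le> L"
    and disj: "\<And>i j. i \<in> J \<Longrightarrow> j \<in> J \<Longrightarrow> i \<noteq> j \<Longrightarrow> {l i<..<u i} \<inter> {l j<..<u j} = {}"
    and cover: "{0..L} \<subseteq> F \<union> (\<Union>j\<in>J. {l j..u j})"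
  shows "L = (\<Sum>j\<in>J. u j - l j)"
proof -
  define Q where "Q = (\<Union>j\<in>J. {l j<..<u j})"
  \<comment> \<open>The endpoints are included in this null set; they are the difference between the
    disjoint open and the covering closed intervals.\<close>
  define G where "G = F \<union> l ` J \<union> u ` J"
  have "disjoint_family_on (\<lambda>j. {l j<..<u j}) J"
    using disj by (auto simp: disjoint_family_on_def)
  then have "measure lborel Q = (\<Sum>j\<in>J. measure lborel {l j<..<u j})"
    unfolding Q_def using J(1) le by (intro measure_finite_Union) auto
  then have mO: "measure lborel Q = (\<Sum>j\<in>J. u j - l j)" using le by simp
  have OL: "Q \<subseteq> {0..L}" unfolding Q_def using le by fastforce
  have fO: "Q \<in> fmeasurable lborel"
  proof (rule fmeasurableI2[OF _ OL])
    show "{0..L} \<in> fmeasurable lborel" using L by (simp add: fmeasurable_def)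
    have "open Q" unfolding Q_def by (intro open_UN ballI open_greaterThanLessThan)
    then show "Q \<in> sets lborel" by simp
  qed
  have finG: "finite G" using J by (simp add: G_def)
  have fG: "G \<in> fmeasurable lborel" "measure lborel G = 0"
    using finG borel_closed[OF finite_imp_closed[OF finG]]
    by (auto simp: fmeasurable_def measure_def emeasure_lborel_countable countable_finite)
  have "measure lborel Q \<le> measure lborel {0..L}"
    by (rule measure_mono_fmeasurable) (use OL fO L in \<open>auto simp: fmeasurable_def\<close>)
  moreover have "measure lborel {0..L} \<le> measure lborel (Q \<union> G)"
  proof (rule measure_mono_fmeasurable)
    show "{0..L} \<subseteq> Q \<union> G"
    proof
      fix t assume "t \<in> {0..L}"
      then consider "t \<in> F" | j where "j \<in> J" "l j \<le> t" "t \<le> u j" using cover by fastforce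
      then show "t \<in> Q \<union> G" unfolding Q_def G_def by cases (auto simp: order.strict_iff_order)
    qed
  qed (use fO fG in auto)
  moreover have "measure lborel (Q \<union> G) \<le> measure lborel Q + measure lborel G"
    by (rule measure_Un_le) (use fO fG in auto)
  ultimately show ?thesis using mO fG(2) L by simp
qed

text \<open>For points close to the base line or to a corner: along a ray, the inequalities for
  lying in a triangle are affine.\<close>

lemma eventually_at_right_affine_pos:
  fixes c d :: real
  assumes "c > 0"
  shows "\<forall>\<^sub>F x in at_right 0. c + d * x > 0"
proof -
  have "((\<lambda>x. c + d * x) \<longlongrightarrow> c + d * 0) (at_right 0)" by (intro tendsto_intros)
  then show ?thesis using assms by (auto dest: order_tendstoD(1))
qed

section \<open>Triangles in terms of signed areas\<close>

lemma cross2_scaleR: "cross2 (a *\<^sub>R p) q = a * cross2 p q" "cross2 p (a *\<^sub>R q) = a * cross2 p q"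
  by (simp_all add: cross2_def algebra_simps)

lemma cramer2:
  assumes "cross2 p q \<noteq> 0"
  shows "x = (cross2 x q / cross2 p q) *\<^sub>R p + (cross2 p x / cross2 p q) *\<^sub>R q"
proof -
  have "cross2 p q *\<^sub>R x = cross2 x q *\<^sub>R p + cross2 p x *\<^sub>R q"
    by (simp add: point_eq_iff cross2_def algebra_simps)
  then have "(1 / cross2 p q) *\<^sub>R cross2 p q *\<^sub>R x = (1 / cross2 p q) *\<^sub>R (cross2 x q *\<^sub>R p + cross2 p x *\<^sub>R q)"
    by simp
  then show ?thesis using assms by (simp add: scaleR_add_right)
qed

text \<open>The quotients are the barycentric coordinates of \<open>x\<close> at \<open>Q\<close>
  and \<open>R\<close> as ratios of signed areas; dividing by \<open>D\<close> makes the criterion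
  independent of orientation.\<close>

lemma mem_closed_triangle_cross2:
  assumes "nondegenerate_triangle P Q R"
  defines "D \<equiv> cross2 (Q - P) (R - P)"
  shows "x \<in> closed_triangle P Q R \<longleftrightarrow> 0 \<le> cross2 (x - P) (R - P) / D \<and> 0 \<le> cross2 (Q - P) (x - P) / D
      \<and> cross2 (x - P) (R - P) / D + cross2 (Q - P) (x - P) / D \<le> 1" (is ?c)
    and "x \<in> interior (closed_triangle P Q R) \<longleftrightarrow> 0 < cross2 (x - P) (R - P) / D \<and> 0 < cross2 (Q - P) (x - P) / D
      \<and> cross2 (x - P) (R - P) / D + cross2 (Q - P) (x - P) / D < 1" (is ?i)
proof -
  have D: "D \<noteq> 0" using assms by (simp add: nondegenerate_iff_cross2)
  have x: "x = P + (cross2 (x - P) (R - P) / D) *\<^sub>R (Q - P) + (cross2 (Q - P) (x - P) / D) *\<^sub>R (R - P)" for x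
    using cramer2[OF D[unfolded D_def], of "x - P"] by (simp add: D_def algebra_simps)
  have uv: "u = cross2 (x - P) (R - P) / D \<and> v = cross2 (Q - P) (x - P) / D"
    if "x = P + u *\<^sub>R (Q - P) + v *\<^sub>R (R - P)" for x u v
    using affine_coordinates_unique[OF assms(1), of u v] x[of x] that by metis
  show ?c unfolding closed_triangle_alt using x[of x] uv by (smt (verit) mem_Collect_eq)
  show ?i unfolding interior_triangle_alt[OF assms(1)] using x[of x] uv by (smt (verit) mem_Collect_eq)
qed

text \<open>A tiling with named vertices for each tile. A set of tiles forgets which tile vertex is
  the image of which vertex of the prototile, and edge counts and angle sums depend on that.\<close>

definition dissection :: "'i set \<Rightarrow> ('i \<Rightarrow> point) \<Rightarrow> ('i \<Rightarrow> point) \<Rightarrow> ('i \<Rightarrow> point) \<Rightarrow> point set \<Rightarrow> bool" where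
  "dissection I U V W S \<longleftrightarrow> finite I \<and> (\<forall>i\<in>I. nondegenerate_triangle (U i) (V i) (W i)) \<and>
     (\<forall>i\<in>I. \<forall>j\<in>I. i \<noteq> j \<longrightarrow> interior (closed_triangle (U i) (V i) (W i)) \<inter> interior (closed_triangle (U j) (V j) (W j)) = {}) \<and>
     (\<Union>i\<in>I. closed_triangle (U i) (V i) (W i)) = S"

lemma vertices_mem_closed_triangle:
  "p \<in> closed_triangle p q r" "q \<in> closed_triangle p q r" "r \<in> closed_triangle p q r"
  by (simp_all add: closed_triangle_def hull_inc)

lemma dissection_tile_subset:
  assumes "dissection I U V W S" "i \<in> I"
  shows "closed_triangle (U i) (V i) (W i) \<subseteq> S"
  using assms unfolding dissection_def by blast

lemma dissection_vertex_mem: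
  assumes "dissection I U V W S" "i \<in> I"
  shows "U i \<in> S" "V i \<in> S" "W i \<in> S"
  by (rule subsetD[OF dissection_tile_subset[OF assms] vertices_mem_closed_triangle(1)],
      rule subsetD[OF dissection_tile_subset[OF assms] vertices_mem_closed_triangle(2)],
      rule subsetD[OF dissection_tile_subset[OF assms] vertices_mem_closed_triangle(3)])

lemma dissection_image:
  assumes "dissection I U V W S" "similarity r f"
  shows "dissection I (\<lambda>i. f (U i)) (\<lambda>i. f (V i)) (\<lambda>i. f (W i)) (f ` S)"
proof -
  have inj: "inj f" using similarity_bij[OF assms(2)] by (simp add: bij_def)
  show ?thesis
    using assms(1)
    unfolding dissection_def similarity_nondegenerate[OF assms(2)] similarity_triangle[OF assms(2), symmetric]
      similarity_interior[OF assms(2)] image_Int[OF inj, symmetric]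
    by auto
qed

text \<open>Coordinates along \<open>AB\<close> and across it, where the orientation sign
  \<open>\<sigma>\<close> reflects the plane if \<open>C\<close> would come to lie below the axis.
  All boundary arguments can then use a horizontal base starting at the origin.\<close>

lemma normal_position:
  assumes "nondegenerate_triangle A B C"
  obtains f where "similarity 1 f" "f A = 0" "f B $ 1 = dist A B" "f B $ 2 = 0" "f C $ 2 > 0"
proof -
  have AB: "A \<noteq> B" using assms by (auto simp: nondegenerate_triangle_def)
  define L where "L = dist A B"
  have L: "L > 0" using AB by (simp add: L_def)
  define e where "e = (1 / L) *\<^sub>R (B - A)"
  define \<sigma> where "\<sigma> = sgn (cross2 e (C - A))"
  have "cross2 e (C - A) = (1 / L) * cross2 (B - A) (C - A)"
    unfolding e_def by (rule cross2_scaleR)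
  then have cr: "cross2 e (C - A) \<noteq> 0" using assms L by (simp add: nondegenerate_iff_cross2)
  then have \<sigma>: "\<sigma>\<^sup>2 = 1" "\<sigma> * cross2 e (C - A) > 0"
    by (auto simp: \<sigma>_def sgn_if)
  have ne: "norm e = 1" using L by (simp add: e_def L_def dist_norm norm_minus_commute)
  then have e: "(e $ 1)\<^sup>2 + (e $ 2)\<^sup>2 = 1"
    using power2_norm_eq_inner[of e] by (simp add: inner_point power2_eq_square)
  define f :: "point \<Rightarrow> point" where "f x = vector [(x - A) \<bullet> e, \<sigma> * cross2 e (x - A)]" for x
  have f: "f x $ 1 = (x - A) \<bullet> e" "f x $ 2 = \<sigma> * cross2 e (x - A)" for x
    by (simp_all add: f_def)
  have "dist (f x) (f y) = dist x y" for x y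
  proof -
    define d where "d = x - y"
    have d1: "(f x - f y) $ 1 = d \<bullet> e" by (simp add: f d_def inner_diff_left)
    have d2: "(f x - f y) $ 2 = \<sigma> * cross2 e d" by (simp add: f d_def cross2_def algebra_simps)
    have "(f x - f y) \<bullet> (f x - f y) = (d \<bullet> e)\<^sup>2 + \<sigma>\<^sup>2 * (cross2 e d)\<^sup>2"
      unfolding inner_point[of "f x - f y"] d1 d2 by (simp add: power2_eq_square)
    also have "\<dots> = ((e $ 1)\<^sup>2 + (e $ 2)\<^sup>2) * (d \<bullet> d)"
      unfolding \<sigma>(1) inner_point cross2_def by (simp add: power2_eq_square algebra_simps)
    finally have "(norm (f x - f y))\<^sup>2 = (norm d)\<^sup>2" unfolding e power2_norm_eq_inner by simp
    then show ?thesis by (simp add: dist_norm d_def)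
  qed
  then have sim: "similarity 1 f" by (simp add: similarity_def)
  have BA: "B - A = L *\<^sub>R e" using L by (simp add: e_def)
  have "f B $ 1 = L" using ne by (simp add: f BA norm_eq_1)
  moreover have "f B $ 2 = 0" by (simp add: f BA cross2_def)
  moreover have "f A = 0" by (simp add: point_eq_iff f cross2_def)
  ultimately show ?thesis using that[OF sim] \<sigma>(2) by (simp add: f L_def)
qed

section \<open>Tile edges on a horizontal base line\<close>

definition base_overlap :: "point \<Rightarrow> point \<Rightarrow> real" where
  "base_overlap p q = (if p $ 2 = 0 \<and> q $ 2 = 0 then \<bar>p $ 1 - q $ 1\<bar> else 0)"

text \<open>The last claim is the one that excludes overlaps: over an inner point of its edge a tile
  has all sufficiently low points in its interior, so two tiles cannot share such a point.\<close>

lemma triangle_base_interval2: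
  assumes nd: "nondegenerate_triangle p q r" and pq: "p $ 2 = 0" "q $ 2 = 0" "r $ 2 \<ge> 0" and lt: "p $ 1 < q $ 1"
  shows "r $ 2 > 0"
    and "vector [t, 0] \<in> closed_triangle p q r \<longleftrightarrow> p $ 1 \<le> t \<and> t \<le> q $ 1"
    and "p $ 1 < t \<Longrightarrow> t < q $ 1 \<Longrightarrow> \<forall>\<^sub>F x in at_right 0. vector [t, x] \<in> interior (closed_triangle p q r)"
proof -
  define D where "D = cross2 (q - p) (r - p)"
  have D: "D = (q $ 1 - p $ 1) * r $ 2" using pq by (simp add: D_def cross2_def)
  have "D \<noteq> 0" using nd by (simp add: D_def nondegenerate_iff_cross2)
  then show r: "r $ 2 > 0" using pq D by (cases "r $ 2 = 0") auto
  have D0: "D > 0" unfolding D using r lt by simp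
  have c: "cross2 (vector [t, x] - p) (r - p) = (t - p $ 1) * r $ 2 - x * (r $ 1 - p $ 1)"
    "cross2 (q - p) (vector [t, x] - p) = (q $ 1 - p $ 1) * x" for x
    using pq by (simp_all add: cross2_def)
  show "vector [t, 0] \<in> closed_triangle p q r \<longleftrightarrow> p $ 1 \<le> t \<and> t \<le> q $ 1"
    unfolding mem_closed_triangle_cross2(1)[OF nd] c D_def[symmetric] using r lt
    by (simp add: D field_simps)
  assume t: "p $ 1 < t" "t < q $ 1"
  have c1: "\<forall>\<^sub>F x in at_right 0. (t - p $ 1) * r $ 2 + (p $ 1 - r $ 1) * x > 0"
    by (rule eventually_at_right_affine_pos) (use t r in simp)
  have c2: "\<forall>\<^sub>F x in at_right 0. (q $ 1 - t) * r $ 2 + (r $ 1 - q $ 1) * x > 0"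
    by (rule eventually_at_right_affine_pos) (use t r in simp)
  have c3: "\<forall>\<^sub>F x in at_right 0. x > (0::real)" by (simp add: eventually_at_right_less)
  show "\<forall>\<^sub>F x in at_right 0. vector [t, x] \<in> interior (closed_triangle p q r)"
    using c1 c2 c3
  proof eventually_elim
    case (elim x)
    have "cross2 (vector [t, x] - p) (r - p) > 0" "cross2 (q - p) (vector [t, x] - p) > 0"
      "cross2 (vector [t, x] - p) (r - p) + cross2 (q - p) (vector [t, x] - p) < D"
      unfolding c D using elim lt by (simp_all add: algebra_simps)
    then show ?case
      unfolding mem_closed_triangle_cross2(2)[OF nd] D_def[symmetric] using D0
      by (simp add: add_divide_distrib[symmetric])
  qed
qed

text \<open>A tile without an edge on the base line gets the interval \<open>[0, 0]\<close>, and its contacts with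
  the line are collected in \<open>F\<close>.\<close>

definition base_interval :: "point set \<Rightarrow> real \<Rightarrow> real \<Rightarrow> real set \<Rightarrow> bool" where
  "base_interval X l u F \<longleftrightarrow> l \<le> u \<and> finite F \<and>
     (l = 0 \<and> u = 0 \<or> (\<forall>t. l \<le> t \<and> t \<le> u \<longrightarrow> vector [t, 0] \<in> X)) \<and>
     (\<forall>t. l < t \<and> t < u \<longrightarrow> (\<forall>\<^sub>F x in at_right 0. vector [t, x] \<in> interior X)) \<and>
     (\<forall>t. vector [t, 0] \<in> X \<longrightarrow> t \<in> {l..u} \<union> F)"

lemma triangle_base_interval_two:
  assumes nd: "nondegenerate_triangle p q r" and "p $ 2 = 0" "q $ 2 = 0" "r $ 2 \<ge> 0"
  shows "\<exists>l u F. base_interval (closed_triangle p q r) l u F \<and>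
      u - l = base_overlap p q + base_overlap q r + base_overlap r p"
proof -
  have "p $ 1 \<noteq> q $ 1"
    using nd assms(2,3) by (auto simp: nondegenerate_iff_cross2 cross2_def)
  then consider "p $ 1 < q $ 1" | "q $ 1 < p $ 1" by linarith
  then show ?thesis
  proof cases
    case 1
    note * = triangle_base_interval2[OF nd assms(2-4) 1]
    have "base_interval (closed_triangle p q r) (p $ 1) (q $ 1) {}"
      unfolding base_interval_def using 1 *(2,3) by auto
    moreover have "q $ 1 - p $ 1 = base_overlap p q + base_overlap q r + base_overlap r p"
      using *(1) 1 assms by (simp add: base_overlap_def)
    ultimately show ?thesis by blast
  next
    case 2
    have nd': "nondegenerate_triangle q p r" using nd by (simp add: nondegenerate_triangle_perm)
    note * = triangle_base_interval2[OF nd' assms(3,2,4) 2]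
    have "base_interval (closed_triangle q p r) (q $ 1) (p $ 1) {}"
      unfolding base_interval_def using 2 *(2,3) by auto
    moreover have "p $ 1 - q $ 1 = base_overlap p q + base_overlap q r + base_overlap r p"
      using *(1) 2 assms by (simp add: base_overlap_def)
    ultimately show ?thesis by (metis closed_triangle_perm(1))
  qed
qed

text \<open>At most two vertices lie on the axis. If two do, the tile contributes their edge;
  otherwise it touches the axis in at most one vertex and contributes length 0.\<close>

lemma triangle_base_interval:
  assumes nd: "nondegenerate_triangle p q r" and h: "p $ 2 \<ge> 0" "q $ 2 \<ge> 0" "r $ 2 \<ge> 0"
  shows "\<exists>l u F. base_interval (closed_triangle p q r) l u F \<and>
      u - l = base_overlap p q + base_overlap q r + base_overlap r p"
proof -
  have perm: "closed_triangle q r p = closed_triangle p q r" "closed_triangle r p q = closed_triangle p q r"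
    "nondegenerate_triangle q r p" "nondegenerate_triangle r p q"
    using nd by (simp_all add: closed_triangle_def nondegenerate_triangle_def insert_commute)
  consider "p $ 2 = 0" "q $ 2 = 0" | "q $ 2 = 0" "r $ 2 = 0" | "r $ 2 = 0" "p $ 2 = 0"
    | "p $ 2 > 0 \<and> q $ 2 > 0 \<or> q $ 2 > 0 \<and> r $ 2 > 0 \<or> r $ 2 > 0 \<and> p $ 2 > 0" using h by linarith
  then show ?thesis
  proof cases
    case 1
    then show ?thesis using triangle_base_interval_two[OF nd _ _ h(3)] by blast
  next
    case 2
    then show ?thesis using triangle_base_interval_two[OF perm(3) _ _ h(1)] perm(1) by (simp add: ac_simps)
  next
    case 3
    then show ?thesis using triangle_base_interval_two[OF perm(4) _ _ h(2)] perm(2) by (simp add: ac_simps)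
  next
    case 4
    \<comment> \<open>At least two vertices have positive height, so a point of height
      \<open>0\<close> has all its weight on the remaining one.\<close>
    have "t \<in> {p $ 1, q $ 1, r $ 1}" if t: "vector [t, 0] \<in> closed_triangle p q r" for t
    proof -
      obtain x y z where xyz: "vector [t, 0] = x *\<^sub>R p + y *\<^sub>R q + z *\<^sub>R r" "0 \<le> x" "0 \<le> y" "0 \<le> z" "x + y + z = 1"
        using t unfolding closed_triangle_def convex_hull_3 by blast
      have e: "t = x * p $ 1 + y * q $ 1 + z * r $ 1" "0 = x * p $ 2 + y * q $ 2 + z * r $ 2"
        using arg_cong[OF xyz(1), of "\<lambda>v. v $ 1"] arg_cong[OF xyz(1), of "\<lambda>v. v $ 2"] by simp_all
      have "x * p $ 2 \<ge> 0" "y * q $ 2 \<ge> 0" "z * r $ 2 \<ge> 0" using xyz h by simp_all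
      then have "x * p $ 2 = 0" "y * q $ 2 = 0" "z * r $ 2 = 0" using e(2) by linarith+
      then have "x = 0 \<and> y = 0 \<or> y = 0 \<and> z = 0 \<or> z = 0 \<and> x = 0" using 4 by auto
      then show ?thesis using e(1) xyz(5) by auto
    qed
    then have "base_interval (closed_triangle p q r) 0 0 {p $ 1, q $ 1, r $ 1}"
      unfolding base_interval_def by auto
    moreover have "0 - 0 = base_overlap p q + base_overlap q r + base_overlap r p"
      using 4 by (auto simp: base_overlap_def)
    ultimately show ?thesis by blast
  qed
qed

lemma normal_triangle_mem:
  fixes B C x :: point
  assumes "B $ 2 = 0" "B $ 1 > 0" "C $ 2 > 0" "x \<in> closed_triangle 0 B C"
  shows "x $ 2 \<ge> 0" "x $ 2 = 0 \<Longrightarrow> 0 \<le> x $ 1 \<and> x $ 1 \<le> B $ 1"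
proof -
  obtain u v where uv: "x = u *\<^sub>R B + v *\<^sub>R C" "0 \<le> u" "0 \<le> v" "u + v \<le> 1"
    using assms(4) unfolding closed_triangle_alt by auto
  have x: "x $ 1 = u * B $ 1 + v * C $ 1" "x $ 2 = v * C $ 2" using uv(1) assms(1) by simp_all
  show "x $ 2 \<ge> 0" using x uv assms by simp
  assume "x $ 2 = 0"
  then have "v = 0" using x(2) assms(3) by simp
  then show "0 \<le> x $ 1 \<and> x $ 1 \<le> B $ 1" using x(1) uv assms(2) by (simp add: mult_left_le_one_le)
qed

lemma normal_triangle_segment:
  fixes B x :: point
  assumes "B $ 2 = 0" "B $ 1 > 0"
  shows "x \<in> closed_segment 0 B \<longleftrightarrow> x $ 2 = 0 \<and> 0 \<le> x $ 1 \<and> x $ 1 \<le> B $ 1"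
proof
  assume "x \<in> closed_segment 0 B"
  then obtain u where "x = u *\<^sub>R B" "0 \<le> u" "u \<le> 1" by (auto simp: closed_segment_def)
  then show "x $ 2 = 0 \<and> 0 \<le> x $ 1 \<and> x $ 1 \<le> B $ 1" using assms by (simp add: mult_left_le_one_le)
next
  assume x: "x $ 2 = 0 \<and> 0 \<le> x $ 1 \<and> x $ 1 \<le> B $ 1"
  then have "x = (x $ 1 / B $ 1) *\<^sub>R B" using assms by (simp add: point_eq_iff)
  moreover have "0 \<le> x $ 1 / B $ 1" "x $ 1 / B $ 1 \<le> 1" using x assms by simp_all
  ultimately show "x \<in> closed_segment 0 B" unfolding closed_segment_def by fastforce
qed

lemma base_length_sum:
  assumes diss: "dissection I U V W (closed_triangle 0 B C)" and B: "B $ 2 = 0" "B $ 1 > 0" "C $ 2 > 0"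
  shows "B $ 1 = (\<Sum>i\<in>I. base_overlap (U i) (V i) + base_overlap (V i) (W i) + base_overlap (W i) (U i))"
proof -
  define X where "X i = closed_triangle (U i) (V i) (W i)" for i
  have I: "finite I" "\<And>i. i \<in> I \<Longrightarrow> nondegenerate_triangle (U i) (V i) (W i)"
    "\<And>i j. i \<in> I \<Longrightarrow> j \<in> I \<Longrightarrow> i \<noteq> j \<Longrightarrow> interior (X i) \<inter> interior (X j) = {}"
    "(\<Union>i\<in>I. X i) = closed_triangle 0 B C"
    using diss by (auto simp: dissection_def X_def)
  have h: "U i $ 2 \<ge> 0" "V i $ 2 \<ge> 0" "W i $ 2 \<ge> 0" if "i \<in> I" for i
    using dissection_vertex_mem[OF diss that] normal_triangle_mem(1)[OF B] by blast+
  have "\<forall>i\<in>I. \<exists>l u F. base_interval (X i) l u F \<and>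
      u - l = base_overlap (U i) (V i) + base_overlap (V i) (W i) + base_overlap (W i) (U i)"
    unfolding X_def using triangle_base_interval I(2) h by blast
  then obtain l u F where luF: "\<And>i. i \<in> I \<Longrightarrow> base_interval (X i) (l i) (u i) (F i)"
    "\<And>i. i \<in> I \<Longrightarrow> u i - l i = base_overlap (U i) (V i) + base_overlap (V i) (W i) + base_overlap (W i) (U i)"
    by metis
  have "B $ 1 = (\<Sum>i\<in>I. u i - l i)"
  proof (rule interval_lengths_sum[of I "\<Union>i\<in>I. F i"])
    show "finite I" by fact
    show "finite (\<Union>i\<in>I. F i)" using I(1) luF(1) by (auto simp: base_interval_def)
    show "0 \<le> B $ 1" using B by simp
    show "0 \<le> l i \<and> l i \<le> u i \<and> u i \<le> B $ 1" if i: "i \<in> I" for i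
    proof -
      have le: "l i \<le> u i" using luF(1)[OF i] by (simp add: base_interval_def)
      consider "l i = 0" "u i = 0" | "vector [l i, 0] \<in> X i" "vector [u i, 0] \<in> X i"
        using luF(1)[OF i] by (auto simp: base_interval_def)
      then show ?thesis
      proof cases
        case 2
        then have "vector [l i, 0] \<in> closed_triangle 0 B C" "vector [u i, 0] \<in> closed_triangle 0 B C"
          using I(4) i by blast+
        then show ?thesis using le by (auto dest: normal_triangle_mem(2)[OF B])
      qed (use B in auto)
    qed
    \<comment> \<open>A common inner point \<open>t\<close> would have points just above it in the
      interiors of both tiles.\<close>
    show "{l i<..<u i} \<inter> {l j<..<u j} = {}" if ij: "i \<in> I" "j \<in> I" "i \<noteq> j" for i j
    proof (rule ccontr)
      assume "\<not> ?thesis"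
      then obtain t where "t \<in> {l i<..<u i} \<inter> {l j<..<u j}" by blast
      then have t: "l i < t" "t < u i" "l j < t" "t < u j" by simp_all
      then have "\<forall>\<^sub>F x in at_right 0. vector [t, x] \<in> interior (X i)" "\<forall>\<^sub>F x in at_right 0. vector [t, x] \<in> interior (X j)"
        using luF(1) ij by (auto simp: base_interval_def)
      then have "\<forall>\<^sub>F x in at_right (0::real). False"
        by eventually_elim (use I(3)[OF ij] in blast)
      then show False by simp
    qed
    show "{0..B $ 1} \<subseteq> (\<Union>i\<in>I. F i) \<union> (\<Union>i\<in>I. {l i..u i})"
    proof
      fix t assume t: "t \<in> {0..B $ 1}"
      then have "vector [t, 0] \<in> closed_segment 0 B" using normal_triangle_segment[OF B(1,2)] by simp
      moreover have "closed_segment 0 B \<subseteq> closed_triangle 0 B C"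
        unfolding segment_convex_hull closed_triangle_def by (intro hull_mono) auto
      ultimately obtain i where "i \<in> I" "vector [t, 0] \<in> X i" using I(4) by blast
      then show "t \<in> (\<Union>i\<in>I. F i) \<union> (\<Union>i\<in>I. {l i..u i})" using luF(1) unfolding base_interval_def by blast
    qed
  qed
  then show ?thesis using luF(2) by simp
qed

definition edge_overlap :: "point \<Rightarrow> point \<Rightarrow> point \<Rightarrow> point \<Rightarrow> real" where
  "edge_overlap A B p q = (if p \<in> closed_segment A B \<and> q \<in> closed_segment A B then dist p q else 0)"

text \<open>In normal position a tile vertex lies on \<open>AB\<close> exactly when its height is
  \<open>0\<close>, since the triangle stands on this base. So the sum over the edges on the base
  line can be transported back.\<close>

lemma edge_length_sum:
  assumes diss: "dissection I U V W (closed_triangle A B C)" and nd: "nondegenerate_triangle A B C"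
  shows "dist A B = (\<Sum>i\<in>I. edge_overlap A B (U i) (V i) + edge_overlap A B (V i) (W i) + edge_overlap A B (W i) (U i))"
proof -
  obtain f where f: "similarity 1 f" "f A = 0" "f B $ 1 = dist A B" "f B $ 2 = 0" "f C $ 2 > 0"
    using normal_position[OF nd] by blast
  have AB: "dist A B > 0" using nd by (auto simp: nondegenerate_triangle_def)
  have d: "dissection I (\<lambda>i. f (U i)) (\<lambda>i. f (V i)) (\<lambda>i. f (W i)) (closed_triangle 0 (f B) (f C))"
    using dissection_image[OF diss f(1)] similarity_triangle[OF f(1), of A B C] f(2) by simp
  have inj: "inj f" using similarity_bij[OF f(1)] by (simp add: bij_def)
  have seg: "p \<in> closed_segment A B \<longleftrightarrow> f p $ 2 = 0" if "p \<in> closed_triangle A B C" for p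
  proof -
    have "f p \<in> closed_triangle 0 (f B) (f C)"
      using imageI[OF that, of f] similarity_triangle[OF f(1), of A B C] f(2) by simp
    then have "f p \<in> closed_segment 0 (f B) \<longleftrightarrow> f p $ 2 = 0"
      using normal_triangle_mem(2) normal_triangle_segment f(3-5) AB by metis
    moreover have "f p \<in> closed_segment 0 (f B) \<longleftrightarrow> p \<in> closed_segment A B"
      using similarity_closed_segment[OF f(1), of A B] inj f(2) by (metis inj_image_mem_iff)
    ultimately show ?thesis by simp
  qed
  have eq: "base_overlap (f p) (f q) = edge_overlap A B p q" if "p \<in> closed_triangle A B C" "q \<in> closed_triangle A B C" for p q
  proof (cases "f p $ 2 = 0 \<and> f q $ 2 = 0")
    case True
    have "dist p q = dist (f p) (f q)" using similarity_dist[OF f(1)] by simp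
    also have "\<dots> = \<bar>f p $ 1 - f q $ 1\<bar>" using True by (simp add: dist_norm norm_eq_sqrt_inner inner_point)
    finally show ?thesis using True seg that by (simp add: base_overlap_def edge_overlap_def)
  next
    case False
    then show ?thesis using seg that by (auto simp: base_overlap_def edge_overlap_def)
  qed
  note mem = dissection_vertex_mem[OF diss]
  have "f B $ 1 = (\<Sum>i\<in>I. base_overlap (f (U i)) (f (V i)) + base_overlap (f (V i)) (f (W i)) + base_overlap (f (W i)) (f (U i)))"
    using base_length_sum[OF d f(4) _ f(5)] f(3) AB by simp
  then show ?thesis using f(3) eq mem by simp
qed

section \<open>Tile angles at a vertex\<close>

definition direction :: "real \<Rightarrow> point" where
  "direction t = vector [cos t, sin t]"

lemma direction_nth [simp]: "direction t $ 1 = cos t" "direction t $ 2 = sin t"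
  by (simp_all add: direction_def)

lemma cross2_direction: "cross2 (direction s) (direction t) = sin (t - s)"
  by (simp add: cross2_def sin_diff)

lemma sin_nonneg_imp_nonneg:
  assumes "sin x \<ge> 0" "- pi < x"
  shows "0 \<le> x"
proof (rule ccontr)
  assume "\<not> 0 \<le> x"
  then have "sin (- x) > 0" using assms(2) by (intro sin_gt_zero) auto
  then show False using assms(1) by simp
qed

text \<open>The arccosine recovers the direction of a vector only in the closed upper half-plane; in
  normal position all tile vertices lie there.\<close>

definition polar_angle :: "point \<Rightarrow> real" where
  "polar_angle p = arccos (p $ 1 / norm p)"

lemma polar_decomposition:
  assumes "p \<noteq> 0" "p $ 2 \<ge> 0"
  shows "p = norm p *\<^sub>R direction (polar_angle p)" "0 \<le> polar_angle p" "polar_angle p \<le> pi"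
proof -
  have n: "norm p > 0" using assms(1) by simp
  have "\<bar>p $ 1\<bar> \<le> norm p" by (rule component_le_norm_cart)
  then have b: "-1 \<le> p $ 1 / norm p" "p $ 1 / norm p \<le> 1" using n by (auto simp: field_simps)
  then show "0 \<le> polar_angle p" "polar_angle p \<le> pi"
    by (simp_all add: polar_angle_def arccos_lbound arccos_ubound)
  have c: "cos (polar_angle p) = p $ 1 / norm p" using b by (simp add: polar_angle_def)
  have n2: "(norm p)\<^sup>2 = (p $ 1)\<^sup>2 + (p $ 2)\<^sup>2"
    unfolding power2_norm_eq_inner inner_point by (simp add: power2_eq_square)
  have "(p $ 1 / norm p)\<^sup>2 + (p $ 2 / norm p)\<^sup>2 = 1"
    unfolding power_divide add_divide_distrib[symmetric] n2[symmetric] using n by simp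
  then have "(sin (polar_angle p))\<^sup>2 = (p $ 2 / norm p)\<^sup>2"
    unfolding sin_squared_eq c by simp
  moreover have "sin (polar_angle p) \<ge> 0"
    using \<open>0 \<le> polar_angle p\<close> \<open>polar_angle p \<le> pi\<close> by (rule sin_ge_zero)
  ultimately have "sin (polar_angle p) = p $ 2 / norm p"
    using assms(2) n power2_eq_imp_eq[of "sin (polar_angle p)" "p $ 2 / norm p"] by simp
  then show "p = norm p *\<^sub>R direction (polar_angle p)"
    unfolding point_eq_iff[of p] using c n by simp
qed

lemma cross2_polar:
  assumes "p \<noteq> 0" "p $ 2 \<ge> 0"
  shows "cross2 p (direction t) = norm p * sin (t - polar_angle p)"
    "cross2 (direction t) p = norm p * sin (polar_angle p - t)"
proof -
  have "cross2 (norm p *\<^sub>R direction (polar_angle p)) (direction t) = norm p * sin (t - polar_angle p)"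
    "cross2 (direction t) (norm p *\<^sub>R direction (polar_angle p)) = norm p * sin (polar_angle p - t)"
    by (simp_all add: cross2_scaleR cross2_direction)
  then show "cross2 p (direction t) = norm p * sin (t - polar_angle p)"
    "cross2 (direction t) p = norm p * sin (polar_angle p - t)"
    using polar_decomposition(1)[OF assms] by simp_all
qed

lemma angle_at_0_polar:
  assumes p: "p \<noteq> 0" "p $ 2 \<ge> 0" and q: "q \<noteq> 0" "q $ 2 \<ge> 0"
  shows "angle_at p 0 q = \<bar>polar_angle p - polar_angle q\<bar>"
proof -
  have n: "norm p > 0" "norm q > 0" using assms by auto
  have "(norm p *\<^sub>R direction (polar_angle p)) \<bullet> (norm q *\<^sub>R direction (polar_angle q))
      = norm p * norm q * cos (polar_angle p - polar_angle q)"
    by (simp add: inner_point cos_diff algebra_simps)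
  then have "p \<bullet> q = norm p * norm q * cos (polar_angle p - polar_angle q)"
    using polar_decomposition(1)[OF p] polar_decomposition(1)[OF q] by simp
  then have "angle_at p 0 q = arccos (cos (polar_angle p - polar_angle q))"
    using n by (simp add: angle_at_def)
  also have "\<dots> = \<bar>polar_angle p - polar_angle q\<bar>"
    using polar_decomposition(2,3)[OF p] polar_decomposition(2,3)[OF q] by (intro arccos_cos_eq_abs) auto
  finally show ?thesis .
qed

text \<open>\<open>cross2 p q\<close> is a positive multiple of the sine of the difference of the
  directions, and this difference lies strictly between \<open>- pi\<close> and \<open>pi\<close>,
  where the sine has the sign of its argument.\<close>

lemma polar_angle_lt:
  assumes p: "p \<noteq> 0" "p $ 2 \<ge> 0" and q: "q \<noteq> 0" "q $ 2 \<ge> 0"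
    and nd: "cross2 p q \<noteq> 0"
  shows "cross2 p q > 0 \<longleftrightarrow> polar_angle p < polar_angle q" "polar_angle p \<noteq> polar_angle q"
proof -
  have "cross2 p q = norm q * cross2 p (direction (polar_angle q))"
    using polar_decomposition(1)[OF q] cross2_scaleR(2) by metis
  then have c: "cross2 p q = norm p * norm q * sin (polar_angle q - polar_angle p)"
    using cross2_polar(1)[OF p] by simp
  have n: "norm p * norm q > 0" using assms by auto
  show "polar_angle p \<noteq> polar_angle q" using c nd by auto
  have b: "- pi \<le> polar_angle q - polar_angle p" "polar_angle q - polar_angle p \<le> pi"
    using polar_decomposition(2,3)[OF p] polar_decomposition(2,3)[OF q] by auto
  have ne: "sin (polar_angle q - polar_angle p) \<noteq> 0" using c nd by auto
  then have "polar_angle q - polar_angle p \<noteq> pi" "polar_angle q - polar_angle p \<noteq> - pi" by auto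
  then have b': "- pi < polar_angle q - polar_angle p" "polar_angle q - polar_angle p < pi" using b by auto
  have "sin (polar_angle q - polar_angle p) > 0 \<longleftrightarrow> polar_angle p < polar_angle q"
  proof
    assume "sin (polar_angle q - polar_angle p) > 0"
    then have "0 \<le> polar_angle q - polar_angle p" by (rule sin_nonneg_imp_nonneg[OF less_imp_le b'(1)])
    moreover have "polar_angle q - polar_angle p \<noteq> 0" using ne by auto
    ultimately show "polar_angle p < polar_angle q" by simp
  qed (use b'(2) in \<open>simp add: sin_gt_zero\<close>)
  then show "cross2 p q > 0 \<longleftrightarrow> polar_angle p < polar_angle q" unfolding c
    using n zero_less_mult_pos[OF _ n] mult_pos_pos[OF n] by blast
qed

text \<open>The closed cone of a tile at \<open>0\<close> corresponds to the interval \<open>[l, u]\<close> of directions.\<close>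

definition cone_interval :: "point set \<Rightarrow> real \<Rightarrow> real \<Rightarrow> real \<Rightarrow> bool" where
  "cone_interval X \<xi> l u \<longleftrightarrow> 0 \<le> l \<and> l \<le> u \<and> u \<le> \<xi> \<and>
     (\<forall>t. l < t \<and> t < u \<longrightarrow> (\<forall>\<^sub>F x in at_right 0. x *\<^sub>R direction t \<in> interior X)) \<and>
     (\<forall>t x. 0 \<le> t \<and> t \<le> \<xi> \<and> 0 < x \<and> x *\<^sub>R direction t \<in> X \<longrightarrow> l \<le> t \<and> t \<le> u)"

lemma triangle_cone_interval_aux:
  assumes nd: "nondegenerate_triangle 0 q r" and q: "q $ 2 \<ge> 0" "polar_angle q \<le> \<xi>"
    and r: "r $ 2 \<ge> 0" "polar_angle r \<le> \<xi>" and lt: "polar_angle q < polar_angle r" and \<xi>: "\<xi> < pi"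
  shows "cone_interval (closed_triangle 0 q r) \<xi> (polar_angle q) (polar_angle r)"
proof -
  define D where "D = cross2 q r"
  have Dn: "D \<noteq> 0" using nd by (simp add: D_def nondegenerate_iff_cross2)
  have ne: "q \<noteq> 0" "r \<noteq> 0" using Dn by (auto simp: D_def cross2_def)
  have D: "D > 0" using polar_angle_lt(1)[OF ne(1) q(1) ne(2) r(1)] Dn lt by (simp add: D_def)
  have n: "norm q > 0" "norm r > 0" using ne by auto
  note pq = polar_decomposition(2,3)[OF ne(1) q(1)] and pr = polar_decomposition(2,3)[OF ne(2) r(1)]
  have c: "cross2 (x *\<^sub>R direction t) r = x * (norm r * sin (polar_angle r - t))"
    "cross2 q (x *\<^sub>R direction t) = x * (norm q * sin (t - polar_angle q))" for x t
    using cross2_polar ne q r by (simp_all add: cross2_scaleR)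
  show ?thesis
    unfolding cone_interval_def
  proof (intro conjI allI impI)
    show "0 \<le> polar_angle q" "polar_angle r \<le> \<xi>" "polar_angle q \<le> polar_angle r"
      using pq r lt by auto
  next
    fix t assume t: "polar_angle q < t \<and> t < polar_angle r"
    have s: "sin (polar_angle r - t) > 0" "sin (t - polar_angle q) > 0"
      using t pq pr by (auto intro!: sin_gt_zero)
    have ev: "\<forall>\<^sub>F x in at_right 0. D + (- (norm r * sin (polar_angle r - t)) - norm q * sin (t - polar_angle q)) * x > 0"
      by (rule eventually_at_right_affine_pos) fact
    have ev0: "\<forall>\<^sub>F x in at_right 0. x > (0::real)" by (simp add: eventually_at_right_less)
    show "\<forall>\<^sub>F x in at_right 0. x *\<^sub>R direction t \<in> interior (closed_triangle 0 q r)"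
      using ev ev0
    proof eventually_elim
      case (elim x)
      have "cross2 (x *\<^sub>R direction t) r > 0" "cross2 q (x *\<^sub>R direction t) > 0"
        unfolding c using elim s n by simp_all
      moreover have "cross2 (x *\<^sub>R direction t) r + cross2 q (x *\<^sub>R direction t) < D"
        unfolding c using elim by (simp add: algebra_simps)
      ultimately show ?case
        unfolding mem_closed_triangle_cross2(2)[OF nd] using D
        by (simp add: D_def add_divide_distrib[symmetric])
    qed
  next
    fix t x assume tx: "0 \<le> t \<and> t \<le> \<xi> \<and> 0 < x \<and> x *\<^sub>R direction t \<in> closed_triangle 0 q r"
    then have "cross2 (x *\<^sub>R direction t) r \<ge> 0" "cross2 q (x *\<^sub>R direction t) \<ge> 0"
      using mem_closed_triangle_cross2(1)[OF nd, of "x *\<^sub>R direction t"] D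
      by (auto simp: D_def zero_le_divide_iff)
    then have "sin (polar_angle r - t) \<ge> 0" "sin (t - polar_angle q) \<ge> 0"
      unfolding c using tx n by (simp_all add: zero_le_mult_iff)
    \<comment> \<open>Here \<open>\<xi> < pi\<close> matters: a nonnegative sine shows an angle to
      be nonnegative only if the angle is above \<open>- pi\<close>.\<close>
    moreover have "- pi < polar_angle r - t" "- pi < t - polar_angle q" using tx \<xi> pq pr q r by auto
    ultimately show "polar_angle q \<le> t" "t \<le> polar_angle r" using sin_nonneg_imp_nonneg by force+
  qed
qed

lemma triangle_cone_interval:
  assumes nd: "nondegenerate_triangle 0 q r" and q: "q $ 2 \<ge> 0" "polar_angle q \<le> \<xi>"
    and r: "r $ 2 \<ge> 0" "polar_angle r \<le> \<xi>" and \<xi>: "\<xi> < pi"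
  shows "\<exists>l u. cone_interval (closed_triangle 0 q r) \<xi> l u \<and> u - l = angle_at q 0 r"
proof -
  have Dn: "cross2 q r \<noteq> 0" using nd by (simp add: nondegenerate_iff_cross2)
  have ne: "q \<noteq> 0" "r \<noteq> 0" using Dn by (auto simp: cross2_def)
  have ang: "angle_at q 0 r = \<bar>polar_angle q - polar_angle r\<bar>"
    by (rule angle_at_0_polar) (use ne q r in auto)
  have "polar_angle q \<noteq> polar_angle r"
    by (rule polar_angle_lt(2)) (use ne q r Dn in auto)
  then consider "polar_angle q < polar_angle r" | "polar_angle r < polar_angle q" by linarith
  then show ?thesis
  proof cases
    case 1
    then show ?thesis using triangle_cone_interval_aux[OF nd q r 1 \<xi>] ang by fastforce
  next
    case 2
    have nd': "nondegenerate_triangle 0 r q" using nd by (simp add: nondegenerate_triangle_perm)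
    have "cone_interval (closed_triangle 0 q r) \<xi> (polar_angle r) (polar_angle q)"
      using triangle_cone_interval_aux[OF nd' r q 2 \<xi>] by (simp add: closed_triangle_perm)
    then show ?thesis using 2 ang by fastforce
  qed
qed

definition vertex_angle :: "point \<Rightarrow> point \<Rightarrow> point \<Rightarrow> point \<Rightarrow> real" where
  "vertex_angle A p q r = (if p = A then angle_at q A r else 0)"

text \<open>\<open>cross2 x C\<close> is nonnegative on the triangle, which puts the direction of
  \<open>x\<close> before that of \<open>C\<close>.\<close>

lemma normal_triangle_polar_angle:
  assumes B: "B $ 2 = 0" "B $ 1 > 0" "C $ 2 > 0" and x: "x \<in> closed_triangle 0 B C" "x \<noteq> 0"
  shows "polar_angle x \<le> polar_angle C"
proof -
  have C0: "C \<noteq> 0" using B by auto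
  have nd: "nondegenerate_triangle 0 B C" using B by (simp add: nondegenerate_iff_cross2 cross2_def)
  have x2: "x $ 2 \<ge> 0" using normal_triangle_mem(1)[OF B x(1)] .
  have D: "cross2 B C > 0" using B by (simp add: cross2_def)
  have "cross2 x C \<ge> 0"
    using mem_closed_triangle_cross2(1)[OF nd, of x] x(1) D by (simp add: zero_le_divide_iff)
  then have "sin (polar_angle C - polar_angle x) \<ge> 0"
  proof -
    have "cross2 x C = norm C * cross2 x (direction (polar_angle C))"
      using polar_decomposition(1)[OF C0] B cross2_scaleR(2) by (metis less_imp_le)
    then have "0 \<le> norm C * (norm x * sin (polar_angle C - polar_angle x))"
      using \<open>cross2 x C \<ge> 0\<close> cross2_polar(1)[OF x(2) x2] by simp
    then show ?thesis using C0 x(2) by (simp add: zero_le_mult_iff)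
  qed
  moreover have "polar_angle C > 0"
  proof -
    have "polar_angle C \<noteq> 0"
    proof
      assume "polar_angle C = 0"
      then have "C $ 2 = norm C * sin 0" using polar_decomposition(1)[OF C0] B 
        by (metis direction_nth(2) less_imp_le vector_scaleR_component real_scaleR_def)
      then show False using B by simp
    qed
    then show ?thesis using polar_decomposition(2)[OF C0] B by simp
  qed
  ultimately show ?thesis
    using sin_nonneg_imp_nonneg[of "polar_angle C - polar_angle x"] polar_decomposition(3)[OF x(2) x2] by simp
qed

text \<open>Close to the corner only tiles containing \<open>0\<close> matter: the finitely many
  others are closed and miss a neighbourhood of it. And \<open>0\<close>, an extreme point of the
  large triangle, is a vertex of any tile containing it.\<close>

lemma normal_vertex_tile:
  assumes diss: "dissection I U V W (closed_triangle 0 B C)" and B: "B $ 2 = 0" "B $ 1 > 0" "C $ 2 > 0"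
    and t: "0 \<le> t" "t \<le> polar_angle C"
  obtains i x where "i \<in> I" "0 \<in> {U i, V i, W i}" "x > 0"
    "x *\<^sub>R direction t \<in> closed_triangle (U i) (V i) (W i)"
proof -
  define X where "X i = closed_triangle (U i) (V i) (W i)" for i
  have I: "finite I" "(\<Union>i\<in>I. X i) = closed_triangle 0 B C"
    using diss by (auto simp: dissection_def X_def)
  have nd: "nondegenerate_triangle 0 B C" using B by (simp add: nondegenerate_iff_cross2 cross2_def)
  have C0: "C \<noteq> 0" using B by auto
  have D: "cross2 B C > 0" using B by (simp add: cross2_def)
  note pc = polar_decomposition(2,3)[OF C0 less_imp_le[OF B(3)]]
  have c: "cross2 (x *\<^sub>R direction t) C = x * (norm C * sin (polar_angle C - t))"
    "cross2 B (x *\<^sub>R direction t) = x * (B $ 1 * sin t)" for x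
    using cross2_polar(2)[OF C0 less_imp_le[OF B(3)]] B(1) by (simp_all add: cross2_scaleR) (simp add: cross2_def)
  have s: "sin (polar_angle C - t) \<ge> 0" "sin t \<ge> 0" using t pc by (auto intro!: sin_ge_zero)
  have ev0: "\<forall>\<^sub>F x in at_right 0. x > (0::real)" by (simp add: eventually_at_right_less)
  have evD: "\<forall>\<^sub>F x in at_right 0. cross2 B C + (- (norm C * sin (polar_angle C - t)) - B $ 1 * sin t) * x > 0"
    by (rule eventually_at_right_affine_pos) fact
  have evS: "\<forall>\<^sub>F x in at_right 0. x *\<^sub>R direction t \<in> closed_triangle 0 B C"
    using ev0 evD
  proof eventually_elim
    case (elim x)
    have "cross2 (x *\<^sub>R direction t) C \<ge> 0" "cross2 B (x *\<^sub>R direction t) \<ge> 0"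
      unfolding c using elim s B by simp_all
    moreover have "cross2 (x *\<^sub>R direction t) C + cross2 B (x *\<^sub>R direction t) \<le> cross2 B C"
      unfolding c using elim by (simp add: algebra_simps)
    ultimately show ?case
      unfolding mem_closed_triangle_cross2(1)[OF nd] using D
      by (simp add: add_divide_distrib[symmetric])
  qed
  have lim: "((\<lambda>x. x *\<^sub>R direction t) \<longlongrightarrow> 0) (at_right 0)"
    by (rule tendsto_eq_intros | simp)+
  have "\<forall>\<^sub>F x in at_right 0. \<forall>i\<in>{i\<in>I. 0 \<notin> X i}. x *\<^sub>R direction t \<notin> X i"
  proof (rule eventually_ball_finite)
    show "finite {i \<in> I. 0 \<notin> X i}" using I(1) by simp
    show "\<forall>i\<in>{i\<in>I. 0 \<notin> X i}. \<forall>\<^sub>F x in at_right 0. x *\<^sub>R direction t \<notin> X i"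
    proof
      fix i assume i: "i \<in> {i\<in>I. 0 \<notin> X i}"
      have "closed (X i)"
        unfolding X_def closed_triangle_def by (simp add: compact_imp_closed finite_imp_compact_convex_hull)
      then have "open (- X i)" "0 \<in> - X i" using i by auto
      then show "\<forall>\<^sub>F x in at_right 0. x *\<^sub>R direction t \<notin> X i"
        using topological_tendstoD[OF lim] by fastforce
    qed
  qed
  then have ev: "\<forall>\<^sub>F x in at_right 0. x > 0 \<and> x *\<^sub>R direction t \<in> closed_triangle 0 B C \<and>
      (\<forall>i\<in>{i\<in>I. 0 \<notin> X i}. x *\<^sub>R direction t \<notin> X i)"
    using ev0 evS by eventually_elim blast
  then obtain x where x: "x > 0" "x *\<^sub>R direction t \<in> closed_triangle 0 B C"
      "\<And>i. i \<in> I \<Longrightarrow> 0 \<notin> X i \<Longrightarrow> x *\<^sub>R direction t \<notin> X i"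
    using eventually_happens'[OF trivial_limit_at_right_real ev] by blast
  then obtain i where i: "i \<in> I" "x *\<^sub>R direction t \<in> X i" "0 \<in> X i" using I(2) by (metis UN_E)
  obtain a b c where abc: "0 = a *\<^sub>R U i + b *\<^sub>R V i + c *\<^sub>R W i" "0 \<le> a" "0 \<le> b" "0 \<le> c" "a + b + c = 1"
    using i(3) unfolding X_def closed_triangle_def convex_hull_3 by blast
  note mem = dissection_vertex_mem[OF diss i(1)]
  note h = mem[THEN normal_triangle_mem(1)[OF B]]
  have zero: "p = 0" if "p \<in> {U i, V i, W i}" "p $ 2 = 0" "p $ 1 = 0" for p
    using that by (simp add: point_eq_iff)
  \<comment> \<open>Extremality in coordinates: heights are nonnegative, so vertices of positive
    weight lie on the base; there the abscissas are nonnegative too, so these vertices are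
    \<open>0\<close>.\<close>
  have "0 = a * U i $ 2 + b * V i $ 2 + c * W i $ 2"
    using arg_cong[OF abc(1), of "\<lambda>v. v $ 2"] by simp
  moreover have "a * U i $ 2 \<ge> 0" "b * V i $ 2 \<ge> 0" "c * W i $ 2 \<ge> 0" using abc h by simp_all
  ultimately have z: "a = 0 \<or> U i $ 2 = 0" "b = 0 \<or> V i $ 2 = 0" "c = 0 \<or> W i $ 2 = 0"
    by (smt (verit) mult_eq_0_iff)+
  have "0 = a * U i $ 1 + b * V i $ 1 + c * W i $ 1"
    using arg_cong[OF abc(1), of "\<lambda>v. v $ 1"] by simp
  moreover have "a * U i $ 1 \<ge> 0" "b * V i $ 1 \<ge> 0" "c * W i $ 1 \<ge> 0"
    using z abc mem[THEN normal_triangle_mem(2)[OF B]] by auto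
  ultimately have z1: "a = 0 \<or> U i $ 1 = 0" "b = 0 \<or> V i $ 1 = 0" "c = 0 \<or> W i $ 1 = 0"
    by (smt (verit) mult_eq_0_iff)+
  have "a \<noteq> 0 \<or> b \<noteq> 0 \<or> c \<noteq> 0" using abc(5) by auto
  then have "0 \<in> {U i, V i, W i}" using z z1 by (auto simp: point_eq_iff)
  then show ?thesis using that i x(1) by (simp add: X_def)
qed

text \<open>The direction along the base leads to a tile at the corner that contains a base point
  beyond \<open>0\<close>. Some vertex of positive weight in that point lies on the base away from
  \<open>0\<close>.\<close>

lemma normal_vertex_edge:
  assumes diss: "dissection I U V W (closed_triangle 0 B C)" and B: "B $ 2 = 0" "B $ 1 > 0" "C $ 2 > 0"
  shows "\<exists>i\<in>I. \<exists>p. 0 \<in> {U i, V i, W i} \<and> p \<in> {U i, V i, W i} \<and> p \<noteq> 0 \<and> p $ 2 = 0"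
proof -
  have C0: "C \<noteq> 0" using B by auto
  obtain i x where ix: "i \<in> I" "0 \<in> {U i, V i, W i}" "x > 0"
    "x *\<^sub>R direction 0 \<in> closed_triangle (U i) (V i) (W i)"
    using normal_vertex_tile[OF diss B order.refl] polar_decomposition(2)[OF C0 less_imp_le[OF B(3)]] by blast
  obtain a b c where abc: "x *\<^sub>R direction 0 = a *\<^sub>R U i + b *\<^sub>R V i + c *\<^sub>R W i" "0 \<le> a" "0 \<le> b" "0 \<le> c" "a + b + c = 1"
    using ix(4) unfolding closed_triangle_def convex_hull_3 by blast
  note h = dissection_vertex_mem[OF diss ix(1), THEN normal_triangle_mem(1)[OF B]]
  have e: "x = a * U i $ 1 + b * V i $ 1 + c * W i $ 1" "0 = a * U i $ 2 + b * V i $ 2 + c * W i $ 2"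
    using arg_cong[OF abc(1), of "\<lambda>v. v $ 1"] arg_cong[OF abc(1), of "\<lambda>v. v $ 2"] by simp_all
  moreover have "a * U i $ 2 \<ge> 0" "b * V i $ 2 \<ge> 0" "c * W i $ 2 \<ge> 0" using abc h by simp_all
  ultimately have z: "a = 0 \<or> U i $ 2 = 0" "b = 0 \<or> V i $ 2 = 0" "c = 0 \<or> W i $ 2 = 0"
    by (smt (verit) mult_eq_0_iff)+
  have "a * U i $ 1 \<noteq> 0 \<or> b * V i $ 1 \<noteq> 0 \<or> c * W i $ 1 \<noteq> 0" using e(1) ix(3) by auto
  then have "\<exists>p. p \<in> {U i, V i, W i} \<and> p \<noteq> 0 \<and> p $ 2 = 0" using z by fastforce
  then show ?thesis using ix(1,2) by blast
qed

text \<open>Tiles at the corner occupy intervals of directions, disjoint because their interiors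
  are, and covering because every direction enters a tile with a vertex at the corner.\<close>

lemma normal_vertex_angle_sum:
  assumes diss: "dissection I U V W (closed_triangle 0 B C)" and B: "B $ 2 = 0" "B $ 1 > 0" "C $ 2 > 0"
  shows "angle_at B 0 C = (\<Sum>i\<in>I. vertex_angle 0 (U i) (V i) (W i) + vertex_angle 0 (V i) (W i) (U i)
     + vertex_angle 0 (W i) (U i) (V i))"
proof -
  define X where "X i = closed_triangle (U i) (V i) (W i)" for i
  define va where "va i = vertex_angle 0 (U i) (V i) (W i) + vertex_angle 0 (V i) (W i) (U i)
     + vertex_angle 0 (W i) (U i) (V i)" for i
  define J where "J = {i\<in>I. 0 \<in> {U i, V i, W i}}"
  have I: "finite I" "\<And>i. i \<in> I \<Longrightarrow> nondegenerate_triangle (U i) (V i) (W i)"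
    "\<And>i j. i \<in> I \<Longrightarrow> j \<in> I \<Longrightarrow> i \<noteq> j \<Longrightarrow> interior (X i) \<inter> interior (X j) = {}"
    using diss by (auto simp: dissection_def X_def)
  have C0: "C \<noteq> 0" and B0: "B \<noteq> 0" using B by auto
  define \<xi> where "\<xi> = polar_angle C"
  note pc = polar_decomposition[OF C0 less_imp_le[OF B(3)], folded \<xi>_def]
  have "\<xi> \<noteq> pi"
  proof
    assume "\<xi> = pi"
    then have "C $ 2 = 0" using arg_cong[OF pc(1), of "\<lambda>v. v $ 2"] by simp
    then show False using B by simp
  qed
  then have \<xi>: "0 \<le> \<xi>" "\<xi> < pi" using pc by auto
  have "polar_angle B = 0"
    using B by (simp add: polar_angle_def norm_eq_sqrt_inner inner_point)
  then have ang: "angle_at B 0 C = \<xi>"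
    using angle_at_0_polar[of B C] B0 C0 B \<xi> by (simp add: \<xi>_def)
  have "\<exists>l u. cone_interval (X i) \<xi> l u \<and> u - l = va i" if i: "i \<in> J" for i
  proof -
    have iI: "i \<in> I" using i by (simp add: J_def)
    note mem = dissection_vertex_mem[OF diss iI]
    note h = mem[THEN normal_triangle_mem(1)[OF B]]
    note pa = mem[THEN normal_triangle_polar_angle[OF B], folded \<xi>_def]
    have nd: "nondegenerate_triangle (U i) (V i) (W i)" using I(2) iI .
    \<comment> \<open>Distinct vertices: at most one of the three summands of \<open>va i\<close> is
      nonzero.\<close>
    have ne: "U i \<noteq> V i" "V i \<noteq> W i" "W i \<noteq> U i"
      using nd by (auto simp: nondegenerate_triangle_def insert_commute)
    consider "U i = 0" | "V i = 0" | "W i = 0" using i by (auto simp: J_def)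
    then show ?thesis
    proof cases
      case 1
      have "va i = angle_at (V i) 0 (W i)" using 1 ne by (auto simp: va_def vertex_angle_def)
      then show ?thesis
        using triangle_cone_interval[of "V i" "W i" \<xi>] nd h pa \<xi> ne 1 by (auto simp: X_def)
    next
      case 2
      have "va i = angle_at (W i) 0 (U i)" using 2 ne by (auto simp: va_def vertex_angle_def)
      moreover have "X i = closed_triangle 0 (W i) (U i)" "nondegenerate_triangle 0 (W i) (U i)"
        using nd by (simp_all add: X_def closed_triangle_def nondegenerate_triangle_def 2 insert_commute)
      ultimately show ?thesis
        using triangle_cone_interval[of "W i" "U i" \<xi>] h pa \<xi> ne 2 by auto
    next
      case 3
      have "va i = angle_at (U i) 0 (V i)" using 3 ne by (auto simp: va_def vertex_angle_def)
      moreover have "X i = closed_triangle 0 (U i) (V i)" "nondegenerate_triangle 0 (U i) (V i)"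
        using nd by (simp_all add: X_def closed_triangle_def nondegenerate_triangle_def 3 insert_commute)
      ultimately show ?thesis
        using triangle_cone_interval[of "U i" "V i" \<xi>] h pa \<xi> ne 3 by auto
    qed
  qed
  then obtain l u where lu: "\<And>i. i \<in> J \<Longrightarrow> cone_interval (X i) \<xi> (l i) (u i)" "\<And>i. i \<in> J \<Longrightarrow> u i - l i = va i"
    by metis
  have "\<xi> = (\<Sum>i\<in>J. u i - l i)"
  proof (rule interval_lengths_sum[of J "{}"])
    show "finite J" using I(1) by (simp add: J_def)
    show "0 \<le> l i \<and> l i \<le> u i \<and> u i \<le> \<xi>" if "i \<in> J" for i
      using lu(1)[OF that] by (simp add: cone_interval_def)
    show "{l i<..<u i} \<inter> {l j<..<u j} = {}" if ij: "i \<in> J" "j \<in> J" "i \<noteq> j" for i j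
    proof (rule ccontr)
      assume "\<not> ?thesis"
      then obtain t where "t \<in> {l i<..<u i} \<inter> {l j<..<u j}" by blast
      then have t: "l i < t" "t < u i" "l j < t" "t < u j" by simp_all
      then have "\<forall>\<^sub>F x in at_right 0. x *\<^sub>R direction t \<in> interior (X i)"
        "\<forall>\<^sub>F x in at_right 0. x *\<^sub>R direction t \<in> interior (X j)"
        using lu(1) ij by (auto simp: cone_interval_def)
      then have "\<forall>\<^sub>F x in at_right (0::real). False"
        by eventually_elim (use I(3)[of i j] ij in \<open>auto simp: J_def\<close>)
      then show False by simp
    qed
    show "{0..\<xi>} \<subseteq> {} \<union> (\<Union>i\<in>J. {l i..u i})"
    proof
      fix t assume t: "t \<in> {0..\<xi>}"
      then obtain i x where ix: "i \<in> I" "0 \<in> {U i, V i, W i}" "x > 0" "x *\<^sub>R direction t \<in> X i"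
        using normal_vertex_tile[OF diss B, of t] by (auto simp: \<xi>_def X_def)
      then have "i \<in> J" by (simp add: J_def)
      moreover have "l i \<le> t \<and> t \<le> u i"
        using lu(1)[OF \<open>i \<in> J\<close>] ix(3,4) t unfolding cone_interval_def atLeastAtMost_iff by blast
      ultimately show "t \<in> {} \<union> (\<Union>i\<in>J. {l i..u i})" by auto
    qed
  qed (use \<xi> in auto)
  also have "\<dots> = (\<Sum>i\<in>J. va i)" using lu(2) by simp
  also have "\<dots> = (\<Sum>i\<in>I. va i)"
    by (rule sum.mono_neutral_left) (use I(1) in \<open>auto simp: J_def va_def vertex_angle_def\<close>)
  finally show ?thesis using ang by (simp add: va_def)
qed

text \<open>The isometry to normal position keeps angles and segments. The second claim supplies the
  particular tile whose edge at the corner can be compared with the edge counts of the side.\<close>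

lemma vertex_angle_sum:
  assumes diss: "dissection I U V W (closed_triangle A B C)" and nd: "nondegenerate_triangle A B C"
  shows "angle_at B A C = (\<Sum>i\<in>I. vertex_angle A (U i) (V i) (W i) + vertex_angle A (V i) (W i) (U i)
     + vertex_angle A (W i) (U i) (V i))"
    and "\<exists>i\<in>I. \<exists>p. A \<in> {U i, V i, W i} \<and> p \<in> {U i, V i, W i} \<and> p \<noteq> A \<and> p \<in> closed_segment A B"
proof -
  obtain f where f: "similarity 1 f" "f A = 0" "f B $ 1 = dist A B" "f B $ 2 = 0" "f C $ 2 > 0"
    using normal_position[OF nd] by blast
  have AB: "f B $ 1 > 0" using nd f(3) by (auto simp: nondegenerate_triangle_def)
  have d: "dissection I (\<lambda>i. f (U i)) (\<lambda>i. f (V i)) (\<lambda>i. f (W i)) (closed_triangle 0 (f B) (f C))"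
    using dissection_image[OF diss f(1)] similarity_triangle[OF f(1), of A B C] f(2) by simp
  have inj: "inj f" using similarity_bij[OF f(1)] by (simp add: bij_def)
  have v: "vertex_angle 0 (f p) (f q) (f r) = vertex_angle A p q r" for p q r
    using similarity_angle_at[OF f(1), of q A r] f(2) inj
    by (auto simp: vertex_angle_def inj_def) 
  have "angle_at (f B) 0 (f C) = angle_at B A C"
    using similarity_angle_at[OF f(1), of B A C] f(2) by simp
  then show "angle_at B A C = (\<Sum>i\<in>I. vertex_angle A (U i) (V i) (W i) + vertex_angle A (V i) (W i) (U i)
     + vertex_angle A (W i) (U i) (V i))"
    using normal_vertex_angle_sum[OF d f(4) AB f(5)] by (simp add: v)
  obtain i p where ip: "i \<in> I" "0 \<in> {f (U i), f (V i), f (W i)}" "p \<in> {f (U i), f (V i), f (W i)}" "p \<noteq> 0" "p $ 2 = 0"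
    using normal_vertex_edge[OF d f(4) AB f(5)] by blast
  obtain q where q: "q \<in> {U i, V i, W i}" "p = f q" using ip(3) by blast
  have "A \<in> {U i, V i, W i}" using ip(2) f(2) inj by (auto simp: inj_def)
  moreover have "q \<noteq> A" using q ip(4) f(2) by auto
  moreover have "q \<in> closed_segment A B"
  proof -
    have "q \<in> closed_triangle A B C" using dissection_vertex_mem[OF diss ip(1)] q(1) by blast
    then have "f q \<in> closed_triangle 0 (f B) (f C)"
      using imageI[of q "closed_triangle A B C" f] similarity_triangle[OF f(1), of A B C] f(2) by simp
    then have "f q \<in> closed_segment 0 (f B)"
      using normal_triangle_mem(2)[OF f(4) AB f(5)] normal_triangle_segment[OF f(4) AB] ip(5) q(2) by simp
    then show ?thesis
      using similarity_closed_segment[OF f(1), of A B] inj f(2) by (metis inj_image_mem_iff)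
  qed
  ultimately show "\<exists>i\<in>I. \<exists>p. A \<in> {U i, V i, W i} \<and> p \<in> {U i, V i, W i} \<and> p \<noteq> A \<and> p \<in> closed_segment A B"
    using ip(1) q(1) by blast
qed

section \<open>Right triangles\<close>

lemma angle_at_commute: "angle_at P Q R = angle_at R Q P"
  by (simp add: angle_at_def inner_commute mult.commute)

text \<open>Cauchy-Schwarz keeps the argument of \<open>arccos\<close> in its range, so that taking
  the cosine undoes it.\<close>

lemma right_angle_iff:
  assumes "P \<noteq> Q" "R \<noteq> Q"
  shows "angle_at P Q R = pi / 2 \<longleftrightarrow> (P - Q) \<bullet> (R - Q) = 0"
proof -
  define x where "x = ((P - Q) \<bullet> (R - Q)) / (norm (P - Q) * norm (R - Q))"
  have n: "norm (P - Q) * norm (R - Q) > 0" using assms by simp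
  have "\<bar>(P - Q) \<bullet> (R - Q)\<bar> \<le> norm (P - Q) * norm (R - Q)" by (rule Cauchy_Schwarz_ineq2)
  then have "\<bar>x\<bar> \<le> 1" unfolding x_def abs_divide abs_of_pos[OF n] divide_le_eq_1_pos[OF n] .
  then have c: "cos (arccos x) = x" by (rule cos_arccos_abs)
  have "arccos x = pi / 2 \<longleftrightarrow> x = 0"
  proof
    assume "arccos x = pi / 2"
    then show "x = 0" using c cos_pi_half by metis
  qed simp
  then show ?thesis using assms by (simp add: angle_at_def x_def)
qed

text \<open>All trigonometry is derived from \<open>\<xi>\<close>, an acute angle whose cosine and
  sine are the leg ratios; \<open>\<eta>\<close> is recognised as \<open>pi / 2 - \<xi>\<close>
  because both have cosine \<open>a / c\<close>.\<close>

lemma right_triangle_angles: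
  fixes A B C :: point
  assumes nd: "nondegenerate_triangle A B C" and perp: "(A - C) \<bullet> (B - C) = 0"
  defines "\<xi> \<equiv> angle_at B A C" and "\<eta> \<equiv> angle_at C B A"
  shows "(dist B C)\<^sup>2 + (dist A C)\<^sup>2 = (dist A B)\<^sup>2" "cos \<xi> = dist A C / dist A B" "tan \<xi> = dist B C / dist A C"
    "\<xi> + \<eta> = pi / 2" "0 < \<xi>" "0 < \<eta>" "angle_at A C B = pi / 2"
proof -
  define p q where "p = A - C" and "q = B - C"
  define a b c where "a = dist B C" and "b = dist A C" and "c = dist A B"
  have ne: "A \<noteq> C" "B \<noteq> C" "A \<noteq> B" using nd by (auto simp: nondegenerate_triangle_def insert_commute)
  have abc: "a > 0" "b > 0" "c > 0" using ne by (auto simp: a_def b_def c_def)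
  have pq: "p \<bullet> q = 0" "q \<bullet> p = 0" "p \<bullet> p = b\<^sup>2" "q \<bullet> q = a\<^sup>2"
    using perp by (auto simp: p_def q_def a_def b_def dist_norm power2_norm_eq_inner inner_commute)
  have v: "A - B = p - q" "B - A = q - p" "C - A = - p" "C - B = - q" by (simp_all add: p_def q_def)
  have py: "a\<^sup>2 + b\<^sup>2 = c\<^sup>2"
    unfolding c_def dist_norm power2_norm_eq_inner v using pq by (simp add: inner_simps)
  then show "(dist B C)\<^sup>2 + (dist A C)\<^sup>2 = (dist A B)\<^sup>2" by (simp add: a_def b_def c_def)
  have nm: "norm (B - A) = c" "norm (C - A) = b" "norm (C - B) = a" "norm (A - B) = c"
    by (simp_all add: a_def b_def c_def dist_norm norm_minus_commute)
  have "(B - A) \<bullet> (C - A) = b\<^sup>2" "(C - B) \<bullet> (A - B) = a\<^sup>2"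
    unfolding v using pq by (simp_all add: inner_simps)
  then have x: "\<xi> = arccos (b / c)" and e: "\<eta> = arccos (a / c)"
    unfolding \<xi>_def \<eta>_def angle_at_def nm using abc by (simp_all add: power2_eq_square)
  have "b\<^sup>2 < c\<^sup>2" "a\<^sup>2 < c\<^sup>2" using abc unfolding py[symmetric] by simp_all
  then have lt: "b < c" "a < c" using abc power2_less_imp_less less_imp_le by blast+
  have r: "0 < b / c" "b / c < 1" using abc lt by auto
  show cx: "cos \<xi> = dist A C / dist A B"
    unfolding x using r by (simp add: b_def c_def)
  have x0: "0 < \<xi>" "\<xi> < pi / 2"
    unfolding x using arccos_less_arccos[of "b / c" 1] arccos_less_arccos[of 0 "b / c"] r by simp_all
  then show "0 < \<xi>" by simp
  have "(sin \<xi>)\<^sup>2 = (a / c)\<^sup>2"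
  proof -
    have "(a / c)\<^sup>2 + (b / c)\<^sup>2 = 1" using abc py by (simp add: power_divide add_divide_distrib[symmetric])
    then show ?thesis unfolding sin_squared_eq cx by (simp add: b_def c_def)
  qed
  then have sx: "sin \<xi> = a / c"
    using x0 abc power2_eq_imp_eq[of "sin \<xi>" "a / c"] by (simp add: sin_ge_zero)
  show "tan \<xi> = dist B C / dist A C"
    unfolding tan_def cx sx using abc by (simp add: a_def b_def c_def)
  have "\<eta> = arccos (cos (pi / 2 - \<xi>))" unfolding e sx[symmetric] by (simp add: cos_diff)
  also have "\<dots> = pi / 2 - \<xi>" using x0 by (intro arccos_cos) auto
  finally show "\<xi> + \<eta> = pi / 2" by simp
  then show "0 < \<eta>" using x0 by simp
  show "angle_at A C B = pi / 2" using right_angle_iff[of A C B] ne perp by simp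
qed

text \<open>The tiles themselves serve as indices; choosing one similarity for each names its
  vertices.\<close>

lemma tiled_by_dissection:
  assumes "tiled_by S S r N" "S = closed_triangle A B C" "nondegenerate_triangle A B C"
  obtains I :: "point set set" and f where "dissection I (\<lambda>i. f i A) (\<lambda>i. f i B) (\<lambda>i. f i C) S"
    "\<And>i. i \<in> I \<Longrightarrow> similarity r (f i)"
proof -
  obtain I where t: "finite I" "\<And>X. X \<in> I \<Longrightarrow> \<exists>f. similarity r f \<and> f ` S = X"
      "pairwise (\<lambda>X Y. interior X \<inter> interior Y = {}) I" "\<Union>I = S"
    using assms(1) by (auto simp: tiled_by_def)
  then obtain f where f: "\<And>X. X \<in> I \<Longrightarrow> similarity r (f X)" "\<And>X. X \<in> I \<Longrightarrow> f X ` S = X" by metis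
  have tri: "closed_triangle (f X A) (f X B) (f X C) = X" if "X \<in> I" for X
    using similarity_triangle[OF f(1)[OF that]] f(2)[OF that] assms(2) by simp
  have "dissection I (\<lambda>i. f i A) (\<lambda>i. f i B) (\<lambda>i. f i C) S"
    unfolding dissection_def using t(1,3,4) similarity_nondegenerate[OF f(1)] assms(3)
    by (auto simp: tri pairwise_def)
  then show ?thesis using that f(1) by blast
qed

section \<open>Edge counts and the case of irrational scale\<close>

definition edge_count :: "'i set \<Rightarrow> ('i \<Rightarrow> point \<Rightarrow> point) \<Rightarrow> point \<Rightarrow> point \<Rightarrow> point \<Rightarrow> point \<Rightarrow> nat" where
  "edge_count I f X Y P Q = card {i\<in>I. f i P \<in> closed_segment X Y \<and> f i Q \<in> closed_segment X Y}"

lemma sum_edge_overlap: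
  assumes "finite I" "\<And>i. i \<in> I \<Longrightarrow> similarity r (f i)"
  shows "(\<Sum>i\<in>I. edge_overlap X Y (f i P) (f i Q)) = real (edge_count I f X Y P Q) * (r * dist P Q)"
proof -
  have "(\<Sum>i\<in>I. edge_overlap X Y (f i P) (f i Q)) =
      (\<Sum>i\<in>I. if f i P \<in> closed_segment X Y \<and> f i Q \<in> closed_segment X Y then r * dist P Q else 0)"
    using similarity_dist[OF assms(2)] by (intro sum.cong) (simp_all add: edge_overlap_def)
  then show ?thesis using assms(1) by (simp add: edge_count_def sum.If_cases Int_def)
qed

lemma edge_count_eq_0D:
  assumes "edge_count I f X Y P Q = 0" "finite I" "i \<in> I"
  shows "\<not> (f i P \<in> closed_segment X Y \<and> f i Q \<in> closed_segment X Y)"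
  using assms by (auto simp: edge_count_def)

text \<open>If all tile edges on \<open>AB\<close> are images of the leg \<open>BC\<close>, then the tile at \<open>A\<close> touching \<open>AB\<close>
  has its image of \<open>B\<close> there, since no right angle fits at \<open>A\<close>.  Hence angle \<open>A\<close> is a multiple of
  angle \<open>B\<close>, and its rational cosine forces it to be \<open>pi / 3\<close>.\<close>

lemma short_leg_edges:
  fixes A B C :: point
  assumes nd: "nondegenerate_triangle A B C" and perp: "(A - C) \<bullet> (B - C) = 0"
    and diss: "dissection I (\<lambda>i. f i A) (\<lambda>i. f i B) (\<lambda>i. f i C) (closed_triangle A B C)"
    and sim: "\<And>i. i \<in> I \<Longrightarrow> similarity r (f i)"
    and cnt: "edge_count I f A B A B = 0" "edge_count I f A B C A = 0"
    and rat: "dist A C / dist A B \<in> \<rat>"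
  shows "angle_at B A C = pi / 3"
proof -
  define \<xi> \<eta> where "\<xi> = angle_at B A C" and "\<eta> = angle_at C B A"
  note ang = right_triangle_angles[OF nd perp, folded \<xi>_def \<eta>_def]
  have fin: "finite I" using diss by (simp add: dissection_def)
  define nA nB nC where "nA = card {i\<in>I. f i A = A}" and "nB = card {i\<in>I. f i B = A}" and "nC = card {i\<in>I. f i C = A}"
  have va: "vertex_angle A (f i P) (f i Q) (f i R) = (if f i P = A then angle_at Q P R else 0)" if "i \<in> I" for i P Q R
    using similarity_angle_at[OF sim[OF that], of Q P R] by (auto simp: vertex_angle_def)
  have s: "(\<Sum>i\<in>I. if f i P = A then x else 0) = real (card {i\<in>I. f i P = A}) * x" for P and x :: real
    using fin by (simp add: sum.If_cases Int_def)
  have "\<xi> = (\<Sum>i\<in>I. (if f i A = A then \<xi> else 0) + (if f i B = A then \<eta> else 0) + (if f i C = A then pi / 2 else 0))"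
    unfolding \<xi>_def \<eta>_def ang(7)[symmetric] using vertex_angle_sum(1)[OF diss nd] va by simp
  then have sum: "\<xi> = nA * \<xi> + nB * \<eta> + nC * (pi / 2)"
    unfolding sum.distrib s nA_def nB_def nC_def .
  \<comment> \<open>A right angle does not fit at \<open>A\<close>: it exceeds \<open>\<xi>\<close>
    by the positive \<open>\<eta>\<close>.\<close>
  have nC: "nC = 0"
  proof (rule ccontr)
    assume "nC \<noteq> 0"
    then have "real nC * (pi / 2) \<ge> 1 * (pi / 2)" by (intro mult_right_mono) auto
    moreover have "nA * \<xi> \<ge> 0" "nB * \<eta> \<ge> 0" using ang by simp_all
    ultimately show False using sum ang(4,6) by linarith
  qed
  obtain i p where ip: "i \<in> I" "A \<in> {f i A, f i B, f i C}" "p \<in> {f i A, f i B, f i C}" "p \<noteq> A" "p \<in> closed_segment A B"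
    using vertex_angle_sum(2)[OF diss nd] by blast
  have "f i C \<noteq> A" using nC ip(1) fin by (auto simp: nC_def)
  \<comment> \<open>If the image of \<open>A\<close> were at \<open>A\<close>, the other endpoint
    \<open>p\<close> on \<open>AB\<close> would be an image of \<open>B\<close> or \<open>C\<close>,
    giving an edge counted by one of the two vanishing numbers.\<close>
  moreover have "f i A \<noteq> A"
    using edge_count_eq_0D[OF cnt(1) fin ip(1)] edge_count_eq_0D[OF cnt(2) fin ip(1)] ip(3-5) by auto
  ultimately have "f i B = A" using ip(2) by auto
  then have "i \<in> {i\<in>I. f i B = A}" using ip(1) by simp
  then have nB: "nB \<ge> 1" unfolding nB_def using fin by (metis (no_types, lifting) One_nat_def Suc_leI card_gt_0_iff empty_iff finite_subset mem_Collect_eq subsetI)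
  have "nB * \<eta> \<ge> 1 * \<eta>" using nB ang(6) by (intro mult_right_mono) auto
  \<comment> \<open>One angle \<open>\<eta>\<close> is already used up at the corner, so
    \<open>\<xi>\<close> itself no longer fits.\<close>
  have "nA = 0"
  proof (rule ccontr)
    assume "nA \<noteq> 0"
    then have "nA * \<xi> \<ge> 1 * \<xi>" using ang(5) by (intro mult_right_mono) auto
    then show False using sum nC \<open>nB * \<eta> \<ge> 1 * \<eta>\<close> ang(6) by simp
  qed
  then have "\<xi> = nB * \<eta>" using sum nC by simp
  moreover have "cos \<xi> \<in> \<rat>" using ang(2) rat by simp
  ultimately have "\<xi> = pi / 3" using rational_cos_eq_pi_third[of \<xi> nB \<eta>] ang by auto
  then show ?thesis by (simp add: \<xi>_def)
qed

text \<open>The zero patterns say which tile edge alone covers two of the sides: the hypotenuse both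
  legs, or one leg the other leg and the hypotenuse. The last possibility occurs twice, once for
  each leg.\<close>

lemma tiled_by_nonsquare_cases:
  fixes A B C :: point
  assumes nd: "nondegenerate_triangle A B C" and perp: "(A - C) \<bullet> (B - C) = 0"
    and til: "tiled_by S S r N" and S: "S = closed_triangle A B C" and nsq: "\<not> (\<exists>k::nat. N = k\<^sup>2)"
  shows "(\<exists>p q::nat. N = p\<^sup>2 + q\<^sup>2 \<and> q > 0 \<and> dist B C * q = dist A C * p) \<or>
    (\<exists>k::nat. N = 3 * k\<^sup>2) \<and> (angle_at B A C = pi / 3 \<or> angle_at C B A = pi / 3)"
proof -
  define a b c where "a = dist B C" and "b = dist A C" and "c = dist A B"
  have ne: "A \<noteq> C" "B \<noteq> C" "A \<noteq> B" using nd by (auto simp: nondegenerate_triangle_def insert_commute)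
  have abc: "a > 0" "b > 0" "c > 0" using ne by (auto simp: a_def b_def c_def)
  note ang = right_triangle_angles[OF nd perp]
  have py: "a\<^sup>2 + b\<^sup>2 = c\<^sup>2" using ang(1) by (simp add: a_def b_def c_def)
  obtain I :: "point set set" and f where diss: "dissection I (\<lambda>i. f i A) (\<lambda>i. f i B) (\<lambda>i. f i C) S"
    and sim: "\<And>i. i \<in> I \<Longrightarrow> similarity r (f i)"
    using tiled_by_dissection[OF til S nd] by blast
  have fin: "finite I" using diss by (simp add: dissection_def)
  have Nr: "real N * r\<^sup>2 = 1" by (rule tiled_by_ratio[OF til S nd])
  have "I \<noteq> {}" using diss S vertices_mem_closed_triangle(1)[of A B C] by (auto simp: dissection_def)
  then have r: "r > 0" using sim similarity_pos by blast
  define l where "l = sqrt (real N)"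
  \<comment> \<open>The area identity makes \<open>l\<close> the reciprocal of the tile scale, so
    multiplying a side equation by \<open>l\<close> removes \<open>r\<close>.\<close>
  have "(l * r)\<^sup>2 = 1" using Nr by (simp add: l_def power_mult_distrib)
  then have lr: "l * r = 1" using r by (simp add: l_def power2_eq_1_iff) (smt (verit) mult_nonneg_nonneg real_sqrt_ge_zero of_nat_0_le_iff)
  have l: "l \<notin> \<rat>" "l\<^sup>2 \<in> \<rat>" "l > 0" "l\<^sup>2 = real N"
    using sqrt_nonsquare_irrational[OF nsq] lr r zero_less_mult_pos2[of l r] by (auto simp: l_def)
  have edge_sums: "(\<Sum>i\<in>I. edge_overlap X Y (f i P) (f i Q)) = real (edge_count I f X Y P Q) * (r * dist P Q)"
    for X Y P Q by (rule sum_edge_overlap) (use fin sim in auto)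
  define d where "d X Y P Q = edge_count I f X Y P Q" for X Y P Q
  have side: "l * dist X Y = real (d X Y B C) * a + real (d X Y C A) * b + real (d X Y A B) * c"
    if "S = closed_triangle X Y Z" "nondegenerate_triangle X Y Z" for X Y Z
  proof -
    have "dist X Y = real (d X Y A B) * (r * dist A B) + real (d X Y B C) * (r * dist B C) + real (d X Y C A) * (r * dist C A)"
      using edge_length_sum[OF diss[unfolded that(1)] that(2)]
      unfolding sum.distrib edge_sums d_def .
    then have "l * dist X Y = (l * r) * (real (d X Y B C) * a + real (d X Y C A) * b + real (d X Y A B) * c)"
      by (simp add: a_def b_def c_def dist_commute algebra_simps)
    then show ?thesis using lr by simp
  qed
  have perm: "S = closed_triangle B C A" "S = closed_triangle C A B"
      "nondegenerate_triangle B C A" "nondegenerate_triangle C A B"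
    using S nd by (simp_all add: closed_triangle_def nondegenerate_triangle_def insert_commute)
  have eqs: "l * a = real (d B C B C) * a + real (d B C C A) * b + real (d B C A B) * c"
    "l * b = real (d C A B C) * a + real (d C A C A) * b + real (d C A A B) * c"
    "l * c = real (d A B B C) * a + real (d A B C A) * b + real (d A B A B) * c"
    using side[OF perm(1,3)] side[OF perm(2,4)] side[OF S nd] by (simp_all add: a_def b_def c_def dist_commute)
  \<comment> \<open>Here \<open>y\<close> is the short leg, covered by \<open>k\<close> copies of
    the long leg \<open>x\<close>; comparing squares gives
    \<open>l\<^sup>2 = 3 * k\<^sup>2\<close>.\<close>
  have sq3: "N = 3 * k\<^sup>2" if "l * y = real k * x" "x\<^sup>2 = 3 * y\<^sup>2" "y > 0" for k x y
  proof -
    have "l\<^sup>2 * y\<^sup>2 = (real k)\<^sup>2 * x\<^sup>2" using that(1) by (metis power_mult_distrib)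
    then have "real N * y\<^sup>2 = real (3 * k\<^sup>2) * y\<^sup>2" using that(2) l(4) by (simp add: ac_simps)
    then have "real N = real (3 * k\<^sup>2)" using that(3) by simp
    then show ?thesis by (simp only: of_nat_eq_iff)
  qed
  have third: "x\<^sup>2 = 3 * y\<^sup>2" if "y / c = 1 / 2" "x\<^sup>2 + y\<^sup>2 = c\<^sup>2" for x y
  proof -
    have "c = 2 * y" using that(1) abc by (simp add: field_simps)
    then show ?thesis using that(2) by (simp add: power_mult_distrib)
  qed
  from side_matrix_zero_pattern[OF l(1-3) abc py eqs]
  consider (c) "d B C B C = 0" "d B C C A = 0" "d C A B C = 0" "d C A C A = 0"
    | (a) "d C A C A = 0" "d C A A B = 0" "d A B C A = 0" "d A B A B = 0"
    | (b) "d B C B C = 0" "d B C A B = 0" "d A B B C = 0" "d A B A B = 0" by metis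
  then show ?thesis
  proof cases
    case c
    \<comment> \<open>The numbers of hypotenuses covering \<open>BC\<close> and \<open>CA\<close>.
      Pythagoras turns the two side equations into a sum of squares for \<open>N\<close>.\<close>
    define p q where "p = d B C A B" and "q = d C A A B"
    have e: "l * a = real p * c" "l * b = real q * c" using eqs(1,2) c by (simp_all add: p_def q_def)
    have "(l * a)\<^sup>2 + (l * b)\<^sup>2 = l\<^sup>2 * c\<^sup>2"
      using py by (simp add: power_mult_distrib distrib_left[symmetric])
    then have "((real p)\<^sup>2 + (real q)\<^sup>2) * c\<^sup>2 = real N * c\<^sup>2"
      unfolding e l(4) by (simp add: power_mult_distrib distrib_right)
    then have "real N = real (p\<^sup>2 + q\<^sup>2)" using abc by simp
    then have "N = p\<^sup>2 + q\<^sup>2" by (simp only: of_nat_eq_iff)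
    moreover have "q > 0" using e(2) l abc by (cases "q = 0") auto
    moreover have "a * q = b * p"
    proof -
      have "l * (a * q) = (l * a) * q" by simp
      also have "\<dots> = (l * b) * p" unfolding e by simp
      finally show ?thesis using l(3) by simp
    qed
    ultimately show ?thesis by (auto simp: a_def b_def)
  next
    case a
    have e: "l * b = real (d C A B C) * a" "l * c = real (d A B B C) * a" using eqs(2,3) a by simp_all
    \<comment> \<open>Both sides at \<open>A\<close> consist of copies of the leg \<open>a\<close>,
      so the cosine of the angle at \<open>A\<close> is a quotient of counts.\<close>
    have "b / c = (l * b) / (l * c)" using l(3) by simp
    also have "\<dots> = real (d C A B C) / real (d A B B C)" unfolding e using abc by simp
    finally have rat: "dist A C / dist A B \<in> \<rat>" by (simp add: b_def c_def)
    have A: "angle_at B A C = pi / 3"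
      by (rule short_leg_edges[OF nd perp diss[unfolded S] sim _ _ rat]) (use a in \<open>simp_all add: d_def\<close>)
    have "b / c = 1 / 2" unfolding b_def c_def using ang(2) A cos_60 by metis
    then have "N = 3 * (d C A B C)\<^sup>2" using sq3[OF e(1)] third[of b a] py abc by simp
    then show ?thesis using A by blast
  next
    case b
    have e: "l * a = real (d B C C A) * b" "l * c = real (d A B C A) * b" using eqs(1,3) b by simp_all
    have "a / c = (l * a) / (l * c)" using l(3) by simp
    also have "\<dots> = real (d B C C A) / real (d A B C A)" unfolding e using abc by simp
    finally have rat: "dist B C / dist B A \<in> \<rat>" by (simp add: a_def c_def dist_commute)
    have nd': "nondegenerate_triangle B A C" using nd by (simp add: nondegenerate_triangle_perm)
    have perp': "(B - C) \<bullet> (A - C) = 0" using perp by (simp add: inner_commute)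
    \<comment> \<open>The preceding case with \<open>A\<close> and \<open>B\<close> exchanged; a
      dissection does not depend on the order in which the vertices are named.\<close>
    have diss': "dissection I (\<lambda>i. f i B) (\<lambda>i. f i A) (\<lambda>i. f i C) (closed_triangle B A C)"
    proof -
      have "dissection I (\<lambda>i. f i B) (\<lambda>i. f i A) (\<lambda>i. f i C) X = dissection I (\<lambda>i. f i A) (\<lambda>i. f i B) (\<lambda>i. f i C) X" for X
        by (simp only: dissection_def closed_triangle_perm(1) nondegenerate_triangle_perm(1))
      then show ?thesis using diss unfolding S closed_triangle_perm(1)[of B A] by simp
    qed
    have B: "angle_at A B C = pi / 3"
      by (rule short_leg_edges[OF nd' perp' diss' sim _ _ rat])
        (use b in \<open>auto simp: d_def edge_count_def closed_segment_commute conj_commute\<close>)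
    have "a / c = 1 / 2"
      unfolding a_def c_def using right_triangle_angles(2)[OF nd' perp'] B cos_60 dist_commute by metis
    then have "N = 3 * (d B C C A)\<^sup>2" using sq3[OF e(1)] third[of a b] py abc by (simp add: add.commute)
    then show ?thesis using B angle_at_commute by metis
  qed
qed

text \<open>\<open>\<alpha>\<close> lies opposite the shorter leg, so
  \<open>tan \<alpha> \<le> 1\<close>. This excludes \<open>\<alpha> = pi / 3\<close>; an angle of
  60 degrees is then the other one, whence \<open>\<alpha> = pi / 6\<close>. Irrationality of
  \<open>sqrt 3\<close> separates that case from rational tangents.\<close>

lemma right_triangle_tilings:
  fixes A B C :: point
  assumes nd: "nondegenerate_triangle A B C" and perp: "(A - C) \<bullet> (B - C) = 0"
    and le: "dist B C \<le> dist A C" and N: "N > 0"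
  defines "S \<equiv> closed_triangle A B C" and "\<alpha> \<equiv> angle_at B A C"
  shows "(tan \<alpha> \<in> \<rat> \<longrightarrow> ((\<exists>r. tiled_by S S r N) \<longleftrightarrow> (\<exists>k::nat. N = k\<^sup>2) \<or>
        (\<exists>e f :: int. f \<noteq> 0 \<and> int N = e\<^sup>2 + f\<^sup>2 \<and> tan \<alpha> = of_int e / of_int f))) \<and>
     (\<alpha> = pi / 6 \<longrightarrow> ((\<exists>r. tiled_by S S r N) \<longleftrightarrow> (\<exists>k::nat. N = k\<^sup>2) \<or> (\<exists>k::nat. N = 3 * k\<^sup>2))) \<and>
     (tan \<alpha> \<notin> \<rat> \<and> \<alpha> \<noteq> pi / 6 \<longrightarrow> ((\<exists>r. tiled_by S S r N) \<longleftrightarrow> (\<exists>k::nat. N = k\<^sup>2)))"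
proof -
  define a b where "a = dist B C" and "b = dist A C"
  have ne: "A \<noteq> C" "B \<noteq> C" "A \<noteq> B" using nd by (auto simp: nondegenerate_triangle_def insert_commute)
  have ab: "a > 0" "b > 0" "a \<le> b" using ne le by (auto simp: a_def b_def)
  note ang = right_triangle_angles[OF nd perp, folded \<alpha>_def]
  have tan: "tan \<alpha> = a / b" using ang(3) by (simp add: a_def b_def)
  have tan_le: "tan \<alpha> \<le> 1" using tan ab by simp
  have not60: "\<alpha> \<noteq> pi / 3"
  proof
    assume "\<alpha> = pi / 3"
    then have "tan \<alpha> = sqrt 3" by (simp only: tan_60)
    then show False using tan_le by simp
  qed
  have sqrt3: "sqrt 3 \<notin> \<rat>"
  proof -
    have "\<not> (\<exists>k::nat. 3 = k\<^sup>2)"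
    proof
      assume "\<exists>k::nat. 3 = k\<^sup>2"
      then obtain k :: nat where k: "k\<^sup>2 = 3" by metis
      then have "k < 2" using power_less_imp_less_base[of k 2 2] by simp
      then have "k = 0 \<or> k = 1" by auto
      then show False using k by auto
    qed
    then show ?thesis using sqrt_nonsquare_irrational[of 3] by simp
  qed
  have irr30: "tan \<alpha> \<notin> \<rat>" if "\<alpha> = pi / 6"
  proof
    assume "tan \<alpha> \<in> \<rat>"
    then have "inverse (tan \<alpha>) \<in> \<rat>" by simp
    then show False using sqrt3 that by (simp add: tan_30)
  qed
  have square: "\<exists>r. tiled_by S S r N" if "\<exists>k::nat. N = k\<^sup>2"
  proof -
    obtain k where k: "N = k\<^sup>2" using \<open>\<exists>k. N = k\<^sup>2\<close> by blast
    then have "k > 0" using N by (cases k) auto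
    then show ?thesis using tiled_by_square[OF nd] k by (auto simp: S_def)
  qed
  have sums: "\<exists>r. tiled_by S S r N"
    if ef: "f \<noteq> 0" "int N = e\<^sup>2 + f\<^sup>2" "tan \<alpha> = of_int e / of_int f" for e f :: int
  proof -
    have "tan \<alpha> > 0" using tan ab by simp
    \<comment> \<open>Since the tangent is positive, \<open>e\<close> and \<open>f\<close> may be
      replaced by their absolute values.\<close>
    then have t: "tan \<alpha> = \<bar>of_int e\<bar> / \<bar>of_int f\<bar>" using ef(3) by (metis abs_divide abs_of_pos)
    define e' f' where "e' = nat \<bar>e\<bar>" and "f' = nat \<bar>f\<bar>"
    have r: "real e' = \<bar>of_int e\<bar>" "real f' = \<bar>of_int f\<bar>" by (simp_all add: e'_def f'_def)
    have e0: "e \<noteq> 0" using \<open>tan \<alpha> > 0\<close> ef(3) by auto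
    have pos: "e' > 0" "f' > 0" using e0 ef(1) by (auto simp: e'_def f'_def)
    have "a / b = real e' / real f'" using t tan r by simp
    then have "a * f' = b * e'" using ab pos by (simp add: field_simps)
    then have "\<exists>r. tiled_by S S r (f'\<^sup>2 + e'\<^sup>2)"
      unfolding S_def using tiled_by_sum_squares[OF nd perp pos] by (simp add: a_def b_def)
    moreover have "int N = int (f'\<^sup>2 + e'\<^sup>2)" using ef(2) by (simp add: e'_def f'_def)
    then have "N = f'\<^sup>2 + e'\<^sup>2" by (simp only: of_nat_eq_iff)
    ultimately show ?thesis by simp
  qed
  have three: "\<exists>r. tiled_by S S r N" if a30: "\<alpha> = pi / 6" and k: "N = 3 * k\<^sup>2" for k
  proof -
    have "k > 0" using N k by (cases k) auto
    have "a / b = 1 / sqrt 3" using tan a30 by (simp add: tan_30)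
    then have "b = a * sqrt 3" using ab by (simp add: field_simps)
    then have "b\<^sup>2 = 3 * a\<^sup>2" by (simp add: power_mult_distrib)
    then show ?thesis using tiled_by_three_squares[OF nd perp \<open>k > 0\<close>] k by (simp add: S_def a_def b_def)
  qed
  have only: "(\<exists>e f :: int. f \<noteq> 0 \<and> int N = e\<^sup>2 + f\<^sup>2 \<and> tan \<alpha> = of_int e / of_int f) \<or>
      \<alpha> = pi / 6 \<and> (\<exists>k::nat. N = 3 * k\<^sup>2)" if til: "tiled_by S S r N" and nsq: "\<not> (\<exists>k::nat. N = k\<^sup>2)" for r
    using tiled_by_nonsquare_cases[OF nd perp til S_def[THEN meta_eq_to_obj_eq] nsq]
  proof (elim disjE exE conjE)
    fix p q :: nat assume pq: "N = p\<^sup>2 + q\<^sup>2" "q > 0" "dist B C * q = dist A C * p"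
    have "tan \<alpha> = of_int (int p) / of_int (int q)"
      unfolding tan using pq(2,3) ab
      by (simp add: a_def[symmetric] b_def[symmetric] frac_eq_eq mult.commute)
    then show ?thesis using pq(1,2)
      by (intro disjI1 exI[of _ "int p"] exI[of _ "int q"]) simp
  next
    fix k assume "N = 3 * k\<^sup>2" "angle_at B A C = pi / 3"
    then show ?thesis using not60 by (simp add: \<alpha>_def)
  next
    fix k assume "N = 3 * k\<^sup>2" "angle_at C B A = pi / 3"
    then have "\<alpha> = pi / 6" using ang(4) by simp
    then show ?thesis using \<open>N = 3 * k\<^sup>2\<close> by blast
  qed
  have rat: "tan \<alpha> \<in> \<rat>" if "tan \<alpha> = of_int e / of_int f" for e f :: int unfolding that by simp
  \<comment> \<open>What remains is propositional; naming the six statements hides their quantifiers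
    and real expressions from the final search.\<close>
  define E Q where "E \<longleftrightarrow> \<alpha> = pi / 6" and "Q \<longleftrightarrow> tan \<alpha> \<in> \<rat>"
  define T SQ SM TH where "T \<longleftrightarrow> (\<exists>r. tiled_by S S r N)" and "SQ \<longleftrightarrow> (\<exists>k::nat. N = k\<^sup>2)"
    and "SM \<longleftrightarrow> (\<exists>e f :: int. f \<noteq> 0 \<and> int N = e\<^sup>2 + f\<^sup>2 \<and> tan \<alpha> = of_int e / of_int f)"
    and "TH \<longleftrightarrow> (\<exists>k::nat. N = 3 * k\<^sup>2)"
  have "SQ \<longrightarrow> T" unfolding T_def SQ_def using square by iprover
  moreover have "SM \<longrightarrow> T" unfolding T_def SM_def using sums by iprover
  moreover have "E \<longrightarrow> TH \<longrightarrow> T" unfolding T_def E_def TH_def using three by iprover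
  moreover have "SM \<longrightarrow> Q" unfolding SM_def Q_def using rat by iprover
  moreover have "E \<longrightarrow> \<not> Q" unfolding E_def Q_def using irr30 by iprover
  moreover have "T \<longrightarrow> \<not> SQ \<longrightarrow> SM \<or> E \<and> TH"
    unfolding T_def SQ_def SM_def TH_def E_def using only by iprover
  ultimately show ?thesis
    unfolding T_def[symmetric] SQ_def[symmetric] SM_def[symmetric] TH_def[symmetric]
      E_def[symmetric] Q_def[symmetric] by blast
qed

section \<open>Independence of the labelling of vertices\<close>

lemma triangle_angles_eq:
  assumes "A \<noteq> B" "B \<noteq> C" "A \<noteq> C"
  shows "triangle_angles A B C = {angle_at p q r | p q r. {p, q, r} = {A, B, C}}"
proof (intro equalityI subsetI)
  fix x assume "x \<in> triangle_angles A B C"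
  then consider "x = angle_at C A B" | "x = angle_at A B C" | "x = angle_at B C A"
    by (auto simp: triangle_angles_def)
  then show "x \<in> {angle_at p q r | p q r. {p, q, r} = {A, B, C}}"
    by cases (auto simp: insert_commute)
next
  fix x assume "x \<in> {angle_at p q r | p q r. {p, q, r} = {A, B, C}}"
  then obtain p q r where x: "x = angle_at p q r" "{p, q, r} = {A, B, C}" by blast
  have "p = A \<or> p = B \<or> p = C" "q = A \<or> q = B \<or> q = C" "r = A \<or> r = B \<or> r = C"
    "A \<in> {p, q, r}" "B \<in> {p, q, r}" "C \<in> {p, q, r}" using x(2) by blast+
  then show "x \<in> triangle_angles A B C"
    unfolding x(1) triangle_angles_def using assms angle_at_commute by (elim disjE) auto
qed

lemma nondegenerate_distinct:
  assumes "nondegenerate_triangle A B C"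
  shows "A \<noteq> B" "B \<noteq> C" "A \<noteq> C"
  using assms by (auto simp: nondegenerate_triangle_def insert_commute)

lemma triangle_angles_cong:
  assumes "nondegenerate_triangle A B C" "{A, B, C} = {A', B', C'}"
  shows "triangle_angles A' B' C' = triangle_angles A B C"
proof -
  have nd': "nondegenerate_triangle A' B' C'" using assms by (simp add: nondegenerate_triangle_def)
  show ?thesis
    unfolding triangle_angles_eq[OF nondegenerate_distinct[OF nd']]
      triangle_angles_eq[OF nondegenerate_distinct[OF assms(1)]] assms(2) ..
qed

text \<open>Similarity is a relation between point sets, so the vertices must be recovered from the
  set: they are its extreme points.\<close>

lemma closed_triangle_vertices:
  assumes "nondegenerate_triangle A B C"
  shows "{A, B, C} = {x. x extreme_point_of closed_triangle A B C}"
proof -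
  have "\<not> affine_dependent {A, B, C}"
    using assms collinear_3_eq_affine_dependent unfolding nondegenerate_triangle_def by blast
  then show ?thesis
    unfolding closed_triangle_def using extreme_point_of_convex_hull_affine_independent by blast
qed

text \<open>The image triangle and \<open>ABC\<close> coincide as sets, hence have the same vertices
  in some order, and angles depend neither on that order nor on the scale.\<close>

lemma similar_triangles_angles:
  assumes nd: "nondegenerate_triangle P Q R" "nondegenerate_triangle A B C"
    and "similar_figures (closed_triangle P Q R) (closed_triangle A B C)"
  shows "triangle_angles P Q R = triangle_angles A B C"
proof -
  obtain s f where f: "similarity s f" "f ` closed_triangle P Q R = closed_triangle A B C"
    using assms(3) by (auto simp: similar_figures_iff)
  then have "closed_triangle (f P) (f Q) (f R) = closed_triangle A B C"
    using similarity_triangle by simp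
  moreover have nd': "nondegenerate_triangle (f P) (f Q) (f R)" using similarity_nondegenerate[OF f(1)] nd by simp
  ultimately have "{f P, f Q, f R} = {A, B, C}"
    using closed_triangle_vertices nd(2) by metis
  then have "triangle_angles (f P) (f Q) (f R) = triangle_angles A B C"
    using triangle_angles_cong[OF nd'] by metis
  then show ?thesis by (simp add: triangle_angles_def similarity_angle_at[OF f(1)])
qed

text \<open>Any vertex may carry the right angle; relabelling puts it at \<open>C'\<close>, and
  exchanging the other two, if necessary, makes \<open>B'C'\<close> the leg that is not
  longer.\<close>

lemma right_triangle_ordered:
  assumes "right_triangle A B C"
  obtains A' B' C' where "{A, B, C} = {A', B', C'}" "(A' - C') \<bullet> (B' - C') = 0" "dist B' C' \<le> dist A' C'"
proof -
  note d = nondegenerate_distinct[of A B C]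
  have nd: "nondegenerate_triangle A B C" and
    "angle_at C A B = pi / 2 \<or> angle_at A B C = pi / 2 \<or> angle_at B C A = pi / 2"
    using assms by (auto simp: right_triangle_def triangle_angles_def)
  then have "(C - A) \<bullet> (B - A) = 0 \<or> (A - B) \<bullet> (C - B) = 0 \<or> (B - C) \<bullet> (A - C) = 0"
    using right_angle_iff[of C A B] right_angle_iff[of A B C] right_angle_iff[of B C A] d[OF nd] by auto
  then obtain P Q R where PQR: "{A, B, C} = {P, Q, R}" "(P - R) \<bullet> (Q - R) = 0"
  proof (elim disjE)
    assume "(C - A) \<bullet> (B - A) = 0"
    then show thesis using that[of C B A] by blast
  next
    assume "(A - B) \<bullet> (C - B) = 0"
    then show thesis using that[of A C B] by blast
  next
    assume "(B - C) \<bullet> (A - C) = 0"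
    then show thesis using that[of B A C] by blast
  qed
  show ?thesis
  proof (cases "dist Q R \<le> dist P R")
    case True
    then show ?thesis using that PQR by blast
  next
    case False
    have "{A, B, C} = {Q, P, R}" using PQR(1) by blast
    then show ?thesis using that[of Q P R] PQR(2) False by (simp add: inner_commute)
  qed
qed

text \<open>The tangent of the angle opposite the shorter leg is at most 1, so this angle is at most
  \<open>pi / 4\<close> and hence at most its complement.\<close>

lemma smallest_angle_right_triangle:
  fixes A B C :: point
  assumes nd: "nondegenerate_triangle A B C" and perp: "(A - C) \<bullet> (B - C) = 0" and le: "dist B C \<le> dist A C"
  shows "smallest_angle A B C = angle_at B A C"
proof -
  note ang = right_triangle_angles[OF nd perp]
  define \<xi> where "\<xi> = angle_at B A C"
  have "dist A C > 0" using nondegenerate_distinct[OF nd] by simp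
  then have "tan \<xi> \<le> 1" using ang(3) le by (simp add: \<xi>_def)
  have "\<xi> \<le> pi / 4"
  proof (rule ccontr)
    assume "\<not> \<xi> \<le> pi / 4"
    then have "tan (pi / 4) < tan \<xi>" using ang(4-6) by (intro tan_monotone) (auto simp: \<xi>_def)
    then show False using \<open>tan \<xi> \<le> 1\<close> by (simp add: tan_45)
  qed
  moreover have "angle_at C B A = pi / 2 - \<xi>" "\<xi> > 0" using ang(4,5) by (simp_all add: \<xi>_def)
  ultimately have "Min {\<xi>, angle_at C B A, pi / 2} = \<xi>" by (auto simp: min_def)
  then show ?thesis
    using angle_at_commute[of C A B] angle_at_commute[of A B C] angle_at_commute[of B C A] ang(7)
    by (simp add: smallest_angle_def triangle_angles_def \<xi>_def)
qed

theorem theorem6: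
  fixes A B C P Q R :: point and \<alpha> :: real and N :: nat
  assumes "right_triangle A B C"
    and "nondegenerate_triangle P Q R"
    and "similar_figures (closed_triangle P Q R) (closed_triangle A B C)"
    and "\<alpha> = smallest_angle P Q R"
    and "N > 0"
  shows
    "(tan \<alpha> \<in> \<rat> \<longrightarrow>
        (can_be_tiled N (closed_triangle A B C) (closed_triangle P Q R) \<longleftrightarrow>
          (\<exists>k::nat. N = k\<^sup>2) \<or>
          (\<exists>e f :: int. f \<noteq> 0 \<and> int N = e\<^sup>2 + f\<^sup>2 \<and> tan \<alpha> = of_int e / of_int f))) \<and>
     (\<alpha> = pi / 6 \<longrightarrow>
        (can_be_tiled N (closed_triangle A B C) (closed_triangle P Q R) \<longleftrightarrow>
          (\<exists>k::nat. N = k\<^sup>2) \<or> (\<exists>k::nat. N = 3 * k\<^sup>2))) \<and>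
     (tan \<alpha> \<notin> \<rat> \<and> \<alpha> \<noteq> pi / 6 \<longrightarrow>
        (can_be_tiled N (closed_triangle A B C) (closed_triangle P Q R) \<longleftrightarrow>
          (\<exists>k::nat. N = k\<^sup>2)))"
proof -
  have nd: "nondegenerate_triangle A B C" using assms(1) by (simp add: right_triangle_def)
  obtain A' B' C' where *: "{A, B, C} = {A', B', C'}" "(A' - C') \<bullet> (B' - C') = 0" "dist B' C' \<le> dist A' C'"
    using right_triangle_ordered[OF assms(1)] by blast
  have nd': "nondegenerate_triangle A' B' C'" using nd *(1) by (simp add: nondegenerate_triangle_def)
  have S: "closed_triangle A B C = closed_triangle A' B' C'" using *(1) by (simp add: closed_triangle_def)
  \<comment> \<open>The set of angles is unchanged by the similarity and by relabelling, and the
    smallest angle depends on this set only.\<close>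
  have "\<alpha> = smallest_angle A' B' C'"
    using similar_triangles_angles[OF assms(2) nd assms(3)] triangle_angles_cong[OF nd *(1)] assms(4)
    by (simp add: smallest_angle_def)
  then have \<alpha>: "\<alpha> = angle_at B' A' C'" using smallest_angle_right_triangle[OF nd' *(2,3)] by simp
  show ?thesis
    unfolding can_be_tiled_iff_tiled_by[OF assms(3,5)] unfolding S \<alpha>
    by (rule right_triangle_tilings[OF nd' *(2,3) assms(5)])
qed

end
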